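(* Let $G$ be a non-abelian group which is one of $D_{2n}$ ($n\ge 3$), $T_{4n}$ ($n \ge 2$), $U_{6n}$ ($n\ge 2$), $SD_{8n}$ ($n\ge 2$), $V_{8n}$ ($n \ge 2$) or $U_{(n,m)}$ ($n\ge 2$, $m\ge 2$), and let $\Gamma_G$ be its commuting conjugacy class graph. Then: (1) $E_{CN}(\Gamma_G) = LE^+_{CN}(\Gamma_G) = LE_{CN}(\Gamma_G)$ if and only if $G$ is one of $D_6, D_8, D_{10}, D_{12}, T_8, T_{12}, SD_{24}, V_{16}$, $U_{6n}$ for $n\ge 2$, or $U_{(n,m)}$ for $m\in\{3,4,6\}$ and $n\ge 2$. (2) $E_{CN}(\Gamma_G) < LE^+_{CN}(\Gamma_G) < LE_{CN}(\Gamma_G)$ if and only if $G$ is not among the groups listed in (1).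
   Context: For a finite non-abelian group $G$ with center $Z(G)$, the commuting conjugacy class graph (CCC-graph) $\Gamma_G$ is the simple undirected graph whose vertices are the conjugacy classes $x^G$ of non-central elements $x \in G \setminus Z(G)$; two distinct vertices $x^G, y^G$ are adjacent if there exist $x' \in x^G$ and $y' \in y^G$ with $x'y' = y'x'$. For a finite simple graph $\mathcal{G}$ with vertices $v_1,\dots,v_N$, let $CN(\mathcal{G})$ be the $N\times N$ matrix whose $(i,j)$ entry is, for $i\ne j$, the number of vertices other than $v_i,v_j$ adjacent to both $v_i$ and $v_j$, and whose diagonal entries are $0$. $E_{CN}(\mathcal{G})$ is the sum of the absolute values of the eigenvalues of $CN(\mathcal{G})$ (with multiplicity). Let $CNRS(\mathcal{G})$ be the diagonal matrix whose $i$-th diagonal entry is the $i$-th row sum of $CN(\mathcal{G})$. Put $CNL(\mathcal{G}) = CNRS(\mathcal{G}) - CN(\mathcal{G})$, $CNSL(\mathcal{G}) = CNRS(\mathcal{G}) + CN(\mathcal{G})$ and $\Delta(\mathcal{G}) = \operatorname{tr}(CNRS(\mathcal{G}))/N$. Then $LE_{CN}(\mathcal{G}) = \sum_{\alpha} |\alpha - \Delta(\mathcal{G})|$ over all eigenvalues $\alpha$ of $CNL(\mathcal{G})$ with multiplicity, and $LE^+_{CN}(\mathcal{G}) = \sum_{\beta} |\beta - \Delta(\mathcal{G})|$ over all eigenvalues $\beta$ of $CNSL(\mathcal{G})$ with multiplicity. Groups: $D_{2n}=\langle x,y : x^n=y^2=1,\ yxy^{-1}=x^{-1}\rangle$; $T_{4n}=\langle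 x,y : x^{2n}=1,\ x^n=y^2,\ y^{-1}xy=x^{-1}\rangle$; $U_{6n}=\langle x,y : x^{2n}=y^3=1,\ x^{-1}yx=y^{-1}\rangle$; $U_{(n,m)}=\langle x,y : x^{2n}=y^m=1,\ x^{-1}yx=y^{-1}\rangle$; $SD_{8n}=\langle x,y : x^{4n}=y^2=1,\ yxy=x^{2n-1}\rangle$; $V_{8n}=\langle x,y : x^{2n}=y^4=1,\ yx=x^{-1}y^{-1},\ y^{-1}x=x^{-1}y\rangle$. *)

theory Defs
  imports
    "HOL-Algebra.Coset"
    "Graph_Theory.Pair_Digraph"
    "Jordan_Normal_Form.Char_Poly"
begin

section \<open>Groups given by generators and relations\<close>

text \<open>
  A letter \<open>(g, True)\<close> stands for the generator \<open>g\<close> and \<open>(g, False)\<close> for its formal inverse.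
  A relation \<open>l = r\<close> is the pair \<open>(l, r)\<close> of words.
\<close>

type_synonym 'g word = "('g \<times> bool) list"

definition word_inv :: "'g word \<Rightarrow> 'g word" where
  "word_inv w = rev (map (\<lambda>(g, b). (g, \<not> b)) w)"

definition word_pow :: "'g word \<Rightarrow> nat \<Rightarrow> 'g word" where
  "word_pow w n = concat (replicate n w)"

text \<open>
  The least congruence on words containing \<open>R\<close> and free cancellation; its classes are the elements
  of the quotient of the free group by the normal closure of all \<open>l r\<^sup>-\<^sup>1\<close> with \<open>(l, r) \<in> R\<close>.
\<close>

inductive word_eq :: "'g word rel \<Rightarrow> 'g word \<Rightarrow> 'g word \<Rightarrow> bool" for R where
  refl: "word_eq R u u"
| sym: "word_eq R u v \<Longrightarrow> word_eq R v u"
| trans: "word_eq R u v \<Longrightarrow> word_eq R v w \<Longrightarrow> word_eq R u w"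
| cong: "word_eq R u u' \<Longrightarrow> word_eq R v v' \<Longrightarrow> word_eq R (u @ v) (u' @ v')"
| cancel: "word_eq R [(g, b), (g, \<not> b)] []"
| relation: "(l, r) \<in> R \<Longrightarrow> word_eq R l r"

definition word_class :: "'g word rel \<Rightarrow> 'g word \<Rightarrow> 'g word set" where
  "word_class R u = {v. word_eq R u v}"

definition presented_group :: "'g word rel \<Rightarrow> 'g word set monoid" where
  "presented_group R =
    \<lparr>carrier = range (word_class R),
     monoid.mult = (\<lambda>A B. \<Union>u\<in>A. \<Union>v\<in>B. word_class R (u @ v)),
     one = word_class R []\<rparr>"

lemma word_class_eq_iff: "word_class R u = word_class R v \<longleftrightarrow> word_eq R u v"
  unfolding word_class_def set_eq_iff mem_Collect_eq
  by (meson word_eq.refl word_eq.sym word_eq.trans)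

lemma presented_group_mult:
  "word_class R u \<otimes>\<^bsub>presented_group R\<^esub> word_class R v = word_class R (u @ v)"
proof -
  have "word_class R (u' @ v') = word_class R (u @ v)"
    if "u' \<in> word_class R u" "v' \<in> word_class R v" for u' v'
  proof -
    have "word_eq R u u'" "word_eq R v v'"
      using that by (simp_all add: word_class_def)
    then show ?thesis
      unfolding word_class_eq_iff by (intro word_eq.sym[OF word_eq.cong])
  qed
  then have "(\<Union>u'\<in>word_class R u. \<Union>v'\<in>word_class R v. word_class R (u' @ v')) =
      (\<Union>u'\<in>word_class R u. \<Union>v'\<in>word_class R v. word_class R (u @ v))"
    by (intro SUP_cong HOL.refl)
  moreover have "u \<in> word_class R u" "v \<in> word_class R v"
    by (simp_all add: word_class_def word_eq.refl)
  ultimately show ?thesis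
    by (auto simp: presented_group_def simp del: UN_simps)
qed

lemma word_eq_inv: "word_eq R (word_inv w @ w) []"
proof (induction w)
  case Nil
  show ?case by (simp add: word_inv_def word_eq.refl)
next
  case (Cons a w)
  obtain g b where a: "a = (g, b)" by (cases a)
  have "word_eq R [(g, \<not> b), (g, b)] []"
    using word_eq.cancel[of R g "\<not> b"] by simp
  then have "word_eq R (word_inv w @ ([(g, \<not> b), (g, b)] @ w)) (word_inv w @ ([] @ w))"
    by (intro word_eq.cong word_eq.refl)
  then have "word_eq R (word_inv (a # w) @ a # w) (word_inv w @ w)"
    by (simp add: word_inv_def a)
  then show ?case
    using Cons.IH by (rule word_eq.trans)
qed

lemma group_presented_group: "group (presented_group R)"
proof (rule groupI)
  fix A assume "A \<in> carrier (presented_group R)"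
  then obtain u where A: "A = word_class R u" by (auto simp: presented_group_def)
  have "word_class R (word_inv u) \<otimes>\<^bsub>presented_group R\<^esub> A = \<one>\<^bsub>presented_group R\<^esub>"
    unfolding A presented_group_mult
    by (simp add: presented_group_def word_class_eq_iff word_eq_inv)
  then show "\<exists>B\<in>carrier (presented_group R). B \<otimes>\<^bsub>presented_group R\<^esub> A = \<one>\<^bsub>presented_group R\<^esub>"
    by (auto simp: presented_group_def)
  have "\<one>\<^bsub>presented_group R\<^esub> = word_class R []" by (simp add: presented_group_def)
  then show "\<one>\<^bsub>presented_group R\<^esub> \<otimes>\<^bsub>presented_group R\<^esub> A = A"
    by (simp add: A presented_group_mult)
next
  fix A B C
  assume "A \<in> carrier (presented_group R)" "B \<in> carrier (presented_group R)"
    "C \<in> carrier (presented_group R)"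
  then obtain u v w where "A = word_class R u" "B = word_class R v" "C = word_class R w"
    by (auto simp: presented_group_def)
  then show "A \<otimes>\<^bsub>presented_group R\<^esub> B \<otimes>\<^bsub>presented_group R\<^esub> C =
      A \<otimes>\<^bsub>presented_group R\<^esub> (B \<otimes>\<^bsub>presented_group R\<^esub> C)"
    by (simp add: presented_group_mult)
next
  fix A B
  assume "A \<in> carrier (presented_group R)" "B \<in> carrier (presented_group R)"
  then obtain u v where "A = word_class R u" "B = word_class R v"
    by (auto simp: presented_group_def)
  then show "A \<otimes>\<^bsub>presented_group R\<^esub> B \<in> carrier (presented_group R)"
    by (simp only: presented_group_mult) (simp add: presented_group_def)
qed (simp add: presented_group_def)

section \<open>The families of groups\<close>

datatype gen = GenX | GenY

abbreviation wx :: "gen word" where "wx \<equiv> [(GenX, True)]"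
abbreviation wy :: "gen word" where "wy \<equiv> [(GenY, True)]"
abbreviation wx_inv :: "gen word" where "wx_inv \<equiv> word_inv wx"
abbreviation wy_inv :: "gen word" where "wy_inv \<equiv> word_inv wy"

text \<open>
  Each constant takes the parameter \<open>n\<close>, not the subscript: \<open>D_2n 3\<close> has order 6 and
  \<open>SD_8n 3\<close> has order 24.
\<close>

definition D_2n :: "nat \<Rightarrow> gen word set monoid" where
  "D_2n n = presented_group
    {(word_pow wx n, []), (word_pow wy 2, []), (wy @ wx @ wy_inv, wx_inv)}"

definition T_4n :: "nat \<Rightarrow> gen word set monoid" where
  "T_4n n = presented_group
    {(word_pow wx (2 * n), []), (word_pow wx n, word_pow wy 2), (wy_inv @ wx @ wy, wx_inv)}"

definition U_6n :: "nat \<Rightarrow> gen word set monoid" where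
  "U_6n n = presented_group
    {(word_pow wx (2 * n), []), (word_pow wy 3, []), (wx_inv @ wy @ wx, wy_inv)}"

definition U_nm :: "nat \<Rightarrow> nat \<Rightarrow> gen word set monoid" where
  "U_nm n m = presented_group
    {(word_pow wx (2 * n), []), (word_pow wy m, []), (wx_inv @ wy @ wx, wy_inv)}"

definition SD_8n :: "nat \<Rightarrow> gen word set monoid" where
  "SD_8n n = presented_group
    {(word_pow wx (4 * n), []), (word_pow wy 2, []), (wy @ wx @ wy, word_pow wx (2 * n - 1))}"

definition V_8n :: "nat \<Rightarrow> gen word set monoid" where
  "V_8n n = presented_group
    {(word_pow wx (2 * n), []), (word_pow wy 4, []),
     (wy @ wx, wx_inv @ wy_inv), (wy_inv @ wx, wx_inv @ wy)}"

section \<open>The commuting conjugacy class graph\<close>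

definition center :: "('a, 'b) monoid_scheme \<Rightarrow> 'a set" where
  "center G = {z \<in> carrier G. \<forall>g\<in>carrier G. z \<otimes>\<^bsub>G\<^esub> g = g \<otimes>\<^bsub>G\<^esub> z}"

definition conj_class :: "('a, 'b) monoid_scheme \<Rightarrow> 'a \<Rightarrow> 'a set" where
  "conj_class G a = {g \<otimes>\<^bsub>G\<^esub> a \<otimes>\<^bsub>G\<^esub> inv\<^bsub>G\<^esub> g | g. g \<in> carrier G}"

definition ccc_graph :: "('a, 'b) monoid_scheme \<Rightarrow> 'a set pair_pre_digraph" where
  "ccc_graph G =
    (let V = conj_class G ` (carrier G - center G)
     in \<lparr>pverts = V,
         parcs = {(C, D). C \<in> V \<and> D \<in> V \<and> C \<noteq> D \<and>
                   (\<exists>c\<in>C. \<exists>d\<in>D. c \<otimes>\<^bsub>G\<^esub> d = d \<otimes>\<^bsub>G\<^esub> c)}\<rparr>)"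

lemma pair_graph_ccc_graph:
  assumes "finite (carrier G)"
  shows "pair_graph (ccc_graph G)"
proof -
  have parcs: "parcs (ccc_graph G) \<subseteq> pverts (ccc_graph G) \<times> pverts (ccc_graph G)"
    by (auto simp: ccc_graph_def Let_def)
  have fin: "finite (pverts (ccc_graph G))"
    using assms by (simp add: ccc_graph_def Let_def)
  have "finite (parcs (ccc_graph G))"
    using parcs fin by (meson finite_SigmaI finite_subset)
  moreover have "sym (parcs (ccc_graph G))"
    unfolding sym_def ccc_graph_def Let_def by (simp, metis)
  moreover have "fst e \<noteq> snd e" if "e \<in> parcs (ccc_graph G)" for e
    using that by (auto simp: ccc_graph_def Let_def)
  ultimately show ?thesis
    using parcs fin by unfold_locales (auto simp: symmetric_def)
qed

section \<open>Common neighbourhood energies\<close>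

text \<open>
  Finite simple graphs are \<open>pair_graph\<close>s, each edge being represented by both of its arcs.
  The matrices are taken with respect to an arbitrary enumeration \<open>v\<^sub>0, \<dots>, v\<^bsub>N-1\<^esub>\<close> of the vertices;
  all quantities defined from their spectra are independent of that choice.
\<close>

definition vertex_list :: "'v pair_pre_digraph \<Rightarrow> 'v list" where
  "vertex_list \<Gamma> = (SOME vs. distinct vs \<and> set vs = pverts \<Gamma>)"

definition CN :: "'v pair_pre_digraph \<Rightarrow> real mat" where
  "CN \<Gamma> =
    (let vs = vertex_list \<Gamma>; N = length vs
     in mat N N (\<lambda>(i, j).
       if i = j then 0
       else real (card {w \<in> pverts \<Gamma>. w \<noteq> vs ! i \<and> w \<noteq> vs ! j \<and>
                         (vs ! i, w) \<in> parcs \<Gamma> \<and> (vs ! j, w) \<in> parcs \<Gamma>})))"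

definition CNRS :: "'v pair_pre_digraph \<Rightarrow> real mat" where
  "CNRS \<Gamma> =
    (let N = dim_row (CN \<Gamma>)
     in mat N N (\<lambda>(i, j). if i = j then \<Sum>k<N. CN \<Gamma> $$ (i, k) else 0))"

definition CNL :: "'v pair_pre_digraph \<Rightarrow> real mat" where
  "CNL \<Gamma> = CNRS \<Gamma> - CN \<Gamma>"

definition CNSL :: "'v pair_pre_digraph \<Rightarrow> real mat" where
  "CNSL \<Gamma> = CNRS \<Gamma> + CN \<Gamma>"

definition CN_avg :: "'v pair_pre_digraph \<Rightarrow> real" where
  "CN_avg \<Gamma> = (\<Sum>i<dim_row (CNRS \<Gamma>). CNRS \<Gamma> $$ (i, i)) / real (card (pverts \<Gamma>))"

text \<open>
  The eigenvalues with algebraic multiplicity. The matrices considered here are real symmetric, so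
  their characteristic polynomials split over the reals and no eigenvalue is missed.
\<close>

definition eigenvalues :: "real mat \<Rightarrow> real multiset" where
  "eigenvalues A = proots (char_poly A)"

definition E_CN :: "'v pair_pre_digraph \<Rightarrow> real" where
  "E_CN \<Gamma> = (\<Sum>\<alpha>\<in>#eigenvalues (CN \<Gamma>). \<bar>\<alpha>\<bar>)"

definition LE_CN :: "'v pair_pre_digraph \<Rightarrow> real" where
  "LE_CN \<Gamma> = (\<Sum>\<alpha>\<in>#eigenvalues (CNL \<Gamma>). \<bar>\<alpha> - CN_avg \<Gamma>\<bar>)"

definition LE_plus_CN :: "'v pair_pre_digraph \<Rightarrow> real" where
  "LE_plus_CN \<Gamma> = (\<Sum>\<beta>\<in>#eigenvalues (CNSL \<Gamma>). \<bar>\<beta> - CN_avg \<Gamma>\<bar>)"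

section \<open>The groups listed in the equality case\<close>

definition in_equality_list :: "('a, 'b) monoid_scheme \<Rightarrow> bool" where
  "in_equality_list G \<longleftrightarrow>
     G \<cong> D_2n 3 \<or> G \<cong> D_2n 4 \<or> G \<cong> D_2n 5 \<or> G \<cong> D_2n 6 \<or>
     G \<cong> T_4n 2 \<or> G \<cong> T_4n 3 \<or> G \<cong> SD_8n 3 \<or> G \<cong> V_8n 2 \<or>
     (\<exists>n\<ge>2. G \<cong> U_6n n) \<or>
     (\<exists>n\<ge>2. \<exists>m\<in>{3, 4, 6}. G \<cong> U_nm n m)"

end

theory Submission
  imports Defs "HOL-Library.Product_Plus"
begin

text \<open>
  Every group in question has an abelian subgroup \<open>A\<close> of index two; let \<open>t\<close> lie outside \<open>A\<close>, let
  \<open>F\<close> be the centralizer of \<open>t\<close> in \<open>A\<close> and \<open>D\<close> the set of commutators of \<open>t\<close> with elements of \<open>A\<close>.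
  Non-central classes inside \<open>A\<close> are pairs and all commute; those outside \<open>A\<close> are the cosets of \<open>D\<close>,
  and two of them are adjacent iff they lie in the same coset of \<open>D F\<close>. So the graph is
  \<open>K\<^sub>a \<union> k K\<^sub>b\<close> with \<open>a = (|A| - |F|) / 2\<close>, \<open>k = |D \<inter> F|\<close> and \<open>b = |F| / k\<close>. Its energies are explicit; they
  coincide if \<open>a = b\<close> or \<open>a, b \<le> 2\<close>, and are strictly ordered if \<open>a \<ge> 3\<close>, \<open>k \<le> 2\<close> and \<open>a \<ge> (k + 1) b\<close>.
  The numbers \<open>a\<close>, \<open>b\<close>, \<open>k\<close> are read off a normal form, whose uniqueness follows from an action of
  the words on triples of two residues and a bit.
\<close>

section \<open>Spectra of block-constant matrices\<close>

text \<open>Relations bound a group only from above: they bring every word to the form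
  \<open>u^i v^j t^e\<close>, but that these elements are distinct needs a model. Instead of six
  concrete groups there is one action with parameters \<open>p\<close>, \<open>q\<close>,
  \<open>r\<close>, \<open>s\<close>, \<open>c\<close>. Two residues are needed because
  \<open>t\<^sup>2\<close> need not be a power of \<open>u\<close>: in \<open>U_nm\<close> and
  \<open>V_8n\<close> it supplies a second central generator \<open>v\<close>, while
  \<open>q = 1\<close> switches \<open>v\<close> off for the other families. Every group on the list
  has \<open>a = b\<close> except \<open>D_2n 5\<close>, with \<open>a = 2\<close> and
  \<open>b = 1\<close>, where no two vertices have a common neighbour. In \<open>U_nm\<close> the
  factor \<open>n\<close> multiplies \<open>a\<close> and \<open>b\<close> alike, so that equality
  depends on \<open>m\<close> alone; this is why whole families appear on the list.\<close>

lemma proots_prod_linear: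
  "proots (\<Prod>a\<leftarrow>as. [:- a, 1:]) = mset (as :: real list)"
proof -
  have "(\<Prod>a\<leftarrow>as. [:- a, 1:]) \<noteq> 0" for as :: "real list"
    by (auto simp: prod_list_zero_iff)
  then show ?thesis by (induction as) (simp_all add: proots_mult del: mult_pCons_left)
qed

text \<open>
  Replacing, in every block, the basis vector of the first index by the sum of the basis vectors
  of the block makes the matrix upper triangular, for every ordering of the indices.
\<close>

lemma eigenvalues_block_constant:
  fixes \<rho> :: "nat \<Rightarrow> nat" and \<alpha> \<beta> :: "nat \<Rightarrow> real"
  assumes idem: "\<And>i. i < n \<Longrightarrow> \<rho> (\<rho> i) = \<rho> i" and le: "\<And>i. i < n \<Longrightarrow> \<rho> i \<le> i"
  defines "p \<equiv> \<lambda>r. real (card {k. k < n \<and> \<rho> k = r})"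
  defines "M \<equiv> mat n n (\<lambda>(i, j). (if \<rho> i = \<rho> j then \<alpha> (\<rho> i) else 0) + (if i = j then \<beta> (\<rho> i) else 0))"
  shows "eigenvalues M = mset (map (\<lambda>i. \<beta> (\<rho> i) + (if \<rho> i = i then p i * \<alpha> i else 0)) [0..<n])"
proof -
  define P :: "real mat" where "P = mat n n (\<lambda>(i, j). (if j = i then 1 else 0)
      + (if j = \<rho> i \<and> j \<noteq> i then 1 else 0))"
  define Q :: "real mat" where "Q = mat n n (\<lambda>(i, j). (if j = i then 1 else 0) - (if j = \<rho> i \<and> j \<noteq> i then 1 else 0))"
  \<comment> \<open>Column by column this is \<open>M\<close> in the new basis: the block sum is an
    eigenvector with value \<open>p \<alpha> + \<beta>\<close>, and any other basis vector of a
    block goes to \<open>\<beta>\<close> times itself plus \<open>\<alpha>\<close> times the block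
    sum.\<close>
  define T :: "real mat" where "T = mat n n (\<lambda>(i, j). (if i = j then \<beta> (\<rho> i) else 0)
      + (if i = \<rho> j then \<alpha> i * (if i = j then p i else 1) else 0))"
  have carr: "M \<in> carrier_mat n n" "T \<in> carrier_mat n n" "P \<in> carrier_mat n n" "Q \<in> carrier_mat n n"
    by (simp_all add: M_def T_def P_def Q_def)
  have lt: "\<rho> i < n" if "i < n" for i using le[OF that] that by simp
  have QP: "Q * P = 1\<^sub>m n"
  proof (rule eq_matI)
    fix i j assume "i < dim_row (1\<^sub>m n)" "j < dim_col (1\<^sub>m n)"
    then have ij: "i < n" "j < n" by auto
    have "(Q * P) $$ (i, j) = (\<Sum>k<n. Q $$ (i, k) * P $$ (k, j))"
      using ij carr by (simp add: scalar_prod_def atLeast0LessThan)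
    also have "\<dots> = (\<Sum>k<n. (if k = i then P $$ (k, j) else 0))
        - (\<Sum>k<n. (if k = \<rho> i then (if \<rho> i \<noteq> i then P $$ (k, j) else 0) else 0))"
      unfolding sum_subtractf[symmetric] using ij by (intro sum.cong) (auto simp: Q_def)
    also have "\<dots> = P $$ (i, j) - (if \<rho> i \<noteq> i then P $$ (\<rho> i, j) else 0)"
      using ij lt by (simp add: sum.delta)
    also have "\<dots> = 1\<^sub>m n $$ (i, j)"
      using ij lt idem by (auto simp: P_def)
    finally show "(Q * P) $$ (i, j) = 1\<^sub>m n $$ (i, j)" .
  qed (use carr in auto)
  then have PQ: "P * Q = 1\<^sub>m n"
    using mat_mult_left_right_inverse carr by blast
  have MP: "M * P = P * T"
  proof (rule eq_matI)
    fix i j assume "i < dim_row (P * T)" "j < dim_col (P * T)"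
    then have ij: "i < n" "j < n" using carr by auto
    have "(P * T) $$ (i, j) = (\<Sum>k<n. P $$ (i, k) * T $$ (k, j))"
      using ij carr by (simp add: scalar_prod_def atLeast0LessThan)
    also have "\<dots> = (\<Sum>k<n. (if k = i then T $$ (k, j) else 0))
        + (\<Sum>k<n. (if k = \<rho> i then (if \<rho> i \<noteq> i then T $$ (k, j) else 0) else 0))"
      unfolding sum.distrib[symmetric] using ij by (intro sum.cong) (auto simp: P_def)
    also have "\<dots> = T $$ (i, j) + (if \<rho> i \<noteq> i then T $$ (\<rho> i, j) else 0)"
      using ij lt by (simp add: sum.delta)
    finally have PT: "(P * T) $$ (i, j) = T $$ (i, j) + (if \<rho> i \<noteq> i then T $$ (\<rho> i, j) else 0)" .
    have MP: "(M * P) $$ (i, j) = (\<Sum>k<n. M $$ (i, k) * P $$ (k, j))"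
      using ij carr by (simp add: scalar_prod_def atLeast0LessThan)
    show "(M * P) $$ (i, j) = (P * T) $$ (i, j)"
    proof (cases "\<rho> j = j")
      case True
      have "(\<Sum>k<n. M $$ (i, k) * P $$ (k, j)) = (\<Sum>k<n. if \<rho> k = j then M $$ (i, k) else 0)"
        using ij True by (intro sum.cong) (auto simp: P_def)
      also have "\<dots> = (\<Sum>k<n. if \<rho> k = j \<and> \<rho> i = j then \<alpha> j else 0)
          + (\<Sum>k<n. if k = i then (if \<rho> i = j then \<beta> j else 0) else 0)"
        unfolding sum.distrib[symmetric] using ij by (intro sum.cong) (auto simp: M_def)
      also have "(\<Sum>k<n. if \<rho> k = j \<and> \<rho> i = j then \<alpha> j else 0) = (if \<rho> i = j then p j * \<alpha> j else 0)"
        by (simp add: p_def sum.If_cases Int_def)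
      finally show ?thesis
        unfolding PT MP using ij lt True idem by (auto simp: T_def)
    next
      case False
      have "(\<Sum>k<n. M $$ (i, k) * P $$ (k, j)) = (\<Sum>k<n. if k = j then M $$ (i, k) else 0)"
        using ij False idem by (intro sum.cong) (auto simp: P_def)
      also have "\<dots> = M $$ (i, j)" using ij by (simp add: sum.delta)
      finally show ?thesis
        unfolding PT MP using ij lt False idem by (auto simp: T_def M_def)
    qed
  qed (use carr in auto)
  have "M = M * (P * Q)" using carr PQ by simp
  also have "\<dots> = P * T * Q" using carr MP by (simp flip: assoc_mult_mat)
  finally have "similar_mat M T"
    using carr PQ QP by (intro similar_matI[of _ _ P Q n]) auto
  moreover have "upper_triangular T"
    unfolding upper_triangular_def
  proof (intro allI impI)
    fix i j assume "i < dim_row T" "j < i"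
    then have "i < n" "j < n" "i \<noteq> j" using carr by auto
    \<comment> \<open>Triangularity rests on the representative preceding the other members of its
      block.\<close>
    moreover have "i \<noteq> \<rho> j" using le[OF \<open>j < n\<close>] \<open>j < i\<close> by linarith
    ultimately show "T $$ (i, j) = 0" by (simp add: T_def)
  qed
  ultimately have "char_poly M = (\<Prod>a\<leftarrow>diag_mat T. [:- a, 1:])"
    using char_poly_similar char_poly_upper_triangular carr by metis
  moreover have "diag_mat T = map (\<lambda>i. \<beta> (\<rho> i) + (if \<rho> i = i then p i * \<alpha> i else 0)) [0..<n]"
    unfolding diag_mat_def by (intro map_cong) (simp_all add: T_def)
  ultimately show ?thesis
    by (simp only: eigenvalues_def proots_prod_linear)
qed

text \<open>Each fibre of \<open>\<rho>\<close> contains exactly one fixed point, so a value placed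
  there can be divided evenly over the fibre. This spreads the one exceptional eigenvalue of a block
  over all its indices.\<close>

lemma sum_block_representatives:
  fixes \<rho> :: "nat \<Rightarrow> nat" and f :: "nat \<Rightarrow> real"
  assumes idem: "\<And>i. i < n \<Longrightarrow> \<rho> (\<rho> i) = \<rho> i" and le: "\<And>i. i < n \<Longrightarrow> \<rho> i \<le> i"
  shows "(\<Sum>i<n. if \<rho> i = i then f i else 0) = (\<Sum>i<n. f (\<rho> i) / real (card {k. k < n \<and> \<rho> k = \<rho> i}))"
proof -
  have "(\<Sum>i<n. f (\<rho> i) / real (card {k. k < n \<and> \<rho> k = \<rho> i})) =
      (\<Sum>r\<in>\<rho> ` {..<n}. \<Sum>i | i \<in> {..<n} \<and> \<rho> i = r. f (\<rho> i) / real (card {k. k < n \<and> \<rho> k = \<rho> i}))"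
    by (rule sum.image_gen) simp
  also have "\<dots> = (\<Sum>r\<in>\<rho> ` {..<n}. f r)"
  proof (rule sum.cong)
    fix r assume "r \<in> \<rho> ` {..<n}"
    then have "card {k. k < n \<and> \<rho> k = r} \<noteq> 0" by auto
    moreover have "(\<Sum>i | i \<in> {..<n} \<and> \<rho> i = r. f (\<rho> i) / real (card {k. k < n \<and> \<rho> k = \<rho> i})) =
       (\<Sum>i | i < n \<and> \<rho> i = r. f r / real (card {k. k < n \<and> \<rho> k = r}))"
      by (rule sum.cong) auto
    ultimately show "(\<Sum>i | i \<in> {..<n} \<and> \<rho> i = r. f (\<rho> i) / real (card {k. k < n \<and> \<rho> k = \<rho> i})) = f r"
      by simp
  qed simp
  also have "\<rho> ` {..<n} = {i. i < n \<and> \<rho> i = i}"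
  proof (intro equalityI subsetI)
    fix r assume "r \<in> \<rho> ` {..<n}"
    then obtain i where "i < n" "r = \<rho> i" by auto
    then show "r \<in> {i. i < n \<and> \<rho> i = i}" using idem[of i] le[of i] by auto
  qed force
  finally show ?thesis
    by (simp add: sum.If_cases Int_def)
qed

text \<open>
  The sum of \<open>h\<close> over the spectrum of a \<open>p \<times> p\<close> block with entries \<open>a\<close> plus \<open>b\<close> on the diagonal, divided
  by \<open>p\<close>: spread evenly over the vertices, spectral sums become vertex sums in which the vertex
  enumeration and the list of cliques no longer appear.
\<close>

definition block_trace :: "(real \<Rightarrow> real) \<Rightarrow> real \<Rightarrow> real \<Rightarrow> real \<Rightarrow> real" where
  "block_trace h p a b = ((p - 1) * h b + h (p * a + b)) / p"

text \<open>In all three matrices the coefficients depend only on the size of the block, hence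
  \<open>\<alpha>\<close> and \<open>\<beta>\<close> are functions of that size. The function
  \<open>h\<close> is left open to cover both the plain and the shifted absolute value.\<close>

lemma sum_eigenvalues_block_constant:
  fixes n :: nat and \<kappa> :: "nat \<Rightarrow> 'k" and \<alpha> \<beta> h :: "real \<Rightarrow> real"
  defines "p \<equiv> \<lambda>i. real (card {k. k < n \<and> \<kappa> k = \<kappa> i})"
  assumes M: "M \<in> carrier_mat n n" "\<And>i j. i < n \<Longrightarrow> j < n \<Longrightarrow>
    M $$ (i, j) = (if \<kappa> i = \<kappa> j then \<alpha> (p i) else 0) + (if i = j then \<beta> (p i) else 0)"
  shows "(\<Sum>x\<in>#eigenvalues M. h x) = (\<Sum>i<n. block_trace h (p i) (\<alpha> (p i)) (\<beta> (p i)))"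
proof -
  \<comment> \<open>The first index with the same label represents the block; this choice is
    idempotent and never exceeds its argument, as the triangularization requires.\<close>
  define \<rho> where "\<rho> i = (LEAST k. \<kappa> k = \<kappa> i)" for i
  have \<kappa>\<rho>: "\<kappa> (\<rho> i) = \<kappa> i" for i unfolding \<rho>_def by (rule LeastI[of _ i]) simp
  have le: "\<rho> i \<le> i" for i unfolding \<rho>_def by (rule Least_le) simp
  have eq: "\<rho> i = \<rho> j \<longleftrightarrow> \<kappa> i = \<kappa> j" for i j using \<kappa>\<rho> by (metis \<rho>_def)
  have idem: "\<rho> (\<rho> i) = \<rho> i" for i by (simp add: eq \<kappa>\<rho>)
  have p\<rho>: "p (\<rho> i) = p i" for i by (simp add: p_def \<kappa>\<rho>)
  have p: "p i = real (card {k. k < n \<and> \<rho> k = \<rho> i})" for i by (simp add: p_def eq)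
  have M': "M = mat n n (\<lambda>(i, j). (if \<rho> i = \<rho> j then \<alpha> (p (\<rho> i)) else 0) + (if i = j then \<beta> (p (\<rho> i)) else 0))"
    using M by (intro eq_matI) (auto simp: eq p\<rho>)
  let ?d = "\<lambda>i. \<beta> (p (\<rho> i)) + (if \<rho> i = i then real (card {k. k < n \<and> \<rho> k = i}) * \<alpha> (p i) else 0)"
  have "eigenvalues M = mset (map ?d [0..<n])"
    unfolding M' by (rule eigenvalues_block_constant[of n \<rho> "\<lambda>i. \<alpha> (p i)" "\<lambda>i. \<beta> (p i)"]) (auto simp: idem le)
  then have "(\<Sum>x\<in>#eigenvalues M. h x) = (\<Sum>x\<leftarrow>map ?d [0..<n]. h x)"
    by (simp only: mset_map[symmetric] sum_mset_sum_list)
  also have "\<dots> = (\<Sum>i<n. h (?d i))"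
    by (simp add: comp_def interv_sum_list_conv_sum_set_nat atLeast0LessThan)
  also have "\<dots> = (\<Sum>i<n. h (\<beta> (p i)))
      + (\<Sum>i<n. if \<rho> i = i then h (p i * \<alpha> (p i) + \<beta> (p i)) - h (\<beta> (p i)) else 0)"
    unfolding sum.distrib[symmetric] using p p\<rho> by (intro sum.cong) (auto simp: add.commute)
  also have "(\<Sum>i<n. if \<rho> i = i then h (p i * \<alpha> (p i) + \<beta> (p i)) - h (\<beta> (p i)) else 0) =
      (\<Sum>i<n. (h (p i * \<alpha> (p i) + \<beta> (p i)) - h (\<beta> (p i))) / p i)"
    by (subst sum_block_representatives) (auto simp: idem le p\<rho> p)
  also have "(\<Sum>i<n. h (\<beta> (p i))) + \<dots> = (\<Sum>i<n. block_trace h (p i) (\<alpha> (p i)) (\<beta> (p i)))"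
    unfolding sum.distrib[symmetric]
  proof (rule sum.cong)
    fix i assume "i \<in> {..<n}"
    then have "p i \<noteq> 0" by (auto simp: p_def)
    then show "h (\<beta> (p i)) + (h (p i * \<alpha> (p i) + \<beta> (p i)) - h (\<beta> (p i))) / p i
        = block_trace h (p i) (\<alpha> (p i)) (\<beta> (p i))"
      by (simp add: field_simps block_trace_def)
  qed simp
  finally show ?thesis .
qed

section \<open>Disjoint unions of complete graphs\<close>

text \<open>A disjoint union of complete graphs. Labels instead of a list of cliques match the
  block-constant matrices directly.\<close>

locale cluster_graph =
  fixes \<Gamma> :: "'v pair_pre_digraph" and \<kappa> :: "'v \<Rightarrow> 'k"
  assumes finite_pverts: "finite (pverts \<Gamma>)"
    and parcs_eq: "parcs \<Gamma> = {(u, v). u \<in> pverts \<Gamma> \<and> v \<in> pverts \<Gamma> \<and> u \<noteq> v \<and> \<kappa> u = \<kappa> v}"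
begin

definition size :: "'v \<Rightarrow> real" where
  "size v = real (card {w \<in> pverts \<Gamma>. \<kappa> w = \<kappa> v})"

abbreviation "vs \<equiv> vertex_list \<Gamma>"
abbreviation "N \<equiv> length vs"

lemma vertex_list: "distinct vs" "set vs = pverts \<Gamma>"
  using someI_ex[of "\<lambda>vs. distinct vs \<and> set vs = pverts \<Gamma>"] finite_distinct_list[OF finite_pverts]
  by (auto simp: vertex_list_def)

lemma bij_vertex_list: "bij_betw ((!) vs) {..<N} (pverts \<Gamma>)"
  using bij_betw_nth[OF vertex_list(1) HOL.refl HOL.refl] vertex_list(2) by simp

lemma nth_in_pverts: "i < N \<Longrightarrow> vs ! i \<in> pverts \<Gamma>"
  using nth_mem[of i vs] by (simp add: vertex_list(2))

lemma sum_vertex_list: "(\<Sum>i<N. f (vs ! i)) = (\<Sum>v\<in>pverts \<Gamma>. f v)"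
  by (rule sum.reindex_bij_betw[OF bij_vertex_list])

lemma size_index: "real (card {k. k < N \<and> \<kappa> (vs ! k) = \<kappa> (vs ! i)}) = size (vs ! i)"
proof -
  have "{w \<in> pverts \<Gamma>. \<kappa> w = \<kappa> (vs ! i)} = (!) vs ` {k. k < N \<and> \<kappa> (vs ! k) = \<kappa> (vs ! i)}"
    using bij_betw_imp_surj_on[OF bij_vertex_list] by auto
  moreover have "inj_on ((!) vs) {k. k < N \<and> \<kappa> (vs ! k) = \<kappa> (vs ! i)}"
    using bij_betw_imp_inj_on[OF bij_vertex_list] by (rule inj_on_subset) auto
  ultimately show ?thesis by (simp add: size_def card_image)
qed

lemma CN_carrier: "CN \<Gamma> \<in> carrier_mat N N"
  by (simp add: CN_def Let_def)

text \<open>Two vertices of a clique of size \<open>p\<close> have the other \<open>p - 2\<close> as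
  common neighbours. The zero diagonal is produced by adding this value on the whole block and
  subtracting it again, the shape that the spectral lemma needs; for \<open>p = 1\<close> the formal
  entry \<open>-1\<close> cancels in the same way.\<close>

lemma CN_entry:
  assumes ij: "i < N" "j < N"
  shows "CN \<Gamma> $$ (i, j) = (if \<kappa> (vs ! i) = \<kappa> (vs ! j) then size (vs ! i) - 2 else 0) +
    (if i = j then - (size (vs ! i) - 2) else 0)"
proof (cases "i = j")
  case False
  let ?C = "{w \<in> pverts \<Gamma>. w \<noteq> vs ! i \<and> w \<noteq> vs ! j \<and> (vs ! i, w) \<in> parcs \<Gamma> \<and> (vs ! j, w) \<in> parcs \<Gamma>}"
  have ne: "vs ! i \<noteq> vs ! j" using False ij vertex_list(1) by (simp add: nth_eq_iff_index_eq)
  have "real (card ?C) = (if \<kappa> (vs ! i) = \<kappa> (vs ! j) then size (vs ! i) - 2 else 0)"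
  proof (cases "\<kappa> (vs ! i) = \<kappa> (vs ! j)")
    case True
    let ?B = "{w \<in> pverts \<Gamma>. \<kappa> w = \<kappa> (vs ! i)}"
    have sub: "{vs ! i, vs ! j} \<subseteq> ?B" using True ij nth_in_pverts by auto
    have "?C = ?B - {vs ! i, vs ! j}"
      using True ij nth_in_pverts by (auto simp: parcs_eq)
    then have "card ?C = card ?B - 2"
      using sub ne by (simp add: card_Diff_subset)
    moreover have "card {vs ! i, vs ! j} \<le> card ?B"
      using finite_pverts by (intro card_mono sub) simp
    ultimately show ?thesis using True ne by (simp add: size_def)
  next
    case False
    then have "?C = {}" by (auto simp: parcs_eq)
    then show ?thesis using False by (simp only: card.empty) simp
  qed
  then show ?thesis using False ij by (simp add: CN_def Let_def)
qed (use ij in \<open>simp add: CN_def Let_def\<close>)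

lemma CN_row_sum:
  assumes i: "i < N"
  shows "(\<Sum>k<N. CN \<Gamma> $$ (i, k)) = (size (vs ! i) - 1) * (size (vs ! i) - 2)"
proof -
  have "(\<Sum>k<N. CN \<Gamma> $$ (i, k)) =
      (\<Sum>k<N. if \<kappa> (vs ! k) = \<kappa> (vs ! i) then size (vs ! i) - 2 else 0) +
      (\<Sum>k<N. if k = i then - (size (vs ! i) - 2) else 0)"
    unfolding sum.distrib[symmetric] using i by (intro sum.cong) (auto simp: CN_entry)
  also have "\<dots> = size (vs ! i) * (size (vs ! i) - 2) - (size (vs ! i) - 2)"
    using i by (simp add: sum.If_cases Int_def size_index)
  finally show ?thesis by (simp add: algebra_simps)
qed

lemma CNRS_entry:
  "i < N \<Longrightarrow> j < N \<Longrightarrow>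
    CNRS \<Gamma> $$ (i, j) = (if i = j then (size (vs ! i) - 1) * (size (vs ! i) - 2) else 0)"
  using CN_row_sum CN_carrier by (simp add: CNRS_def Let_def)

lemma CNRS_carrier: "CNRS \<Gamma> \<in> carrier_mat N N"
  using CN_carrier by (simp add: CNRS_def Let_def)

lemma CN_avg_eq:
  "CN_avg \<Gamma> = (\<Sum>v\<in>pverts \<Gamma>. (size v - 1) * (size v - 2)) / real (card (pverts \<Gamma>))"
proof -
  have "(\<Sum>i<N. CNRS \<Gamma> $$ (i, i)) = (\<Sum>i<N. (size (vs ! i) - 1) * (size (vs ! i) - 2))"
    by (intro sum.cong) (auto simp: CNRS_entry)
  then show ?thesis
    using CNRS_carrier sum_vertex_list[of "\<lambda>v. (size v - 1) * (size v - 2)"]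
    by (simp add: CN_avg_def)
qed

lemma sum_eigenvalues:
  assumes "M \<in> carrier_mat N N" "\<And>i j. i < N \<Longrightarrow> j < N \<Longrightarrow>
    M $$ (i, j) = (if \<kappa> (vs ! i) = \<kappa> (vs ! j) then \<alpha> (size (vs ! i)) else 0) +
      (if i = j then \<beta> (size (vs ! i)) else 0)"
  shows "(\<Sum>x\<in>#eigenvalues M. h x) =
    (\<Sum>v\<in>pverts \<Gamma>. block_trace h (size v) (\<alpha> (size v)) (\<beta> (size v)))"
proof -
  have "(\<Sum>x\<in>#eigenvalues M. h x)
      = (\<Sum>i<N. block_trace h (size (vs ! i)) (\<alpha> (size (vs ! i))) (\<beta> (size (vs ! i))))"
    using sum_eigenvalues_block_constant[where n = N and \<kappa> = "\<lambda>i. \<kappa> (vs ! i)" and \<alpha> = \<alpha> and \<beta> = \<beta> and h = h]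
    unfolding size_index using assms by blast
  then show ?thesis
    by (simp only: sum_vertex_list[of "\<lambda>v. block_trace h (size v) (\<alpha> (size v)) (\<beta> (size v))"])
qed

lemma E_CN_eq:
  "E_CN \<Gamma> = (\<Sum>v\<in>pverts \<Gamma>. block_trace abs (size v) (size v - 2) (- (size v - 2)))"
  unfolding E_CN_def
  by (rule sum_eigenvalues[where \<alpha> = "\<lambda>p. p - 2" and \<beta> = "\<lambda>p. - (p - 2)"])
    (simp_all add: CN_carrier CN_entry)

lemma CNL_carrier: "CNL \<Gamma> \<in> carrier_mat N N"
  using CN_carrier by (simp add: CNL_def minus_carrier_mat)

lemma CNSL_carrier: "CNSL \<Gamma> \<in> carrier_mat N N"
  using CN_carrier by (simp add: CNSL_def)

text \<open>The diagonal remainder is the row sum \<open>(p - 1) (p - 2)\<close> plus the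
  \<open>p - 2\<close> taken by the block part. For \<open>CNSL\<close> that amount is subtracted
  instead, whence \<open>(p - 2)\<^sup>2\<close> there.\<close>

lemma CNL_entry:
  assumes "i < N" "j < N"
  shows "CNL \<Gamma> $$ (i, j) = (if \<kappa> (vs ! i) = \<kappa> (vs ! j) then - (size (vs ! i) - 2) else 0) +
    (if i = j then size (vs ! i) * (size (vs ! i) - 2) else 0)"
proof -
  have "CNL \<Gamma> $$ (i, j) = CNRS \<Gamma> $$ (i, j) - CN \<Gamma> $$ (i, j)"
    using assms CN_carrier CNRS_carrier by (simp add: CNL_def)
  then show ?thesis
    by (cases "i = j") (simp_all add: CN_entry CNRS_entry assms, simp add: algebra_simps)
qed

lemma CNSL_entry:
  assumes "i < N" "j < N"
  shows "CNSL \<Gamma> $$ (i, j) = (if \<kappa> (vs ! i) = \<kappa> (vs ! j) then size (vs ! i) - 2 else 0) +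
    (if i = j then (size (vs ! i) - 2)\<^sup>2 else 0)"
proof -
  have "CNSL \<Gamma> $$ (i, j) = CNRS \<Gamma> $$ (i, j) + CN \<Gamma> $$ (i, j)"
    using assms CN_carrier CNRS_carrier by (simp add: CNSL_def)
  then show ?thesis
    by (cases "i = j") (simp_all add: CN_entry CNRS_entry assms, simp add: algebra_simps power2_eq_square)
qed

lemma LE_CN_eq:
  "LE_CN \<Gamma> = (\<Sum>v\<in>pverts \<Gamma>.
    block_trace (\<lambda>x. \<bar>x - CN_avg \<Gamma>\<bar>) (size v) (- (size v - 2)) (size v * (size v - 2)))"
  unfolding LE_CN_def
  by (rule sum_eigenvalues[where \<alpha> = "\<lambda>p. - (p - 2)" and \<beta> = "\<lambda>p. p * (p - 2)"])
    (simp_all add: CNL_entry CNL_carrier)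

lemma LE_plus_CN_eq:
  "LE_plus_CN \<Gamma> = (\<Sum>v\<in>pverts \<Gamma>.
    block_trace (\<lambda>x. \<bar>x - CN_avg \<Gamma>\<bar>) (size v) (size v - 2) ((size v - 2)\<^sup>2))"
  unfolding LE_plus_CN_def
  by (rule sum_eigenvalues[where \<alpha> = "\<lambda>p. p - 2" and \<beta> = "\<lambda>p. (p - 2)\<^sup>2"])
    (simp_all add: CNSL_entry CNSL_carrier)

end

section \<open>Groups with an abelian subgroup of index two\<close>

text \<open>The graph is \<open>K\<^sub>a \<union> k K\<^sub>b\<close> with \<open>c = k b\<close>.\<close>

definition clique_profile :: "'v pair_pre_digraph \<Rightarrow> nat \<Rightarrow> nat \<Rightarrow> nat \<Rightarrow> bool" where
  "clique_profile \<Gamma> a b c \<longleftrightarrow> (\<exists>(\<kappa> :: 'v \<Rightarrow> 'v) V W. cluster_graph \<Gamma> \<kappa> \<and> pverts \<Gamma> = V \<union> W \<and> V \<inter> W = {} \<and>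
     card V = a \<and> card W = c \<and>
     (\<forall>v\<in>V. cluster_graph.size \<Gamma> \<kappa> v = real a) \<and> (\<forall>w\<in>W. cluster_graph.size \<Gamma> \<kappa> w = real b))"

text \<open>Takes the place of Lagrange's theorem: the order of the subgroup, the numbers of classes
  and the clique sizes all come from maps with fibres of constant size, without quotient
  groups.\<close>

lemma card_eq_fibre_card_times_image:
  assumes "finite S" "\<And>x. x \<in> S \<Longrightarrow> card {y \<in> S. f y = f x} = k"
  shows "card S = k * card (f ` S)"
proof -
  have "card S = (\<Sum>z\<in>f ` S. card {y \<in> S. f y = z})"
    using sum.image_gen[OF assms(1), of "\<lambda>_. 1::nat" f] by simp
  also have "\<dots> = (\<Sum>z\<in>f ` S. k)"
    using assms(2) by (intro sum.cong) auto
  finally show ?thesis by (simp add: mult.commute)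
qed

section \<open>Conjugacy classes as classes of an equivalence relation\<close>

context group
begin

lemma conj_class_self: "a \<in> carrier G \<Longrightarrow> a \<in> conj_class G a"
  unfolding conj_class_def by (rule CollectI, rule exI[of _ \<one>]) simp

lemma conj_class_mono:
  assumes "a \<in> carrier G" "b \<in> conj_class G a"
  shows "conj_class G b \<subseteq> conj_class G a"
proof
  fix x assume "x \<in> conj_class G b"
  then obtain g h where "g \<in> carrier G" "h \<in> carrier G" "x = h \<otimes> (g \<otimes> a \<otimes> inv g) \<otimes> inv h"
    using assms by (auto simp: conj_class_def)
  then have "x = (h \<otimes> g) \<otimes> a \<otimes> inv (h \<otimes> g)" "h \<otimes> g \<in> carrier G"
    using assms(1) by (simp_all add: inv_mult_group m_assoc)
  then show "x \<in> conj_class G a" by (auto simp: conj_class_def)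
qed

lemma conj_class_sym:
  assumes "a \<in> carrier G" "b \<in> conj_class G a"
  shows "a \<in> conj_class G b"
proof -
  obtain g where g: "g \<in> carrier G" "b = g \<otimes> a \<otimes> inv g"
    using assms by (auto simp: conj_class_def)
  then have "a = inv g \<otimes> b \<otimes> inv (inv g)"
    using assms(1) by (simp add: m_assoc inv_solve_left)
  then show ?thesis using g(1) unfolding conj_class_def by blast
qed

lemma conj_class_eq_iff:
  assumes "a \<in> carrier G" "b \<in> carrier G"
  shows "conj_class G b = conj_class G a \<longleftrightarrow> b \<in> conj_class G a"
proof
  assume "b \<in> conj_class G a"
  then show "conj_class G b = conj_class G a"
    using assms conj_class_mono[of a b] conj_class_mono[of b a] conj_class_sym[of a b] by blast
qed (use conj_class_self[OF assms(2)] in simp)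

lemma conj_class_fibre:
  assumes "a \<in> carrier G" "A \<subseteq> carrier G" "conj_class G a \<subseteq> A"
  shows "{b \<in> A. conj_class G b = conj_class G a} = conj_class G a"
  using assms conj_class_eq_iff[OF assms(1)] by blast

end

text \<open>The abelian subgroup \<open>range \<alpha>\<close> is parametrized by an additive group.
  Since \<open>\<alpha>\<close> need not be injective, residues can be represented by plain integers
  and calculations take place before reduction. The map \<open>\<sigma>\<close> lifts conjugation by
  \<open>t\<close>, and \<open>c\<close> represents \<open>t\<^sup>2\<close>.\<close>

locale twisted_extension = group G for G :: "('a, 'b) monoid_scheme" (structure) +
  fixes \<alpha> :: "'m::ab_group_add \<Rightarrow> 'a" and \<sigma> :: "'m \<Rightarrow> 'm" and c :: 'm and t :: 'a
  assumes base_closed [simp]: "\<alpha> x \<in> carrier G"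
    and t_closed [simp]: "t \<in> carrier G"
    and base_add: "\<alpha> (x + y) = \<alpha> x \<otimes> \<alpha> y"
    and \<sigma>_add: "\<sigma> (x + y) = \<sigma> x + \<sigma> y"
    and twist: "t \<otimes> \<alpha> x = \<alpha> (\<sigma> x) \<otimes> t"
    and square: "t \<otimes> t = \<alpha> c"
    and cover: "carrier G = range \<alpha> \<union> range (\<lambda>x. \<alpha> x \<otimes> t)"
    and outer: "\<alpha> x \<noteq> \<alpha> y \<otimes> t"
    and finite_base: "finite (range \<alpha>)"
begin

definition \<tau> :: "'m \<Rightarrow> 'a" where "\<tau> x = \<alpha> x \<otimes> t"
definition fixed :: "'m \<Rightarrow> bool" where "fixed x \<longleftrightarrow> \<alpha> (\<sigma> x) = \<alpha> x"
definition F :: "'a set" where "F = {\<alpha> x | x. fixed x}"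
definition D :: "'a set" where "D = range (\<lambda>x. \<alpha> (x - \<sigma> x))"

lemma \<sigma>_0 [simp]: "\<sigma> 0 = 0" using \<sigma>_add[of 0 0] by simp
lemma \<sigma>_minus: "\<sigma> (- x) = - \<sigma> x" using \<sigma>_add[of "- x" x] by (simp add: eq_neg_iff_add_eq_0)
lemma \<sigma>_diff: "\<sigma> (x - y) = \<sigma> x - \<sigma> y" using \<sigma>_add[of x "- y"] by (simp add: \<sigma>_minus)

lemma \<tau>_closed [simp]: "\<tau> x \<in> carrier G" by (simp add: \<tau>_def)

lemma carrier_eq: "carrier G = range \<alpha> \<union> range \<tau>" by (simp add: cover \<tau>_def)

lemma base_neq_outer [simp]: "\<alpha> x \<noteq> \<tau> y" "\<tau> y \<noteq> \<alpha> x"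
  using outer[of x y] by (auto simp: \<tau>_def)

lemma base_eq_iff: "\<alpha> x = \<alpha> y \<longleftrightarrow> \<alpha> (x - y) = \<one>"
proof -
  have "\<alpha> x = \<alpha> (x - y) \<otimes> \<alpha> y" by (simp flip: base_add)
  then show ?thesis by (metis base_closed l_one one_closed right_cancel)
qed

lemma outer_eq_iff: "\<tau> x = \<tau> y \<longleftrightarrow> \<alpha> x = \<alpha> y"
  by (simp add: \<tau>_def)

lemma mult_table:
  "\<alpha> x \<otimes> \<alpha> y = \<alpha> (x + y)" "\<alpha> x \<otimes> \<tau> y = \<tau> (x + y)"
  "\<tau> x \<otimes> \<alpha> y = \<tau> (x + \<sigma> y)" "\<tau> x \<otimes> \<tau> y = \<alpha> (x + \<sigma> y + c)"
proof -
  show "\<alpha> x \<otimes> \<alpha> y = \<alpha> (x + y)" by (simp add: base_add)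
  show "\<alpha> x \<otimes> \<tau> y = \<tau> (x + y)" by (simp add: \<tau>_def base_add m_assoc)
  show *: "\<tau> x \<otimes> \<alpha> y = \<tau> (x + \<sigma> y)"
    by (simp add: \<tau>_def m_assoc twist base_add)
  have "\<tau> x \<otimes> \<tau> y = \<tau> x \<otimes> \<alpha> y \<otimes> t" by (simp add: \<tau>_def m_assoc)
  then show "\<tau> x \<otimes> \<tau> y = \<alpha> (x + \<sigma> y + c)"
    unfolding * by (simp add: \<tau>_def m_assoc square base_add)
qed

lemma base_\<sigma>_cong: "\<alpha> x = \<alpha> y \<Longrightarrow> \<alpha> (\<sigma> x) = \<alpha> (\<sigma> y)"
  using twist[of x] twist[of y] by (metis base_closed right_cancel t_closed)

text \<open>The square of \<open>t\<close> lies in the abelian subgroup and so centralizes it. On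
  representatives \<open>\<sigma>\<close> itself need not be an involution.\<close>

lemma base_\<sigma>_\<sigma>: "\<alpha> (\<sigma> (\<sigma> x)) = \<alpha> x"
proof -
  have "t \<otimes> t \<otimes> \<alpha> x = \<alpha> (\<sigma> (\<sigma> x)) \<otimes> (t \<otimes> t)"
    by (metis base_closed m_assoc t_closed twist)
  then have "\<alpha> (\<sigma> (\<sigma> x)) \<otimes> \<alpha> c = \<alpha> x \<otimes> \<alpha> c"
    by (simp add: square mult_table add.commute)
  then show ?thesis by simp
qed

lemma fixed_iff: "fixed x \<longleftrightarrow> \<alpha> (x - \<sigma> x) = \<one>"
  unfolding fixed_def by (subst eq_commute) (rule base_eq_iff)

lemma fixed_add: "fixed x \<Longrightarrow> fixed y \<Longrightarrow> fixed (x + y)"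
  by (simp add: fixed_def \<sigma>_add base_add)

lemma fixed_0: "fixed 0" by (simp add: fixed_def)

lemma fixed_minus: "fixed x \<Longrightarrow> fixed (- x)"
  using base_eq_iff[of "- \<sigma> x" "- x"] by (simp add: fixed_iff[of x]) (simp add: fixed_def \<sigma>_minus)

lemma fixed_diff: "fixed x \<Longrightarrow> fixed y \<Longrightarrow> fixed (x - y)"
  using fixed_add[of x "- y"] fixed_minus by simp

lemma fixed_cong: "\<alpha> x = \<alpha> y \<Longrightarrow> fixed x \<longleftrightarrow> fixed y"
  using base_\<sigma>_cong[of x y] by (simp add: fixed_def)

lemma F_iff: "\<alpha> x \<in> F \<longleftrightarrow> fixed x"
proof
  assume "\<alpha> x \<in> F"
  then obtain y where "\<alpha> x = \<alpha> y" "fixed y" by (auto simp: F_def)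
  then show "fixed x" using fixed_cong[of x y] by simp
qed (auto simp: F_def)

lemma F_subset: "F \<subseteq> range \<alpha>" by (auto simp: F_def)
lemma D_subset: "D \<subseteq> range \<alpha>" by (auto simp: D_def)

lemma finite_FD: "finite F" "finite D"
  by (rule finite_subset[OF F_subset finite_base], rule finite_subset[OF D_subset finite_base])

lemma D_iff: "\<alpha> x \<in> D \<longleftrightarrow> (\<exists>y. \<alpha> x = \<alpha> (y - \<sigma> y))" by (auto simp: D_def)

section \<open>Conjugation and commutation in terms of representatives\<close>

lemma conj_by:
  assumes "g \<in> carrier G" "a \<in> carrier G" "b \<in> carrier G" "g \<otimes> a = b \<otimes> g"
  shows "g \<otimes> a \<otimes> inv g = b"
  using assms by (simp add: m_assoc)

lemma conj_class_eq: "conj_class G a = range (\<lambda>y. \<alpha> y \<otimes> a \<otimes> inv (\<alpha> y)) \<union> range (\<lambda>y. \<tau> y \<otimes> a \<otimes> inv (\<tau> y))"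
  by (auto simp: conj_class_def carrier_eq)

lemma conj_class_base: "conj_class G (\<alpha> x) = {\<alpha> x, \<alpha> (\<sigma> x)}"
proof -
  have "\<alpha> y \<otimes> \<alpha> x \<otimes> inv (\<alpha> y) = \<alpha> x" for y
    by (rule conj_by) (simp_all add: mult_table add.commute)
  moreover have "\<tau> y \<otimes> \<alpha> x \<otimes> inv (\<tau> y) = \<alpha> (\<sigma> x)" for y
    by (rule conj_by) (simp_all add: mult_table add.commute)
  ultimately show ?thesis by (auto simp: conj_class_eq)
qed

lemma conj_class_outer: "conj_class G (\<tau> x) = range (\<lambda>y. \<tau> (x + (y - \<sigma> y)))"
proof -
  let ?f = "\<lambda>y. \<tau> (x + (y - \<sigma> y))"
  have 1: "\<alpha> y \<otimes> \<tau> x \<otimes> inv (\<alpha> y) = ?f y" for y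
    by (rule conj_by) (simp_all add: mult_table algebra_simps)
  \<comment> \<open>As \<open>\<tau> y = \<alpha> (y - x) \<otimes> \<tau> x\<close> and
    \<open>\<tau> x\<close> commutes with itself, conjugation by \<open>\<tau> y\<close> acts on
    \<open>\<tau> x\<close> like conjugation by \<open>\<alpha> (y - x)\<close> and adds nothing to
    the class.\<close>
  have 2: "\<tau> y \<otimes> \<tau> x \<otimes> inv (\<tau> y) = ?f (y - x)" for y
    by (rule conj_by) (simp_all add: mult_table algebra_simps \<sigma>_diff)
  have "range (\<lambda>y. ?f (y - x)) \<subseteq> range ?f"
    by (rule image_subsetI) (rule rangeI[of ?f])
  then show ?thesis unfolding conj_class_eq 1 2 by (rule Un_absorb2)
qed

lemma commute_outer_base: "\<tau> y \<otimes> \<alpha> x = \<alpha> x \<otimes> \<tau> y \<longleftrightarrow> fixed x"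
  by (simp only: mult_table outer_eq_iff fixed_def add.commute[of x y], simp add: base_add)

text \<open>The summand \<open>c\<close> occurs in both products and cancels; what remains says that
  the two elements differ by a member of \<open>F\<close>.\<close>

lemma commute_outer_outer: "\<tau> x \<otimes> \<tau> y = \<tau> y \<otimes> \<tau> x \<longleftrightarrow> fixed (x - y)"
proof -
  have "\<tau> x \<otimes> \<tau> y = \<tau> y \<otimes> \<tau> x \<longleftrightarrow> \<alpha> (x + \<sigma> y) = \<alpha> (y + \<sigma> x)"
    by (simp only: mult_table, simp add: base_add[of _ c])
  also have "\<dots> \<longleftrightarrow> \<alpha> ((x + \<sigma> y) - (y + \<sigma> x)) = \<one>" by (rule base_eq_iff)
  also have "(x + \<sigma> y) - (y + \<sigma> x) = (x - y) - \<sigma> (x - y)" by (simp add: \<sigma>_diff)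
  finally show ?thesis by (simp add: fixed_iff)
qed

text \<open>The commutator map \<open>a \<mapsto> a (t a t^-1)^-1\<close> is a homomorphism on the
  abelian subgroup with kernel \<open>F\<close> and image \<open>D\<close>. It is defined on group
  elements, not on representatives, because the count concerns the former.\<close>

lemma card_base: "card (range \<alpha>) = card F * card D"
proof -
  define f where "f a = a \<otimes> inv (t \<otimes> a \<otimes> inv t)" for a
  have f: "f (\<alpha> x) = \<alpha> (x - \<sigma> x)" for x
  proof -
    have 1: "t \<otimes> \<alpha> x \<otimes> inv t = \<alpha> (\<sigma> x)" by (rule conj_by) (simp_all add: twist)
    have "\<alpha> (x - \<sigma> x) \<otimes> \<alpha> (\<sigma> x) = \<alpha> x" by (simp add: mult_table)
    then show ?thesis unfolding f_def 1 by (simp add: inv_solve_right')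
  qed
  have "card {b \<in> range \<alpha>. f b = f a} = card F" if "a \<in> range \<alpha>" for a
  proof -
    obtain x where x: "a = \<alpha> x" using \<open>a \<in> range \<alpha>\<close> by auto
    have eq: "f (\<alpha> y) = f (\<alpha> x) \<longleftrightarrow> fixed (y - x)" for y
    proof -
      have "f (\<alpha> y) = f (\<alpha> x) \<longleftrightarrow> \<alpha> ((y - \<sigma> y) - (x - \<sigma> x)) = \<one>" unfolding f by (rule base_eq_iff)
      also have "(y - \<sigma> y) - (x - \<sigma> x) = (y - x) - \<sigma> (y - x)" by (simp add: \<sigma>_diff)
      finally show ?thesis by (simp add: fixed_iff)
    qed
    have "{b \<in> range \<alpha>. f b = f a} = \<alpha> ` {y. f (\<alpha> y) = f (\<alpha> x)}" unfolding x by blast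
    also have "\<dots> = {\<alpha> y | y. fixed (y - x)}" unfolding eq by blast
    also have "\<dots> = (\<lambda>z. z \<otimes> \<alpha> x) ` F"
    proof (intro equalityI subsetI)
      fix b assume "b \<in> {\<alpha> y | y. fixed (y - x)}"
      then obtain y where "b = \<alpha> (y - x) \<otimes> \<alpha> x" "fixed (y - x)" by (auto simp: mult_table)
      then show "b \<in> (\<lambda>z. z \<otimes> \<alpha> x) ` F" by (auto simp: F_def)
    next
      fix b assume "b \<in> (\<lambda>z. z \<otimes> \<alpha> x) ` F"
      then obtain y where "fixed y" "b = \<alpha> (y + x)" by (auto simp: F_def mult_table)
      then show "b \<in> {\<alpha> y | y. fixed (y - x)}" by (intro CollectI exI[of _ "y + x"]) simp
    qed
    also have "card \<dots> = card F"
      by (intro card_image inj_onI) (auto simp: F_def)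
    finally show ?thesis .
  qed
  then have "card (range \<alpha>) = card F * card (f ` range \<alpha>)"
    by (intro card_eq_fibre_card_times_image finite_base)
  also have "f ` range \<alpha> = D" by (auto simp: D_def f image_iff)
  finally show ?thesis .
qed


text \<open>A central element inside the abelian subgroup commutes with \<open>t\<close> and so lies
  in \<open>F\<close>; an element outside fails to commute with the \<open>\<alpha> z\<close> that
  \<open>t\<close> moves.\<close>

lemma center_eq:
  assumes "\<not> fixed z"
  shows "center G = F"
proof (intro equalityI subsetI)
  fix g assume g: "g \<in> center G"
  then have comm: "\<tau> 0 \<otimes> g = g \<otimes> \<tau> 0" "\<alpha> z \<otimes> g = g \<otimes> \<alpha> z" by (simp_all add: center_def)
  from g have "g \<in> range \<alpha> \<union> range \<tau>" by (simp add: center_def carrier_eq)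
  then consider x where "g = \<alpha> x" | x where "g = \<tau> x" by auto
  then show "g \<in> F"
  proof cases
    case (1 x)
    then show ?thesis using comm(1) commute_outer_base F_iff by simp
  next
    case (2 x)
    then show ?thesis using comm(2) commute_outer_base[of x z] assms by simp
  qed
next
  fix g assume "g \<in> F"
  then obtain x where x: "g = \<alpha> x" "fixed x" by (auto simp: F_def)
  then have "g \<otimes> \<alpha> y = \<alpha> y \<otimes> g" "g \<otimes> \<tau> y = \<tau> y \<otimes> g" for y
    using commute_outer_base[of y x] by (simp_all add: mult_table(1) add.commute)
  then show "g \<in> center G" using x(1) by (auto simp: center_def carrier_eq)
qed

section \<open>The vertices of the graph and their number\<close>

definition inner_classes :: "'a set set" where "inner_classes = conj_class G ` (range \<alpha> - F)"
definition outer_classes :: "'a set set" where "outer_classes = conj_class G ` range \<tau>"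

lemma inner_classE:
  assumes "C \<in> inner_classes"
  obtains x where "C = conj_class G (\<alpha> x)" "\<not> fixed x"
  using assms F_iff by (auto simp: inner_classes_def)

lemma outer_classE:
  assumes "C \<in> outer_classes"
  obtains x where "C = conj_class G (\<tau> x)"
  using assms by (auto simp: outer_classes_def)

lemma pverts_ccc_graph:
  assumes "\<not> fixed z"
  shows "pverts (ccc_graph G) = inner_classes \<union> outer_classes"
proof -
  have "carrier G - center G = (range \<alpha> - F) \<union> range \<tau>"
    unfolding center_eq[OF assms] carrier_eq using F_subset by auto
  then show ?thesis
    by (simp add: ccc_graph_def Let_def inner_classes_def outer_classes_def image_Un)
qed

lemma disjoint_classes: "inner_classes \<inter> outer_classes = {}"
proof (rule ccontr)
  assume "inner_classes \<inter> outer_classes \<noteq> {}"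
  then obtain C where C: "C \<in> inner_classes" "C \<in> outer_classes" by blast
  from C(1) obtain x where x: "C = conj_class G (\<alpha> x)" by (rule inner_classE)
  from C(2) obtain y where y: "C = conj_class G (\<tau> y)" by (rule outer_classE)
  have "\<tau> y \<in> {\<alpha> x, \<alpha> (\<sigma> x)}"
    using conj_class_self[of "\<tau> y"] x y conj_class_base by simp
  then show False by simp
qed

lemma fixed_\<sigma>: "fixed (\<sigma> x) \<longleftrightarrow> fixed x"
  using base_\<sigma>_\<sigma>[of x] base_\<sigma>_cong[of "\<sigma> x" x] by (auto simp: fixed_def)

lemma card_inner_classes: "2 * card inner_classes + card F = card (range \<alpha>)"
proof -
  have "card {b \<in> range \<alpha> - F. conj_class G b = conj_class G a} = 2" if "a \<in> range \<alpha> - F" for a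
  proof -
    obtain x where x: "a = \<alpha> x" "\<not> fixed x" using \<open>a \<in> range \<alpha> - F\<close> F_iff by auto
    have "conj_class G a \<subseteq> range \<alpha> - F"
      using x(2) by (simp add: x(1) conj_class_base F_iff fixed_\<sigma>)
    then have "{b \<in> range \<alpha> - F. conj_class G b = conj_class G a} = {\<alpha> x, \<alpha> (\<sigma> x)}"
      unfolding x(1) conj_class_base[symmetric] by (intro conj_class_fibre) auto
    then show ?thesis using x(2) by (simp add: fixed_def)
  qed
  then have "card (range \<alpha> - F) = 2 * card inner_classes"
    unfolding inner_classes_def using finite_base by (intro card_eq_fibre_card_times_image) auto
  moreover have "card F \<le> card (range \<alpha>)" using F_subset finite_base by (rule card_mono[rotated])
  ultimately show ?thesis using card_Diff_subset[OF finite_FD(1) F_subset] by linarith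
qed

lemma finite_outer: "finite (range \<tau>)"
proof -
  have "range \<tau> = (\<lambda>a. a \<otimes> t) ` range \<alpha>" by (auto simp: \<tau>_def)
  then show ?thesis using finite_base by simp
qed

text \<open>The outer coset is as large as the abelian subgroup, that is
  \<open>card F * card D\<close>, and each class in it is a translate of \<open>D\<close>.\<close>

lemma card_outer_classes: "card outer_classes = card F"
proof -
  have "card {b \<in> range \<tau>. conj_class G b = conj_class G a} = card D" if "a \<in> range \<tau>" for a
  proof -
    obtain x where x: "a = \<tau> x" using \<open>a \<in> range \<tau>\<close> by auto
    have "conj_class G a \<subseteq> range \<tau>" unfolding x conj_class_outer by auto
    then have "{b \<in> range \<tau>. conj_class G b = conj_class G a} = conj_class G a"
      unfolding x by (intro conj_class_fibre) auto
    also have "\<dots> = (\<lambda>d. d \<otimes> \<tau> x) ` D"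
      unfolding x conj_class_outer D_def image_image mult_table by (simp add: add.commute)
    also have "card \<dots> = card D"
      by (intro card_image inj_onI) (auto simp: D_def)
    finally show ?thesis .
  qed
  then have "card (range \<tau>) = card D * card outer_classes"
    unfolding outer_classes_def using finite_outer by (intro card_eq_fibre_card_times_image) auto
  moreover have "card (range \<tau>) = card (range \<alpha>)"
  proof -
    have "range \<tau> = (\<lambda>a. a \<otimes> t) ` range \<alpha>" by (auto simp: \<tau>_def)
    moreover have "inj_on (\<lambda>a. a \<otimes> t) (range \<alpha>)" by (intro inj_onI) auto
    ultimately show ?thesis by (simp add: card_image)
  qed
  moreover have "card D \<noteq> 0" using finite_FD by (auto simp: D_def)
  ultimately show ?thesis using card_base by simp
qed

text \<open>Membership in the same coset of \<open>D F\<close>: once a commutator is removed, the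
  difference is fixed.\<close>

definition linked :: "'m \<Rightarrow> 'm \<Rightarrow> bool" where
  "linked x y \<longleftrightarrow> (\<exists>d. fixed (y - x - (d - \<sigma> d)))"

lemma linked_refl: "linked x x"
  unfolding linked_def by (rule exI[of _ 0]) (simp add: fixed_0)

lemma linked_sym: "linked x y \<Longrightarrow> linked y x"
proof -
  assume "linked x y"
  then obtain d where "fixed (y - x - (d - \<sigma> d))" by (auto simp: linked_def)
  then have "fixed (- (y - x - (d - \<sigma> d)))" by (rule fixed_minus)
  also have "- (y - x - (d - \<sigma> d)) = x - y - ((- d) - \<sigma> (- d))" by (simp add: \<sigma>_minus)
  finally show ?thesis unfolding linked_def by (rule exI)
qed

lemma linked_trans: "linked x y \<Longrightarrow> linked y z \<Longrightarrow> linked x z"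
proof -
  assume "linked x y" "linked y z"
  then obtain d e where "fixed (y - x - (d - \<sigma> d))" "fixed (z - y - (e - \<sigma> e))" by (auto simp: linked_def)
  then have "fixed ((y - x - (d - \<sigma> d)) + (z - y - (e - \<sigma> e)))" by (rule fixed_add)
  also have "(y - x - (d - \<sigma> d)) + (z - y - (e - \<sigma> e)) = z - x - ((d + e) - \<sigma> (d + e))"
    by (simp add: \<sigma>_add)
  finally show ?thesis unfolding linked_def by (rule exI)
qed

text \<open>One label for both kinds of vertices. A non-central class inside
  \<open>range \<alpha>\<close> commutes with nothing outside and gets the empty set, so all of
  these fall together; a class outside gets the coset of \<open>D F\<close> that contains it. The
  labels have the type of the vertices, as \<open>clique_profile\<close> demands.\<close>

definition clique_label :: "'a set \<Rightarrow> 'a set" where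
  "clique_label C = {b \<in> range \<tau>. \<exists>d\<in>C. b \<otimes> d = d \<otimes> b}"

lemma clique_label_inner: "\<not> fixed x \<Longrightarrow> clique_label (conj_class G (\<alpha> x)) = {}"
  by (auto simp: clique_label_def conj_class_base commute_outer_base fixed_\<sigma>)

lemma clique_label_outer: "\<tau> y \<in> clique_label (conj_class G (\<tau> x)) \<longleftrightarrow> linked x y"
  by (auto simp: clique_label_def conj_class_outer commute_outer_outer linked_def diff_diff_eq)

lemma clique_label_subset: "clique_label C \<subseteq> range \<tau>"
  by (auto simp: clique_label_def)

lemma clique_label_outer_eq_iff:
  "clique_label (conj_class G (\<tau> x)) = clique_label (conj_class G (\<tau> y)) \<longleftrightarrow> linked x y"
proof
  assume "clique_label (conj_class G (\<tau> x)) = clique_label (conj_class G (\<tau> y))"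
  then show "linked x y" using clique_label_outer linked_refl by blast
next
  assume l: "linked x y"
  have "\<tau> z \<in> clique_label (conj_class G (\<tau> x)) \<longleftrightarrow> \<tau> z \<in> clique_label (conj_class G (\<tau> y))" for z
    unfolding clique_label_outer using l linked_sym linked_trans by blast
  then show "clique_label (conj_class G (\<tau> x)) = clique_label (conj_class G (\<tau> y))"
    using clique_label_subset[of "conj_class G (\<tau> x)"] clique_label_subset[of "conj_class G (\<tau> y)"] by blast
qed

lemma commuting_outer_classes:
  "(\<exists>a\<in>conj_class G (\<tau> x). \<exists>b\<in>conj_class G (\<tau> y). a \<otimes> b = b \<otimes> a) \<longleftrightarrow> linked x y"
proof
  assume "\<exists>a\<in>conj_class G (\<tau> x). \<exists>b\<in>conj_class G (\<tau> y). a \<otimes> b = b \<otimes> a"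
  then obtain u v where "\<tau> (x + (u - \<sigma> u)) \<otimes> \<tau> (y + (v - \<sigma> v)) = \<tau> (y + (v - \<sigma> v)) \<otimes> \<tau> (x + (u - \<sigma> u))"
    by (auto simp: conj_class_outer)
  then have "fixed ((x + (u - \<sigma> u)) - (y + (v - \<sigma> v)))" by (simp add: commute_outer_outer)
  also have "(x + (u - \<sigma> u)) - (y + (v - \<sigma> v)) = x - y - ((v - u) - \<sigma> (v - u))" by (simp add: \<sigma>_diff)
  finally have "linked y x" unfolding linked_def by (rule exI)
  then show "linked x y" by (rule linked_sym)
next
  assume "linked x y"
  then have "\<tau> y \<in> clique_label (conj_class G (\<tau> x))" by (simp add: clique_label_outer)
  then obtain a where "a \<in> conj_class G (\<tau> x)" "\<tau> y \<otimes> a = a \<otimes> \<tau> y" by (auto simp: clique_label_def)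
  then show "\<exists>a\<in>conj_class G (\<tau> x). \<exists>b\<in>conj_class G (\<tau> y). a \<otimes> b = b \<otimes> a"
    using conj_class_self[of "\<tau> y"] by (metis \<tau>_closed)
qed

lemma commuting_classes_iff:
  assumes "C \<in> inner_classes \<union> outer_classes" "C' \<in> inner_classes \<union> outer_classes"
  shows "(\<exists>a\<in>C. \<exists>b\<in>C'. a \<otimes> b = b \<otimes> a) \<longleftrightarrow> clique_label C = clique_label C'"
proof -
  \<comment> \<open>Commutation is denied in both orders, one for each of the two mixed
    cases.\<close>
  have mixed: "\<not> (\<exists>a\<in>C. \<exists>b\<in>C'. a \<otimes> b = b \<otimes> a)" "\<not> (\<exists>b\<in>C'. \<exists>a\<in>C. b \<otimes> a = a \<otimes> b)"
      "clique_label C \<noteq> clique_label C'"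
    if "C \<in> inner_classes" "C' \<in> outer_classes" for C C'
  proof -
    from \<open>C \<in> inner_classes\<close> obtain x where x: "C = conj_class G (\<alpha> x)" "\<not> fixed x" by (rule inner_classE)
    from \<open>C' \<in> outer_classes\<close> obtain y where y: "C' = conj_class G (\<tau> y)" by (rule outer_classE)
    have no: "\<not> (\<tau> z \<otimes> \<alpha> x = \<alpha> x \<otimes> \<tau> z)" "\<not> (\<tau> z \<otimes> \<alpha> (\<sigma> x) = \<alpha> (\<sigma> x) \<otimes> \<tau> z)" for z
      using x(2) by (simp_all add: commute_outer_base fixed_\<sigma>)
    show "\<not> (\<exists>a\<in>C. \<exists>b\<in>C'. a \<otimes> b = b \<otimes> a)" "\<not> (\<exists>b\<in>C'. \<exists>a\<in>C. b \<otimes> a = a \<otimes> b)"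
      unfolding x y conj_class_base conj_class_outer using no by (fastforce dest: HOL.sym)+
    have "clique_label C = {}" using x clique_label_inner by simp
    moreover have "\<tau> y \<in> clique_label C'" using y clique_label_outer linked_refl by simp
    ultimately show "clique_label C \<noteq> clique_label C'" by auto
  qed
  consider "C \<in> inner_classes" "C' \<in> inner_classes" | "C \<in> inner_classes" "C' \<in> outer_classes"
    | "C \<in> outer_classes" "C' \<in> inner_classes" | "C \<in> outer_classes" "C' \<in> outer_classes"
    using assms by blast
  then show ?thesis
  proof cases
    case 1
    then obtain x y where xy: "C = conj_class G (\<alpha> x)" "\<not> fixed x" "C' = conj_class G (\<alpha> y)" "\<not> fixed y"
      by (metis inner_classE)
    have "\<alpha> x \<otimes> \<alpha> y = \<alpha> y \<otimes> \<alpha> x" by (simp add: mult_table add.commute)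
    moreover have "\<alpha> x \<in> C" "\<alpha> y \<in> C'" by (simp_all add: xy conj_class_self)
    ultimately show ?thesis using clique_label_inner xy by auto
  next
    case 2
    then show ?thesis using mixed(1,3)[of C C'] by simp
  next
    case 3
    then show ?thesis using mixed(2,3)[of C' C] by simp
  next
    case 4
    then obtain x y where "C = conj_class G (\<tau> x)" "C' = conj_class G (\<tau> y)"
      by (metis outer_classE)
    then show ?thesis by (simp only: commuting_outer_classes clique_label_outer_eq_iff)
  qed
qed

lemma finite_classes: "finite inner_classes" "finite outer_classes"
  using finite_base finite_outer by (simp_all add: inner_classes_def outer_classes_def)

lemma cluster_graph_ccc_graph:
  assumes "\<not> fixed z"
  shows "cluster_graph (ccc_graph G) clique_label"
proof
  let ?V = "inner_classes \<union> outer_classes"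
  have V: "conj_class G ` (carrier G - center G) = ?V"
    using pverts_ccc_graph[OF assms] by (simp add: ccc_graph_def Let_def)
  show "finite (pverts (ccc_graph G))"
    using finite_classes by (simp add: pverts_ccc_graph[OF assms])
  have "parcs (ccc_graph G) = {(C, C'). C \<in> ?V \<and> C' \<in> ?V \<and> C \<noteq> C' \<and> (\<exists>a\<in>C. \<exists>b\<in>C'. a \<otimes> b = b \<otimes> a)}"
    unfolding ccc_graph_def Let_def V by simp
  then show "parcs (ccc_graph G) = {(C, C'). C \<in> pverts (ccc_graph G) \<and> C' \<in> pverts (ccc_graph G) \<and> C \<noteq> C' \<and>
      clique_label C = clique_label C'}"
    unfolding pverts_ccc_graph[OF assms]
    by (simp only:) (intro Collect_cong prod.case_cong HOL.refl conj_cong commuting_classes_iff)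
qed

text \<open>The size of an outer clique is the index of \<open>D \<inter> F\<close> in
  \<open>F\<close>: translating \<open>\<tau> x\<close> by \<open>F\<close> reaches every class of
  its clique, and two translates are conjugate iff they differ by an element of
  \<open>D\<close>.\<close>

lemma card_outer_clique:
  "card F = card (D \<inter> F) * card {C \<in> outer_classes. clique_label C = clique_label (conj_class G (\<tau> x))}"
proof -
  let ?f = "\<lambda>a. conj_class G (a \<otimes> \<tau> x)"
  have "{C \<in> outer_classes. clique_label C = clique_label (conj_class G (\<tau> x))} = ?f ` F"
  proof (intro equalityI subsetI)
    fix C assume C: "C \<in> {C \<in> outer_classes. clique_label C = clique_label (conj_class G (\<tau> x))}"
    then obtain y where y: "C = conj_class G (\<tau> y)" by (auto elim: outer_classE)
    then have "linked x y" using C by (simp add: clique_label_outer_eq_iff linked_sym)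
    then obtain d where d: "fixed (y - x - (d - \<sigma> d))" by (auto simp: linked_def)
    \<comment> \<open>What is left of the difference after removing the commutator lies in
      \<open>F\<close>; the commutator only moves an element within its class.\<close>
    let ?z = "y - x - (d - \<sigma> d)"
    have "\<tau> y = \<tau> ((?z + x) + (d - \<sigma> d))" by simp
    then have "\<tau> y \<in> conj_class G (\<tau> (?z + x))" unfolding conj_class_outer by blast
    then have "C = conj_class G (\<tau> (?z + x))" unfolding y by (simp add: conj_class_eq_iff)
    then have "C = ?f (\<alpha> ?z)" by (simp only: mult_table)
    moreover have "\<alpha> ?z \<in> F" using d by (simp only: F_iff)
    ultimately show "C \<in> ?f ` F" by (rule image_eqI)
  next
    fix C assume "C \<in> ?f ` F"
    then obtain z where z: "fixed z" "C = conj_class G (\<tau> (z + x))" by (auto simp: F_def mult_table)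
    have "fixed ((z + x) - x - (0 - \<sigma> 0))" using z(1) by simp
    then have "linked x (z + x)" unfolding linked_def by (rule exI)
    then show "C \<in> {C \<in> outer_classes. clique_label C = clique_label (conj_class G (\<tau> x))}"
      using z(2) linked_sym by (simp add: clique_label_outer_eq_iff outer_classes_def)
  qed
  moreover have "card {b \<in> F. ?f b = ?f a} = card (D \<inter> F)" if "a \<in> F" for a
  proof -
    obtain z where z: "a = \<alpha> z" "fixed z" using \<open>a \<in> F\<close> by (auto simp: F_def)
    have eq: "?f (\<alpha> y) = ?f a \<longleftrightarrow> \<alpha> (y - z) \<in> D" for y
    proof -
      have "?f (\<alpha> y) = ?f a \<longleftrightarrow> (\<exists>d. \<alpha> (y + x) = \<alpha> ((z + x) + (d - \<sigma> d)))"
        unfolding z mult_table by (simp add: conj_class_eq_iff,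
            simp add: conj_class_outer image_iff outer_eq_iff)
      also have "\<dots> \<longleftrightarrow> (\<exists>d. \<alpha> (y - z) = \<alpha> (d - \<sigma> d))"
        by (subst (1 2) base_eq_iff) (simp add: algebra_simps)
      finally show ?thesis by (simp add: D_iff)
    qed
    have "{b \<in> F. ?f b = ?f a} = (\<lambda>k. k \<otimes> a) ` (D \<inter> F)"
    proof (intro equalityI subsetI)
      fix b assume b: "b \<in> {b \<in> F. ?f b = ?f a}"
      then obtain y where y: "b = \<alpha> y" "fixed y" by (auto simp: F_def)
      then have "\<alpha> (y - z) \<in> D \<inter> F" using b eq[of y] z fixed_diff by (simp add: F_iff)
      moreover have "b = \<alpha> (y - z) \<otimes> a" by (simp add: y z mult_table)
      ultimately show "b \<in> (\<lambda>k. k \<otimes> a) ` (D \<inter> F)" by (rule image_eqI[rotated])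
    next
      fix b assume "b \<in> (\<lambda>k. k \<otimes> a) ` (D \<inter> F)"
      then obtain k where k: "k \<in> D" "k \<in> F" "b = k \<otimes> a" by auto
      then obtain y where y: "k = \<alpha> y" "fixed y" by (auto simp: F_def)
      have "b = \<alpha> (y + z)" using k y z by (simp add: mult_table)
      moreover have "\<alpha> ((y + z) - z) \<in> D" using k y by simp
      ultimately show "b \<in> {b \<in> F. ?f b = ?f a}"
        using eq[of "y + z"] fixed_add[OF y(2) z(2)] by (simp add: F_iff)
    qed
    also have "card \<dots> = card (D \<inter> F)"
      unfolding z by (intro card_image inj_onI) (auto simp: F_def)
    finally show ?thesis .
  qed
  ultimately show ?thesis
    using card_eq_fibre_card_times_image[of F ?f "card (D \<inter> F)"] finite_FD(1) by simp
qed

theorem clique_profile_ccc_graph: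
  assumes "\<not> fixed z" "2 * a + card F = card (range \<alpha>)" "card F = card (D \<inter> F) * b"
  shows "clique_profile (ccc_graph G) a b (card F)"
  unfolding clique_profile_def
proof (intro exI conjI ballI)
  interpret cg: cluster_graph "ccc_graph G" clique_label
    using assms(1) by (rule cluster_graph_ccc_graph)
  show "cluster_graph (ccc_graph G) clique_label" ..
  show V: "pverts (ccc_graph G) = inner_classes \<union> outer_classes"
    using assms(1) by (rule pverts_ccc_graph)
  show "inner_classes \<inter> outer_classes = {}" by (rule disjoint_classes)
  show ca: "card inner_classes = a" using card_inner_classes assms(2) by simp
  show "card outer_classes = card F" by (rule card_outer_classes)
  have in_label: "clique_label C = {}" if "C \<in> inner_classes" for C
    using \<open>C \<in> inner_classes\<close> by (auto elim!: inner_classE simp: clique_label_inner)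
  have out_label: "clique_label C \<noteq> {}" if "C \<in> outer_classes" for C
    using \<open>C \<in> outer_classes\<close> clique_label_outer linked_refl by (auto elim!: outer_classE)
  show "cg.size C = real a" if "C \<in> inner_classes" for C
  proof -
    have "{w \<in> pverts (ccc_graph G). clique_label w = clique_label C} = inner_classes"
      unfolding V using in_label out_label \<open>C \<in> inner_classes\<close> by blast
    then show ?thesis by (simp add: cg.size_def ca)
  qed
  show "cg.size C = real b" if "C \<in> outer_classes" for C
  proof -
    obtain x where x: "C = conj_class G (\<tau> x)" using \<open>C \<in> outer_classes\<close> by (rule outer_classE)
    have "{w \<in> pverts (ccc_graph G). clique_label w = clique_label C} =
        {w \<in> outer_classes. clique_label w = clique_label (conj_class G (\<tau> x))}"
      unfolding V x[symmetric] using in_label out_label \<open>C \<in> outer_classes\<close> by blast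
    \<comment> \<open>Both factorizations of \<open>card F\<close> contain the factor
      \<open>card (D \<inter> F)\<close>, which can therefore be cancelled.\<close>
    moreover have "card F \<noteq> 0" using finite_FD fixed_0 F_iff by auto
    ultimately show ?thesis using card_outer_clique[of x] assms(3) by (simp add: cg.size_def)
  qed
qed

end

section \<open>Comparing the three energies\<close>

text \<open>The share of one complete graph on \<open>p\<close> vertices: \<open>CN\<close> has
  there the eigenvalue \<open>-(p - 2)\<close> with multiplicity \<open>p - 1\<close> and
  \<open>(p - 1) (p - 2)\<close> once. With the same multiplicities the eigenvalues of
  \<open>CNL\<close> are \<open>p (p - 2)\<close> and \<open>0\<close>, those of \<open>CNSL\<close>
  are \<open>(p - 2)\<^sup>2\<close> and \<open>2 (p - 1) (p - 2)\<close>, which explains the next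
  two formulas.\<close>

definition clique_E :: "real \<Rightarrow> real" where
  "clique_E p = (p - 1) * \<bar>p - 2\<bar> + \<bar>(p - 1) * (p - 2)\<bar>"

definition clique_LE :: "real \<Rightarrow> real \<Rightarrow> real" where
  "clique_LE \<delta> p = (p - 1) * \<bar>p * (p - 2) - \<delta>\<bar> + \<bar>\<delta>\<bar>"

definition clique_LE_plus :: "real \<Rightarrow> real \<Rightarrow> real" where
  "clique_LE_plus \<delta> p = (p - 1) * \<bar>(p - 2)\<^sup>2 - \<delta>\<bar> + \<bar>2 * (p - 1) * (p - 2) - \<delta>\<bar>"

definition average_row_sum :: "real \<Rightarrow> real \<Rightarrow> real \<Rightarrow> real" where
  "average_row_sum a b k =
    (a * ((a - 1) * (a - 2)) + k * b * ((b - 1) * (b - 2))) / (a + k * b)"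

lemma clique_profile_energies:
  fixes \<Gamma> :: "'v pair_pre_digraph" and a b k :: nat
  assumes "clique_profile \<Gamma> a b (k * b)" "a \<ge> 1" "b \<ge> 1"
  defines "\<delta> \<equiv> average_row_sum (real a) (real b) (real k)"
  shows "E_CN \<Gamma> = clique_E (real a) + real k * clique_E (real b)"
    and "LE_CN \<Gamma> = clique_LE \<delta> (real a) + real k * clique_LE \<delta> (real b)"
    and "LE_plus_CN \<Gamma> = clique_LE_plus \<delta> (real a) + real k * clique_LE_plus \<delta> (real b)"
proof -
  obtain \<kappa> :: "'v \<Rightarrow> 'v" and V W where cg: "cluster_graph \<Gamma> \<kappa>"
    and VW: "pverts \<Gamma> = V \<union> W" "V \<inter> W = {}" "card V = a" "card W = k * b"
      "\<forall>v\<in>V. cluster_graph.size \<Gamma> \<kappa> v = real a"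
      "\<forall>w\<in>W. cluster_graph.size \<Gamma> \<kappa> w = real b"
    using assms(1) unfolding clique_profile_def by (elim exE conjE) (rule that)
  interpret cluster_graph \<Gamma> \<kappa> by (rule cg)
  have fin: "finite V" "finite W" using finite_pverts VW(1) by simp_all
  have sum: "(\<Sum>v\<in>pverts \<Gamma>. f (size v)) = real a * f (real a)
      + real k * (real b * f (real b))" for f :: "real \<Rightarrow> real"
    using fin VW by (simp add: sum.union_disjoint)
  \<comment> \<open>A clique of size \<open>p\<close> has \<open>p\<close> vertices, each carrying
    one \<open>p\<close>-th of its spectral sum.\<close>
  have bt: "real p * block_trace h (real p) x y = (real p - 1) * h y + h (real p * x + y)"
      if "p \<ge> 1" for p :: nat and h x y
    using that by (simp add: block_trace_def)
  have "card (pverts \<Gamma>) = a + k * b" using fin VW by (simp add: card_Un_disjoint)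
  then have avg: "CN_avg \<Gamma> = \<delta>"
    unfolding CN_avg_eq sum[of "\<lambda>p. (p - 1) * (p - 2)"] by (simp add: \<delta>_def average_row_sum_def mult.assoc)
  show "E_CN \<Gamma> = clique_E (real a) + real k * clique_E (real b)"
    unfolding E_CN_eq sum[of "\<lambda>p. block_trace abs p (p - 2) (- (p - 2))"] bt[OF assms(2)] bt[OF assms(3)]
    by (simp add: clique_E_def algebra_simps abs_minus_commute)
  have cancel: "p * - (p - 2) + p * (p - 2) = 0" for p :: real
    by (simp add: algebra_simps)
  show "LE_CN \<Gamma> = clique_LE \<delta> (real a) + real k * clique_LE \<delta> (real b)"
    unfolding LE_CN_eq avg sum[of "\<lambda>p. block_trace (\<lambda>x. \<bar>x - \<delta>\<bar>) p (- (p - 2)) (p * (p - 2))"]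
        bt[OF assms(2)] bt[OF assms(3)] cancel clique_LE_def
    by simp
  have merge: "p * (p - 2) + (p - 2)\<^sup>2 = 2 * (p - 1) * (p - 2)" for p :: real
    by (simp add: power2_eq_square algebra_simps)
  show "LE_plus_CN \<Gamma> = clique_LE_plus \<delta> (real a) + real k * clique_LE_plus \<delta> (real b)"
    unfolding LE_plus_CN_eq avg sum[of "\<lambda>p. block_trace (\<lambda>x. \<bar>x - \<delta>\<bar>) p (p - 2) ((p - 2)\<^sup>2)"]
        bt[OF assms(2)] bt[OF assms(3)] merge clique_LE_plus_def ..
qed

text \<open>If all cliques have one size, every row sum equals \<open>\<delta>\<close>, and
  subtracting \<open>\<delta>\<close> from \<open>CNL\<close> and \<open>CNSL\<close> leaves
  \<open>-CN\<close> and \<open>CN\<close>. If the sizes are at most two, no two vertices have a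
  common neighbour and all matrices vanish.\<close>

lemma energies_equal:
  fixes \<Gamma> :: "'v pair_pre_digraph" and a b k :: nat
  assumes "clique_profile \<Gamma> a b (k * b)" "a \<ge> 1" "b \<ge> 1" "a = b \<or> a \<le> 2 \<and> b \<le> 2"
  shows "E_CN \<Gamma> = LE_plus_CN \<Gamma> \<and> LE_plus_CN \<Gamma> = LE_CN \<Gamma>"
proof -
  define \<delta> where "\<delta> = average_row_sum (real a) (real b) (real k)"
  note en = clique_profile_energies[OF assms(1-3), folded \<delta>_def]
  show ?thesis
  proof (cases "a = b")
    case True
    have "real a + real k * real a > 0" using assms(2) by (simp add: add_pos_nonneg)
    then have \<delta>: "\<delta> = (real a - 1) * (real a - 2)"
      unfolding \<delta>_def average_row_sum_def True[symmetric] by (simp add: field_simps)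
    have 1: "real a * (real a - 2) - \<delta> = real a - 2" "(real a - 2)\<^sup>2 - \<delta> = - (real a - 2)"
      "2 * (real a - 1) * (real a - 2) - \<delta> = \<delta>"
      unfolding \<delta> by (simp_all add: power2_eq_square algebra_simps)
    have "clique_LE \<delta> (real a) = clique_E (real a)" "clique_LE_plus \<delta> (real a) = clique_E (real a)"
      unfolding clique_LE_def clique_LE_plus_def clique_E_def 1 abs_minus_cancel by (simp_all add: \<delta>)
    then show ?thesis unfolding en True[symmetric] by simp
  next
    case False
    have small: "real p = 1 \<or> real p = 2" if "p \<ge> 1" "p \<le> 2" for p using that by auto
    have ab: "real a = 1 \<or> real a = 2" "real b = 1 \<or> real b = 2"
      using False small assms by auto
    have "(p - 1) * (p - 2) = 0" "clique_E p = 0" "clique_LE 0 p = 0" "clique_LE_plus 0 p = 0"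
        if "p = 1 \<or> p = 2" for p :: real
      using that by (auto simp: clique_E_def clique_LE_def clique_LE_plus_def)
    note z = this[OF ab(1)] this[OF ab(2)]
    have "\<delta> = 0" unfolding \<delta>_def average_row_sum_def z by simp
    then show ?thesis unfolding en by (simp add: z)
  qed
qed

text \<open>The row sums in the large and the small cliques are \<open>u\<close> and
  \<open>w\<close>, and \<open>\<delta>\<close> is their mean over the vertices. The bounds
  \<open>2 * w \<le> \<delta> < u\<close> fix the sign of all deviations but one. Then
  \<open>LE_plus_CN\<close> is at least \<open>2 * (2 * u - \<delta>)\<close>, which exceeds
  \<open>E_CN\<close>, equal to \<open>2 * u + 2 * K * w\<close>, as soon as
  \<open>K * w < u - \<delta>\<close>; this is the fact \<open>gap\<close>.\<close>

lemma energies_strictly_increasing: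
  fixes \<Gamma> :: "'v pair_pre_digraph" and a b k :: nat
  assumes profile: "clique_profile \<Gamma> a b (k * b)" and b: "b \<ge> 1" and a: "a \<ge> 3"
    and k: "k = 1 \<or> k = 2" and ab: "b + k * b \<le> a"
  shows "E_CN \<Gamma> < LE_plus_CN \<Gamma> \<and> LE_plus_CN \<Gamma> < LE_CN \<Gamma>"
proof -
  define A B K where "A = real a" and "B = real b" and "K = real k"
  define u w where "u = (A - 1) * (A - 2)" and "w = (B - 1) * (B - 2)"
  define \<delta> where "\<delta> = (A * u + K * B * w) / (A + K * B)"
  have "a \<ge> 1" using a by simp
  have "average_row_sum A B K = \<delta>" by (simp add: average_row_sum_def \<delta>_def u_def w_def)
  with clique_profile_energies[OF profile \<open>a \<ge> 1\<close> b]
  have en: "E_CN \<Gamma> = clique_E A + K * clique_E B"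
    "LE_CN \<Gamma> = clique_LE \<delta> A + K * clique_LE \<delta> B"
    "LE_plus_CN \<Gamma> = clique_LE_plus \<delta> A + K * clique_LE_plus \<delta> B"
    by (simp_all add: A_def B_def K_def)
  have A: "A \<ge> 3" using a by (simp add: A_def)
  have B: "B = 1 \<or> B \<ge> 2" "B \<ge> 1" using b by (auto simp: B_def)
  have K: "K \<ge> 1" "K > 0" using k by (auto simp: K_def)
  have "real (b + k * b) \<le> real a" using ab by (simp only: of_nat_le_iff)
  then have AKB: "K * B + B \<le> A" by (simp add: A_def B_def K_def algebra_simps)
  have "B \<le> K * B" using mult_right_mono[of 1 K B] K B by simp
  then have AB: "2 * B \<le> A" using AKB by linarith
  have w: "w \<ge> 0" using B by (auto simp: w_def)
  have N: "A + K * B > 0" using A K B by (simp add: add_pos_nonneg)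
  have \<delta>: "\<delta> * (A + K * B) = A * u + K * B * w" using N by (simp add: \<delta>_def)
  \<comment> \<open>As \<open>A \<ge> 2 * B\<close>, it suffices to compare \<open>u\<close> with
    \<open>3 * w\<close> at \<open>A = 2 * B\<close>.\<close>
  have "(2 * B - 1) * (2 * B - 2) \<le> u"
    unfolding u_def using AB B(2) by (intro mult_mono) linarith+
  moreover have "(2 * B - 1) * (2 * B - 2) - 3 * w = (B - 1) * (B + 4)" by (simp add: w_def algebra_simps)
  moreover have "(B - 1) * (B + 4) \<ge> 0" using B(2) by simp
  ultimately have u3: "3 * w \<le> u" by linarith
  have u0: "u \<ge> 2" unfolding u_def using mult_mono[of 2 "A - 1" 1 "A - 2"] A by simp
  then have wu: "w < u" using u3 w by linarith
  have \<delta>u: "\<delta> < u"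
  proof -
    have "\<delta> * (A + K * B) < u * (A + K * B)"
      unfolding \<delta> using mult_strict_left_mono[OF wu, of "K * B"] K B by (simp add: algebra_simps)
    then show ?thesis using N by simp
  qed
  \<comment> \<open>The factor two puts the small cliques below the mean: for
    \<open>B \<ge> 2\<close> their eigenvalues in \<open>CNL\<close> and \<open>CNSL\<close> are at
    most \<open>2 * w\<close>.\<close>
  have \<delta>w: "2 * w \<le> \<delta>"
  proof -
    have "K * B * w \<le> A * w" using AKB B w by (intro mult_right_mono) linarith+
    moreover have "A * (3 * w) \<le> A * u" using u3 A by (intro mult_left_mono) auto
    ultimately have "(2 * w) * (A + K * B) \<le> \<delta> * (A + K * B)" unfolding \<delta> by (simp add: algebra_simps)
    then show ?thesis using N by simp
  qed
  have \<delta>0: "\<delta> \<ge> 0" using \<delta>w w by linarith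
  have gap: "K * w < u - \<delta>"
  proof -
    \<comment> \<open>Multiplying the claim by \<open>A + K * B\<close> turns
      \<open>u - \<delta>\<close> into \<open>K * B * (u - w)\<close>. After cancelling
      \<open>K\<close> and using \<open>A + K * B \<le> 2 * A - B\<close>, this inequality is what
      remains.\<close>
    have "w * (2 * A - B) < B * (u - w)"
    proof (cases "B = 1")
      case True
      then show ?thesis using u0 by (simp add: w_def)
    next
      case False
      then have B2: "B \<ge> 2" using B by blast
      have uw: "u - w = (A - B) * (A + B - 3)" by (simp add: u_def w_def algebra_simps)
      \<comment> \<open>The factor 3 is shifted so that both comparisons of factors become
        \<open>2 * B \<le> A\<close>.\<close>
      have "(2 * A - B) * (B - 1) = ((2 * A - B) / 3) * (3 * (B - 1))" by simp
      also have "\<dots> \<le> (A - B) * (A + B - 3)" using AB B2 by (intro mult_mono) auto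
      finally have "B * ((2 * A - B) * (B - 1)) \<le> B * (u - w)"
        unfolding uw using B2 by (intro mult_left_mono) auto
      moreover have "w * (2 * A - B) < B * ((2 * A - B) * (B - 1))"
      proof -
        have "0 < (2 * A - B) * (B - 1) * 2" using AB B2 by simp
        then show ?thesis by (simp add: w_def algebra_simps)
      qed
      ultimately show ?thesis by linarith
    qed
    moreover have "w * (A + K * B) \<le> w * (2 * A - B)" using AKB w by (intro mult_left_mono) auto
    ultimately have "w * (A + K * B) < B * (u - w)" by linarith
    then have "K * (w * (A + K * B)) < K * (B * (u - w))" using K by simp
    then have "(K * w) * (A + K * B) < (u - \<delta>) * (A + K * B)"
      using \<delta> by (simp add: algebra_simps)
    then show ?thesis using N by simp
  qed
  have uA: "A * (A - 2) = u + (A - 2)" "(A - 2)\<^sup>2 = u - (A - 2)" "2 * (A - 1) * (A - 2) = 2 * u"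
    "2 * (B - 1) * (B - 2) = 2 * w"
    by (simp_all add: u_def w_def power2_eq_square algebra_simps)
  have EA: "clique_E A = 2 * u" using A by (simp add: clique_E_def u_def)
  have EB: "clique_E B = 2 * w" using B by (auto simp: clique_E_def w_def)
  have LA: "clique_LE \<delta> A = (A - 1) * (u + (A - 2) - \<delta>) + \<delta>"
    unfolding clique_LE_def uA using A \<delta>u \<delta>0 by simp
  have LB: "clique_LE \<delta> B = (B - 1) * (\<delta> - B * (B - 2)) + \<delta>"
  proof (cases "B = 1")
    case False
    have "B * (B - 2) \<le> (2 * (B - 1)) * (B - 2)" using False B by (intro mult_right_mono) auto
    then have "B * (B - 2) \<le> 2 * w" by (simp only: w_def mult.assoc)
    then show ?thesis using \<delta>w \<delta>0 by (simp add: clique_LE_def)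
  qed (use \<delta>0 in \<open>simp add: clique_LE_def\<close>)
  have PA: "clique_LE_plus \<delta> A = (A - 1) * \<bar>u - (A - 2) - \<delta>\<bar> + (2 * u - \<delta>)"
    unfolding clique_LE_plus_def uA using \<delta>u u0 by simp
  have PB: "clique_LE_plus \<delta> B = (B - 1) * (\<delta> - (B - 2)\<^sup>2) + (\<delta> - 2 * w)"
  proof (cases "B = 1")
    case False
    have "(B - 2) * (B - 2) \<le> (2 * (B - 1)) * (B - 2)" using False B by (intro mult_right_mono) auto
    then have "(B - 2)\<^sup>2 \<le> 2 * w" by (simp only: w_def mult.assoc power2_eq_square)
    then show ?thesis unfolding clique_LE_plus_def uA using \<delta>w by simp
  qed (use \<delta>0 in \<open>simp add: clique_LE_plus_def w_def\<close>)
  \<comment> \<open>Deviations from the mean sum to zero; this trades the terms of the small cliques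
    for terms in \<open>A\<close>, \<open>u\<close> and \<open>\<delta>\<close>.\<close>
  have bal: "\<delta> * A + \<delta> * (K * B) = A * u + K * (B * w)" using \<delta> by (simp add: algebra_simps)
  have LE: "LE_CN \<Gamma> = 2 * (A - 1) * (u + (A - 2) - \<delta>)"
  proof -
    have "LE_CN \<Gamma> = (A - 1) * (u + (A - 2)) - (A - 1) * \<delta> + \<delta> + \<delta> * (K * B) - K * (B * w)"
      unfolding en LA LB by (simp add: w_def algebra_simps)
    also have "\<dots> = (A - 1) * (u + (A - 2)) - (A - 1) * \<delta> + \<delta> + A * u - \<delta> * A" using bal by linarith
    also have "\<dots> = 2 * (A - 1) * (u + (A - 2) - \<delta>)" by (simp add: u_def algebra_simps)
    finally show ?thesis .
  qed
  have LEp: "LE_plus_CN \<Gamma> = (A - 1) * (\<bar>u - (A - 2) - \<delta>\<bar> + (u - (A - 2) - \<delta>)) + 2 * (2 * u - \<delta>)"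
  proof -
    have "LE_plus_CN \<Gamma> = (A - 1) * \<bar>u - (A - 2) - \<delta>\<bar> + (2 * u - \<delta>) + (\<delta> * (K * B) - K * (B * w))"
      unfolding en PA PB by (simp add: w_def algebra_simps power2_eq_square)
    also have "\<dots> = (A - 1) * \<bar>u - (A - 2) - \<delta>\<bar> + (2 * u - \<delta>) + (A * u - \<delta> * A)" using bal by linarith
    also have "\<dots> = (A - 1) * (\<bar>u - (A - 2) - \<delta>\<bar> + (u - (A - 2) - \<delta>)) + 2 * (2 * u - \<delta>)"
      by (simp add: u_def algebra_simps)
    finally show ?thesis .
  qed
  have "E_CN \<Gamma> = 2 * u + K * (2 * w)" unfolding en EA EB ..
  moreover have "(A - 1) * (\<bar>u - (A - 2) - \<delta>\<bar> + (u - (A - 2) - \<delta>)) \<ge> 0" using A by simp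
  ultimately have "E_CN \<Gamma> < LE_plus_CN \<Gamma>" unfolding LEp using gap by (simp add: algebra_simps)
  \<comment> \<open>The deviation of the eigenvalue \<open>(A - 2)\<^sup>2\<close> of
    \<open>CNSL\<close> can have either sign, so the comparison is split by it.\<close>
  moreover have "LE_plus_CN \<Gamma> < LE_CN \<Gamma>"
  proof (cases "u - (A - 2) - \<delta> \<ge> 0")
    case True
    have "LE_CN \<Gamma> - LE_plus_CN \<Gamma> = 4 * (A - 1) * (A - 2) - 4 * u + 2 * \<delta>"
      unfolding LE LEp using True by (simp add: algebra_simps)
    also have "\<dots> = 2 * \<delta>" by (simp add: u_def)
    finally have "LE_CN \<Gamma> - LE_plus_CN \<Gamma> = 2 * \<delta>" .
    moreover have "\<delta> > 0"
    proof -
      have "A * u + K * B * w > 0" using A u0 K B w by (intro add_pos_nonneg) auto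
      then show ?thesis using N by (simp add: \<delta>_def)
    qed
    ultimately show ?thesis by linarith
  next
    case False
    have "LE_CN \<Gamma> - LE_plus_CN \<Gamma> = 2 * ((A - 2) * (u - \<delta>))"
      unfolding LE LEp using False by (simp add: u_def algebra_simps)
    moreover have "(A - 2) * (u - \<delta>) > 0" using A \<delta>u by simp
    ultimately show ?thesis by linarith
  qed
  ultimately show ?thesis ..
qed

section \<open>Normal forms in groups given by generators and relations\<close>

context group
begin

text \<open>Conjugation by \<open>g\<close> is an endomorphism and carries powers to powers. The
  form of a swap lets \<open>t\<close> be moved past a power in one rewriting step.\<close>

lemma conj_int_pow:
  assumes "g \<in> carrier G" "x \<in> carrier G" "y \<in> carrier G" "g \<otimes> x = y \<otimes> g"
  shows "g \<otimes> x [^] (i::int) = y [^] i \<otimes> g"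
proof -
  let ?h = "\<lambda>x. g \<otimes> x \<otimes> inv g"
  have "inv g \<otimes> (g \<otimes> z) = z" if "z \<in> carrier G" for z
    using that assms(1) by (simp flip: m_assoc)
  then have "?h \<in> hom G G"
    using assms(1) by (simp add: hom_def m_assoc)
  from hom_int_pow[OF this assms(2) group_axioms group_axioms, of i]
  have 1: "?h (x [^] i) = ?h x [^] i" .
  have 2: "?h x = y" using assms by (simp add: m_assoc)
  show ?thesis using 1 assms(1-3) unfolding 2 by (simp add: inv_solve_right')
qed

lemma int_pow_commute:
  assumes "x \<in> carrier G" "y \<in> carrier G" "x \<otimes> y = y \<otimes> x"
  shows "x [^] (i::int) \<otimes> y [^] (j::int) = y [^] j \<otimes> x [^] i"
  using assms conj_int_pow[of x y y j] conj_int_pow[of "y [^] j" x x i] by simp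

end

text \<open>Evaluation of words in \<open>G\<close>, faithful up to \<open>word_eq\<close>. Working
  with it in \<open>G\<close> itself makes it unnecessary to transport the graph and its energies
  along the isomorphism.\<close>

locale presentation = group G for G :: "('a, 'b) monoid_scheme" (structure) +
  fixes R :: "gen word rel" and \<psi> :: "gen word \<Rightarrow> 'a"
  assumes \<psi>_closed [simp]: "\<psi> w \<in> carrier G"
    and \<psi>_append: "\<psi> (w @ w') = \<psi> w \<otimes> \<psi> w'"
    and \<psi>_eq_iff: "\<psi> w = \<psi> w' \<longleftrightarrow> word_eq R w w'"
    and \<psi>_surj: "carrier G = range \<psi>"
begin

lemma \<psi>_Nil [simp]: "\<psi> [] = \<one>"
  using \<psi>_append[of "[]" "[]"] by simp

lemma \<psi>_word_inv: "\<psi> (word_inv w) = inv (\<psi> w)"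
proof -
  have "\<psi> (word_inv w) \<otimes> \<psi> w = \<one>"
    unfolding \<psi>_append[symmetric] \<psi>_Nil[symmetric] \<psi>_eq_iff by (rule word_eq_inv)
  then show ?thesis by (simp add: inv_equality)
qed

lemma \<psi>_word_pow: "\<psi> (word_pow w n) = \<psi> w [^] n"
proof (induction n)
  case (Suc n)
  have "word_pow w (Suc n) = w @ word_pow w n" by (simp add: word_pow_def)
  then show ?case using Suc nat_pow_Suc2[of "\<psi> w" n] by (simp add: \<psi>_append)
qed (simp add: word_pow_def)

lemma \<psi>_relation: "(l, r) \<in> R \<Longrightarrow> \<psi> l = \<psi> r"
  unfolding \<psi>_eq_iff by (rule word_eq.relation)

end

lemma presentation_exists:
  assumes "group G" "G \<cong> presented_group R"
  obtains \<psi> where "presentation G R \<psi>"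
proof -
  obtain \<phi> where \<phi>: "\<phi> \<in> iso (presented_group R) G"
    using group.iso_sym[OF assms] by (auto simp: is_iso_def)
  then have hom: "\<phi> \<in> hom (presented_group R) G"
      and bij: "bij_betw \<phi> (carrier (presented_group R)) (carrier G)"
    by (auto simp: iso_def)
  have carrier: "carrier (presented_group R) = range (word_class R)" by (simp add: presented_group_def)
  have "presentation G R (\<lambda>w. \<phi> (word_class R w))"
  proof (intro presentation.intro presentation_axioms.intro assms(1))
    fix w w'
    show "\<phi> (word_class R w) \<in> carrier G" using hom by (auto simp: hom_def carrier)
    show "\<phi> (word_class R (w @ w')) = \<phi> (word_class R w) \<otimes>\<^bsub>G\<^esub> \<phi> (word_class R w')"
      using hom_mult[OF hom, of "word_class R w" "word_class R w'"]
      by (simp add: carrier presented_group_mult)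
    show "\<phi> (word_class R w) = \<phi> (word_class R w') \<longleftrightarrow> word_eq R w w'"
      using inj_on_eq_iff[OF bij_betw_imp_inj_on[OF bij, unfolded carrier] rangeI rangeI]
      by (simp only: word_class_eq_iff)
    show "carrier G = range (\<lambda>w. \<phi> (word_class R w))"
      using bij_betw_imp_surj_on[OF bij] by (auto simp: carrier image_image)
  qed
  then show ?thesis by (rule that)
qed

text \<open>
  The data of \<open>u\<^sup>p = v\<^sup>q = 1\<close>, \<open>t u = u\<^sup>r v\<^sup>s t\<close>, \<open>t\<^sup>2 = u\<^sup>c v\<close> with central \<open>v\<close>.
  The triple \<open>(i, j, e)\<close> stands for
  \<open>u\<^sup>i v\<^sup>j t\<^sup>e\<close>, unreduced modulo \<open>p\<close> and \<open>q\<close>, and \<open>step\<close> is left multiplication by a letter; the generator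
  that is not \<open>gu\<close> acts as \<open>t\<close>.
\<close>

locale extension_data =
  fixes p q r s c :: int and gu :: gen
  assumes p: "p > 0" and q: "q > 0"
    and r: "p dvd r * r - 1" and s: "q dvd s * r + s" and rc: "p dvd r * c - c" and sc: "q dvd s * c"
    and sp: "q dvd s * p"
begin

text \<open>Moving \<open>t\<close> past \<open>u^i v^j\<close> replaces the exponents by
  \<open>(r i, s i + j)\<close>. A second \<open>t\<close> is absorbed as \<open>u^c v\<close>, and
  \<open>t^-1\<close> is read as \<open>u^-c v^-1 t\<close>, which explains the corrections by
  \<open>c\<close> and 1.\<close>

fun step :: "gen \<times> bool \<Rightarrow> int \<times> int \<times> bool \<Rightarrow> int \<times> int \<times> bool" where
  "step (g, b) (i, j, e) =
    (if g = gu then (if b then i + 1 else i - 1, j, e)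
     else if b then (r * i + (if e then c else 0), s * i + j + (if e then 1 else 0), \<not> e)
     else (r * i - (if e then 0 else c), s * i + j - (if e then 0 else 1), \<not> e))"

definition act :: "gen word \<Rightarrow> int \<times> int \<times> bool \<Rightarrow> int \<times> int \<times> bool" where
  "act w = foldr step w"

fun sim :: "int \<times> int \<times> bool \<Rightarrow> int \<times> int \<times> bool \<Rightarrow> bool" where
  "sim (i, j, e) (i', j', e') \<longleftrightarrow> p dvd i - i' \<and> q dvd j - j' \<and> e = e'"

lemma act_Nil [simp]: "act [] z = z" by (simp add: act_def)
lemma act_Cons [simp]: "act (a # w) z = step a (act w z)" by (simp add: act_def)
lemma act_append: "act (w @ w') z = act w (act w' z)" by (simp add: act_def)

lemma act_word_pow: "act (word_pow w n) z = (act w ^^ n) z"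
  by (induction n) (simp_all add: word_pow_def act_append)

lemma sim_refl: "sim z z" by (cases z) simp

lemma sim_sym: "sim z z' \<Longrightarrow> sim z' z"
  by (cases z; cases z') (auto simp: dvd_diff_commute)

lemma sim_trans:
  assumes "sim z z'" "sim z' z''"
  shows "sim z z''"
proof -
  obtain i j e i' j' e' i'' j'' e'' where z: "z = (i, j, e)" "z' = (i', j', e')" "z'' = (i'', j'', e'')"
    by (cases z; cases z'; cases z'')
  note d = assms[unfolded z sim.simps]
  have "p dvd (i - i') + (i' - i'')" "q dvd (j - j') + (j' - j'')"
    using d by (blast intro: dvd_add)+
  then show ?thesis using d by (simp add: z)
qed

lemma sim_step: 
  assumes "sim z z'"
  shows "sim (step a z) (step a z')"
proof -
  obtain i j e i' j' where z: "z = (i, j, e)" "z' = (i', j', e)" and d: "p dvd i - i'" "q dvd j - j'"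
    using assms by (cases z; cases z') auto
  obtain g b where a: "a = (g, b)" by (cases a)
  have "p dvd r * (i - i')" using d(1) by simp
  then have 1: "p dvd r * i - r * i'" by (simp add: right_diff_distrib)
  have "q dvd s * (i - i')" using d(1) sp by (metis dvd_trans mult_dvd_mono dvd_refl)
  then have "q dvd s * (i - i') + (j - j')" using d(2) by (rule dvd_add)
  then have 2: "q dvd (s * i + j) - (s * i' + j')" by (simp add: algebra_simps)
  show ?thesis using d 1 2 by (cases b; cases e) (simp_all add: z a algebra_simps)
qed

lemma sim_act: "sim z z' \<Longrightarrow> sim (act w z) (act w z')"
  by (induction w) (auto intro: sim_step)

text \<open>The congruences on \<open>r\<close>, \<open>s\<close> and \<open>c\<close> say that the
  map \<open>(i, j) \<mapsto> (r i, s i + j)\<close> is an involution modulo \<open>p\<close> and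
  \<open>q\<close> that fixes the exponents \<open>(c, 1)\<close> of \<open>t\<^sup>2\<close>. This
  is what makes the letters for \<open>t\<close> and \<open>t^-1\<close> undo each other.\<close>

lemma step_cancel: "sim (step (g, b) (step (g, \<not> b) z)) z"
proof -
  obtain i j e where z: "z = (i, j, e)" by (cases z)
  have 1: "p dvd r * (r * i) - i" using dvd_mult2[OF r, of i] by (simp add: algebra_simps)
  have 2: "q dvd s * (r * i) + s * i" using dvd_mult2[OF s, of i] by (simp add: algebra_simps)
  have 3: "p dvd r * (r * i - c) + c - i" "p dvd r * (r * i + c) - c - i"
    using dvd_diff[OF 1 rc] dvd_add[OF 1 rc] by (simp_all add: algebra_simps)
  have 4: "q dvd s * (r * i - c) + s * i" "q dvd s * (r * i + c) + s * i"
    using dvd_diff[OF 2 sc] dvd_add[OF 2 sc] by (simp_all add: algebra_simps)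
  show ?thesis using 1 2 3 4 by (cases b; cases e) (simp_all add: z algebra_simps)
qed

text \<open>If the action respects the defining relations, it respects every consequence of them.
  Words acting differently on some triple are therefore different in the group.\<close>

lemma word_eq_act:
  assumes "word_eq R w w'" and "\<And>l r z. (l, r) \<in> R \<Longrightarrow> sim (act l z) (act r z)"
  shows "sim (act w z) (act w' z)"
  using assms(1)
proof (induction arbitrary: z)
  case (refl u) show ?case by (rule sim_refl)
next
  case (sym u v) then show ?case using sim_sym by blast
next
  case (trans u v w) then show ?case using sim_trans by blast
next
  case (cong u u' v v')
  then show ?case unfolding act_append using sim_trans sim_act by blast
next
  case (cancel g b) show ?case using step_cancel by simp
next
  case (relation l r) then show ?case by (rule assms(2))
qed

end

text \<open>Reduced exponents of the elements of \<open>F\<close>, and in the next definition of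
  \<open>D \<inter> F\<close>, as pure arithmetic: the counting can then be done without any
  group.\<close>

definition fixed_box :: "int \<Rightarrow> int \<Rightarrow> int \<Rightarrow> int \<Rightarrow> (int \<times> int) set" where
  "fixed_box p q r s = {x \<in> {0..<p} \<times> {0..<q}. p dvd (r - 1) * fst x \<and> q dvd s * fst x}"

definition fixed_commutator_box :: "int \<Rightarrow> int \<Rightarrow> int \<Rightarrow> int \<Rightarrow> (int \<times> int) set" where
  "fixed_commutator_box p q r s =
    {x \<in> fixed_box p q r s. \<exists>k. p dvd fst x + (r - 1) * k \<and> q dvd snd x + s * k}"

text \<open>The element \<open>v\<close> is the value of a word \<open>wv\<close>: the empty word
  where \<open>t\<^sup>2\<close> is a power of \<open>u\<close>, and the square of the letter
  \<open>gt\<close> for \<open>U_nm\<close> and \<open>V_8n\<close>. The assumptions on the action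
  separate normal forms, those on \<open>\<psi>\<close> reduce words to them.\<close>

locale index_two_presentation = presentation G R \<psi> + extension_data p q r s c gu
  for G :: "('a, 'b) monoid_scheme" (structure) and R \<psi> p q r s c gu +
  fixes gt :: gen and wv :: "gen word"
  assumes gens: "gu \<noteq> gt"
    and act_relation: "(l, l') \<in> R \<Longrightarrow> sim (act l z) (act l' z)"
    and act_wv: "sim (act wv (i, j, e)) (i, j + 1, e)"
    and u_pow: "\<psi> [(gu, True)] [^] p = \<one>"
    and v_pow: "\<psi> wv [^] q = \<one>"
    and uv: "\<psi> [(gu, True)] \<otimes> \<psi> wv = \<psi> wv \<otimes> \<psi> [(gu, True)]"
    and tv: "\<psi> [(gt, True)] \<otimes> \<psi> wv = \<psi> wv \<otimes> \<psi> [(gt, True)]"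
    and tu: "\<psi> [(gt, True)] \<otimes> \<psi> [(gu, True)] = \<psi> [(gu, True)] [^] r \<otimes> \<psi> wv [^] s \<otimes> \<psi> [(gt, True)]"
    and tt: "\<psi> [(gt, True)] \<otimes> \<psi> [(gt, True)] = \<psi> [(gu, True)] [^] c \<otimes> \<psi> wv"
begin

section \<open>Existence of the normal form\<close>

definition "u = \<psi> [(gu, True)]"
definition "v = \<psi> wv"
definition "t = \<psi> [(gt, True)]"

definition \<alpha> :: "int \<times> int \<Rightarrow> 'a" where "\<alpha> x = u [^] fst x \<otimes> v [^] snd x"
definition \<sigma> :: "int \<times> int \<Rightarrow> int \<times> int" where "\<sigma> x = (r * fst x, s * fst x + snd x)"

lemma uvt_closed [simp]: "u \<in> carrier G" "v \<in> carrier G" "t \<in> carrier G"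
  by (simp_all add: u_def v_def t_def)

lemmas relations = u_pow[folded u_def] v_pow[folded v_def] uv[folded u_def v_def]
  tv[folded t_def v_def] tu[folded t_def u_def v_def] tt[folded t_def u_def v_def]

lemma \<alpha>_closed [simp]: "\<alpha> x \<in> carrier G" by (simp add: \<alpha>_def)

lemma \<alpha>_add: "\<alpha> (x + y) = \<alpha> x \<otimes> \<alpha> y"
proof -
  have "\<alpha> (x + y) = u [^] fst x \<otimes> (u [^] fst y \<otimes> v [^] snd x) \<otimes> v [^] snd y"
    by (simp add: \<alpha>_def int_pow_mult m_assoc)
  also have "u [^] fst y \<otimes> v [^] snd x = v [^] snd x \<otimes> u [^] fst y"
    by (rule int_pow_commute) (simp_all add: relations)
  finally show ?thesis by (simp add: \<alpha>_def m_assoc)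
qed

lemma twist: "t \<otimes> \<alpha> x = \<alpha> (\<sigma> x) \<otimes> t"
proof -
  have 1: "t \<otimes> v [^] snd x = v [^] snd x \<otimes> t"
    by (rule conj_int_pow) (simp_all add: relations)
  have "t \<otimes> u [^] fst x = (u [^] r \<otimes> v [^] s) [^] fst x \<otimes> t"
    by (rule conj_int_pow) (simp_all add: relations)
  also have "(u [^] r \<otimes> v [^] s) [^] fst x = u [^] (r * fst x) \<otimes> v [^] (s * fst x)"
    by (simp add: int_pow_mult_distrib int_pow_commute relations int_pow_pow)
  finally have 2: "t \<otimes> u [^] fst x = u [^] (r * fst x) \<otimes> v [^] (s * fst x) \<otimes> t" .
  have "t \<otimes> \<alpha> x = t \<otimes> u [^] fst x \<otimes> v [^] snd x" by (simp add: \<alpha>_def m_assoc)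
  also have "\<dots> = u [^] (r * fst x) \<otimes> v [^] (s * fst x) \<otimes> (t \<otimes> v [^] snd x)"
    unfolding 2 by (simp add: m_assoc)
  also have "\<dots> = \<alpha> (\<sigma> x) \<otimes> t"
    unfolding 1 by (simp add: \<alpha>_def \<sigma>_def int_pow_mult m_assoc)
  finally show ?thesis .
qed

lemma square: "t \<otimes> t = \<alpha> (c, 1)"
  by (simp add: \<alpha>_def relations)

lemma \<alpha>_0: "\<alpha> 0 = \<one>" "\<alpha> (0, 0) = \<one>" by (simp_all add: \<alpha>_def)

lemma \<alpha>_minus: "inv (\<alpha> x) = \<alpha> (- x)"
proof (rule inv_equality)
  show "\<alpha> (- x) \<otimes> \<alpha> x = \<one>" by (simp add: \<alpha>_0 flip: \<alpha>_add)
qed simp_all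

text \<open>The right-hand side is closed under left multiplication by every letter and its inverse,
  hence contains the value of every word.\<close>

lemma cover: "carrier G = range \<alpha> \<union> range (\<lambda>x. \<alpha> x \<otimes> t)"
proof
  let ?S = "range \<alpha> \<union> range (\<lambda>x. \<alpha> x \<otimes> t)"
  have base: "\<alpha> x \<otimes> g \<in> ?S" if "g \<in> ?S" for x g
    using that by (auto simp flip: m_assoc \<alpha>_add)
  have t: "t \<otimes> g \<in> ?S" if g: "g \<in> ?S" for g
  proof -
    from g consider x where "g = \<alpha> x" | x where "g = \<alpha> x \<otimes> t" by auto
    then show ?thesis
    proof cases
      case (2 x)
      have "t \<otimes> g = \<alpha> (\<sigma> x) \<otimes> (t \<otimes> t)" unfolding 2 by (simp add: twist flip: m_assoc)
      then show ?thesis by (simp add: square flip: \<alpha>_add)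
    qed (simp add: twist)
  qed
  have "t \<otimes> t \<in> carrier G" by simp
  have inv_t: "inv t = \<alpha> (- (c, 1)) \<otimes> t"
  proof (rule inv_equality)
    show "\<alpha> (- (c, 1)) \<otimes> t \<otimes> t = \<one>" by (simp add: m_assoc square \<alpha>_0 flip: \<alpha>_add)
  qed simp_all
  have u: "u = \<alpha> (1, 0)" by (simp add: \<alpha>_def)
  have letter: "\<psi> [(g, b)] \<otimes> h \<in> ?S" if h: "h \<in> ?S" for g b h
  proof -
    have inv: "\<psi> [(g, False)] = inv (\<psi> [(g, True)])"
      using \<psi>_word_inv[of "[(g, True)]"] by (simp add: word_inv_def)
    have hc: "h \<in> carrier G" using h by auto
    have "g = gu \<or> g = gt" using gens by (cases g; cases gu; cases gt) auto
    then show ?thesis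
    proof
      assume "g = gu"
      then have "\<psi> [(g, b)] = \<alpha> (if b then (1, 0) else - (1, 0))"
        using inv by (cases b) (simp_all add: u[unfolded u_def] \<alpha>_minus)
      then show ?thesis using base[OF h] by simp
    next
      assume "g = gt"
      then have "\<psi> [(g, b)] = (if b then t else \<alpha> (- (c, 1)) \<otimes> t)"
        using inv by (cases b) (simp_all add: t_def[symmetric] inv_t)
      then show ?thesis using t[OF h] base[OF t[OF h]] hc by (cases b) (simp_all add: m_assoc)
    qed
  qed
  have "\<psi> w \<in> ?S" for w
  proof (induction w)
    case Nil
    show ?case using \<alpha>_0 by (metis UnI1 \<psi>_Nil rangeI)
  next
    case (Cons a w)
    obtain g b where "a = (g, b)" by (cases a)
    then show ?case using letter[OF Cons, of g b] \<psi>_append[of "[a]" w] by simp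
  qed
  then show "carrier G \<subseteq> ?S" unfolding \<psi>_surj by blast
qed auto

lemma \<alpha>_mod: "\<alpha> (i mod p, j mod q) = \<alpha> (i, j)"
proof -
  have "u [^] i = u [^] (p * (i div p) + i mod p)" by simp
  also have "\<dots> = (u [^] p) [^] (i div p) \<otimes> u [^] (i mod p)"
    unfolding int_pow_mult[OF uvt_closed(1)] by (simp add: int_pow_pow)
  finally have 1: "u [^] i = u [^] (i mod p)" by (simp add: relations)
  have "v [^] j = v [^] (q * (j div q) + j mod q)" by simp
  also have "\<dots> = (v [^] q) [^] (j div q) \<otimes> v [^] (j mod q)"
    unfolding int_pow_mult[OF uvt_closed(2)] by (simp add: int_pow_pow)
  finally have 2: "v [^] j = v [^] (j mod q)" by (simp add: relations)
  show ?thesis unfolding \<alpha>_def using 1 2 by simp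
qed

section \<open>Uniqueness of the normal form\<close>

definition normal_word :: "int \<times> int \<Rightarrow> bool \<Rightarrow> gen word" where
  "normal_word x e = word_pow [(gu, True)] (nat (fst x mod p)) @ word_pow wv (nat (snd x mod q)) @
    (if e then [(gt, True)] else [])"

lemma \<psi>_normal_word: "\<psi> (normal_word x e) = (if e then \<alpha> x \<otimes> t else \<alpha> x)"
proof -
  have "u [^] nat (fst x mod p) \<otimes> v [^] nat (snd x mod q) = \<alpha> (fst x mod p, snd x mod q)"
    using p q by (simp add: \<alpha>_def flip: int_pow_int)
  also have "\<dots> = \<alpha> x" using \<alpha>_mod[of "fst x" "snd x"] by simp
  finally show ?thesis
    by (simp add: normal_word_def \<psi>_append \<psi>_word_pow u_def[symmetric] v_def[symmetric] t_def[symmetric]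
        flip: m_assoc)
qed

text \<open>Acting on the origin recovers the exponents, so the action tells normal forms apart. The
  word \<open>wv\<close> is known to act as a shift only up to \<open>sim\<close>, which is why its
  powers need an induction of their own.\<close>

lemma act_normal_word: "sim (act (normal_word x e) (0, 0, False)) (fst x, snd x, e)"
proof -
  have U: "(act [(gu, True)] ^^ n) (i, j, e) = (i + int n, j, e)" for n i j e
    by (induction n) (simp_all add: algebra_simps)
  have V: "sim ((act wv ^^ n) (i, j, e)) (i, j + int n, e)" for n i j e
  proof (induction n)
    case (Suc n)
    have "sim ((act wv ^^ Suc n) (i, j, e)) (act wv (i, j + int n, e))" using sim_act[OF Suc] by simp
    moreover have "sim (act wv (i, j + int n, e)) (i, j + int (Suc n), e)"
      using act_wv[of i "j + int n" e] by (simp add: algebra_simps)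
    ultimately show ?case by (rule sim_trans)
  qed (simp add: sim_refl)
  have "act (if e then [(gt, True)] else []) (0, 0, False) = (0, 0, e)"
    using gens by (cases e) auto
  then have "act (normal_word x e) (0, 0, False) =
     act (word_pow [(gu, True)] (nat (fst x mod p))) ((act wv ^^ nat (snd x mod q)) (0, 0, e))"
    by (simp only: normal_word_def act_append act_word_pow)
  also have "sim \<dots> (act (word_pow [(gu, True)] (nat (fst x mod p))) (0, 0 + int (nat (snd x mod q)), e))"
    by (rule sim_act[OF V])
  finally have "sim (act (normal_word x e) (0, 0, False)) (fst x mod p, snd x mod q, e)"
    using p q by (simp add: act_word_pow U)
  moreover have "sim (fst x mod p, snd x mod q, e) (fst x, snd x, e)"
    by (simp add: mod_eq_dvd_iff[symmetric])
  ultimately show ?thesis by (rule sim_trans)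
qed

lemma normal_form_unique:
  assumes "\<psi> (normal_word x e) = \<psi> (normal_word y e')"
  shows "sim (fst x, snd x, e) (fst y, snd y, e')"
proof -
  have "sim (act (normal_word x e) (0, 0, False)) (act (normal_word y e') (0, 0, False))"
    by (rule word_eq_act[OF assms[unfolded \<psi>_eq_iff] act_relation])
  then show ?thesis by (rule sim_trans[OF sim_trans[OF sim_sym[OF act_normal_word]] act_normal_word])
qed

lemma \<alpha>_eq_iff: "\<alpha> x = \<alpha> y \<longleftrightarrow> p dvd fst x - fst y \<and> q dvd snd x - snd y"
proof
  assume "\<alpha> x = \<alpha> y"
  then have "\<psi> (normal_word x False) = \<psi> (normal_word y False)" by (simp only: \<psi>_normal_word if_False)
  from normal_form_unique[OF this] show "p dvd fst x - fst y \<and> q dvd snd x - snd y"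
    unfolding sim.simps by blast
next
  assume "p dvd fst x - fst y \<and> q dvd snd x - snd y"
  then have "fst x mod p = fst y mod p" "snd x mod q = snd y mod q" by (simp_all add: mod_eq_dvd_iff)
  then show "\<alpha> x = \<alpha> y"
    using \<alpha>_mod[of "fst x" "snd x"] \<alpha>_mod[of "fst y" "snd y"] by simp
qed

section \<open>Cardinalities as counts of reduced exponents\<close>

definition box :: "(int \<times> int) set" where "box = {0..<p} \<times> {0..<q}"

lemma range_\<alpha>: "range \<alpha> = \<alpha> ` box"
proof -
  have "\<alpha> x \<in> \<alpha> ` box" for x
    using \<alpha>_mod[of "fst x" "snd x"] p q by (intro image_eqI[of _ _ "(fst x mod p, snd x mod q)"])
        (simp_all add: box_def)
  then show ?thesis by blast
qed

lemma inj_on_box: "inj_on \<alpha> box"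
proof (rule inj_onI)
  fix x y assume xy: "x \<in> box" "y \<in> box" "\<alpha> x = \<alpha> y"
  then have "fst x mod p = fst y mod p" "snd x mod q = snd y mod q" by (simp_all add: \<alpha>_eq_iff mod_eq_dvd_iff)
  then show "x = y" using xy by (auto simp: box_def)
qed

lemma finite_box: "finite box" by (simp add: box_def)

sublocale twisted_extension G \<alpha> \<sigma> "(c, 1)" t
proof
  show "\<alpha> x \<in> carrier G" "t \<in> carrier G" for x by simp_all
  show "\<sigma> (x + y) = \<sigma> x + \<sigma> y" for x y by (simp add: \<sigma>_def algebra_simps)
  \<comment> \<open>The bit of the triple separates the two cosets.\<close>
  show "\<alpha> x \<noteq> \<alpha> y \<otimes> t" for x y
    using normal_form_unique[of x False y True] by (auto simp: \<psi>_normal_word)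
  show "finite (range \<alpha>)" unfolding range_\<alpha> using finite_box by simp
qed (simp_all add: \<alpha>_add twist square cover)

lemma fixed_iff_dvd: "fixed x \<longleftrightarrow> p dvd (r - 1) * fst x \<and> q dvd s * fst x"
  by (simp add: fixed_def \<alpha>_eq_iff \<sigma>_def algebra_simps)

lemma D_iff_dvd: "\<alpha> x \<in> D \<longleftrightarrow> (\<exists>k. p dvd fst x + (r - 1) * k \<and> q dvd snd x + s * k)"
proof -
  have "fst x - fst (y - \<sigma> y) = fst x + (r - 1) * fst y" "snd x - snd (y - \<sigma> y) = snd x + s * fst y" for y
    by (simp_all add: \<sigma>_def algebra_simps)
  then have "\<alpha> x = \<alpha> (y - \<sigma> y) \<longleftrightarrow> p dvd fst x + (r - 1) * fst y \<and> q dvd snd x + s * fst y" for y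
    by (simp only: \<alpha>_eq_iff)
  then show ?thesis unfolding D_iff by (simp only: split_paired_Ex fst_conv) simp
qed

lemma F_box: "F = \<alpha> ` fixed_box p q r s"
proof -
  have "F \<subseteq> \<alpha> ` box" using F_subset by (simp only: range_\<alpha>)
  then have "F = \<alpha> ` {x \<in> box. \<alpha> x \<in> F}" by blast
  also have "\<dots> = \<alpha> ` fixed_box p q r s" unfolding F_iff fixed_iff_dvd fixed_box_def box_def ..
  finally show ?thesis .
qed

lemma DF_box: "D \<inter> F = \<alpha> ` fixed_commutator_box p q r s"
proof -
  have "D \<inter> F = \<alpha> ` {x \<in> fixed_box p q r s. \<alpha> x \<in> D}" unfolding F_box by blast
  also have "\<dots> = \<alpha> ` fixed_commutator_box p q r s" unfolding D_iff_dvd fixed_commutator_box_def ..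
  finally show ?thesis .
qed

lemma card_boxes:
  "card (range \<alpha>) = nat p * nat q"
      "card F = card (fixed_box p q r s)" "card (D \<inter> F) = card (fixed_commutator_box p q r s)"
proof -
  have "fixed_box p q r s \<subseteq> box" "fixed_commutator_box p q r s \<subseteq> box"
      by (auto simp: fixed_box_def fixed_commutator_box_def box_def)
  then have "inj_on \<alpha> (fixed_box p q r s)" "inj_on \<alpha> (fixed_commutator_box p q r s)"
    using inj_on_box inj_on_subset by blast+
  then show "card F = card (fixed_box p q r s)" "card (D \<inter> F) = card (fixed_commutator_box p q r s)"
    unfolding DF_box unfolding F_box by (simp_all add: card_image)
  show "card (range \<alpha>) = nat p * nat q"
    unfolding range_\<alpha> using inj_on_box by (simp add: card_image box_def card_cartesian_product)
qed

text \<open>If \<open>t\<close> centralized the abelian subgroup, all elements would commute. The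
  witness is what identifies the center with \<open>F\<close>.\<close>

lemma not_fixed_if_not_comm:
  assumes "\<not> comm_group G"
  obtains z where "\<not> fixed z"
proof (rule ccontr)
  assume "\<not> thesis"
  then have fixed: "fixed z" for z using that by blast
  have "g \<otimes> h = h \<otimes> g" if "g \<in> carrier G" "h \<in> carrier G" for g h
  proof -
    have "g \<in> range \<alpha> \<union> range \<tau>" "h \<in> range \<alpha> \<union> range \<tau>" using that by (simp_all add: carrier_eq)
    moreover have "\<tau> x \<otimes> \<alpha> y = \<alpha> y \<otimes> \<tau> x" "\<tau> x \<otimes> \<tau> y = \<tau> y \<otimes> \<tau> x" "\<alpha> x \<otimes> \<alpha> y = \<alpha> y \<otimes> \<alpha> x" for x y
      using fixed by (simp_all add: commute_outer_base commute_outer_outer mult_table(1) add.commute)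
    ultimately show ?thesis by auto
  qed
  then show False using assms group_comm_groupI by blast
qed

theorem clique_profile_if_not_comm:
  assumes "\<not> comm_group G" "card (fixed_box p q r s) = m" "card (fixed_commutator_box p q r s) = k"
    "2 * a + m = nat p * nat q" "m = k * b"
  shows "clique_profile (ccc_graph G) a b (k * b)"
proof -
  obtain z where "\<not> fixed z" using assms(1) by (rule not_fixed_if_not_comm)
  from clique_profile_ccc_graph[OF this, of a b] show ?thesis
    using assms(2-) by (simp add: card_boxes)
qed

end

section \<open>Counting fixed points and commutators\<close>

lemma dvd_below_iff:
  fixes q j :: int
  assumes "0 \<le> j" "j < q"
  shows "q dvd j \<longleftrightarrow> j = 0"
  using zdvd_imp_le[of q j] assms by (cases "j = 0") auto

lemma dvd_below_double_iff:
  fixes h i :: int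
  assumes "0 \<le> i" "i < 2 * h"
  shows "h dvd i \<longleftrightarrow> i = 0 \<or> i = h"
proof
  assume "h dvd i"
  then obtain k where k: "i = h * k" by (elim dvdE)
  have h: "h > 0" using assms by linarith
  have "k \<ge> 0" "k < 2" using assms h unfolding k by (simp_all add: zero_le_mult_iff mult.commute)
  then have "k = 0 \<or> k = 1" by linarith
  then show "i = 0 \<or> i = h" by (auto simp: k)
qed auto

text \<open>As \<open>v\<close> is central its exponent is unrestricted, and only the exponents of
  \<open>u\<close> have to be determined.\<close>

lemma fixed_box_eqI:
  assumes "\<And>i. 0 \<le> i \<Longrightarrow> i < p \<Longrightarrow> p dvd (r - 1) * i \<and> q dvd s * i \<longleftrightarrow> i \<in> I" "I \<subseteq> {0..<p}"
  shows "fixed_box p q r s = I \<times> {0..<q}"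
proof -
  have "x \<in> fixed_box p q r s \<longleftrightarrow> x \<in> I \<times> {0..<q}" for x
    using assms(1)[of "fst x"] subsetD[OF assms(2), of "fst x"]
    unfolding fixed_box_def mem_Collect_eq mem_Times_iff atLeastLessThan_iff by blast
  then show ?thesis by blast
qed

lemma fixed_commutator_box_eqI:
  assumes "fixed_box p q r s = B" "C \<subseteq> B"
    and "\<And>i j. (i, j) \<in> B \<Longrightarrow> (\<exists>k. p dvd i + (r - 1) * k \<and> q dvd j + s * k) \<longleftrightarrow> (i, j) \<in> C"
  shows "fixed_commutator_box p q r s = C"
proof -
  have "x \<in> fixed_commutator_box p q r s \<longleftrightarrow> x \<in> C" for x
    using assms(3)[of "fst x" "snd x"] subsetD[OF assms(2), of x]
    unfolding fixed_commutator_box_def assms(1) mem_Collect_eq prod.collapse by blast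
  then show ?thesis by blast
qed

text \<open>Here \<open>t\<close> inverts \<open>u\<close> of odd order. Since 2 is invertible
  modulo \<open>p\<close>, only \<open>u^0\<close> is fixed, and the commutators, being powers of
  \<open>u\<close>, meet \<open>F\<close> trivially.\<close>

lemma inversion_boxes_odd:
  fixes p q :: int
  assumes "p > 0" "q > 0" "odd p"
  shows "card (fixed_box p q (- 1) 0) = nat q" "card (fixed_commutator_box p q (- 1) 0) = 1"
proof -
  have cop: "coprime p (- 2)" using assms(3) by simp
  have F: "fixed_box p q (- 1) 0 = {0} \<times> {0..<q}"
  proof (rule fixed_box_eqI)
    fix i assume "0 \<le> i" "i < p"
    then show "p dvd (- 1 - 1) * i \<and> q dvd 0 * i \<longleftrightarrow> i \<in> {0}"
      using coprime_dvd_mult_right_iff[OF cop, of i] dvd_below_iff[of i p] by simp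
  qed (use assms(1) in simp)
  then show "card (fixed_box p q (- 1) 0) = nat q" by simp
  have "fixed_commutator_box p q (- 1) 0 = {(0, 0)}"
  proof (rule fixed_commutator_box_eqI[OF F])
    fix i j :: int assume "(i, j) \<in> {0} \<times> {0..<q}"
    then have ij: "i = 0" "0 \<le> j" "j < q" by simp_all
    then show "(\<exists>k. p dvd i + (- 1 - 1) * k \<and> q dvd j + 0 * k) \<longleftrightarrow> (i, j) \<in> {(0, 0)}"
      using dvd_below_iff[OF ij(2,3)] exI[of "\<lambda>k. p dvd (- 1 - 1) * k" 0] by simp
  qed (use assms(2) in simp)
  then show "card (fixed_commutator_box p q (- 1) 0) = 1" by simp
qed

text \<open>If \<open>u\<close> of order \<open>2 * h\<close> is inverted, the fixed powers are
  \<open>u^0\<close> and \<open>u^h\<close>. The commutators are the even powers of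
  \<open>u\<close>, which include \<open>u^h\<close> exactly if \<open>h\<close> is even.\<close>

lemma inversion_boxes_even:
  fixes h q :: int
  assumes "h > 0" "q > 0"
  shows "card (fixed_box (2 * h) q (- 1) 0) = 2 * nat q"
    "card (fixed_commutator_box (2 * h) q (- 1) 0) = (if even h then 2 else 1)"
proof -
  have two: "2 * h dvd (- 1 - 1) * i \<longleftrightarrow> h dvd i" for i
    using dvd_mult_cancel_left[of 2 h i] by simp
  have F: "fixed_box (2 * h) q (- 1) 0 = {0, h} \<times> {0..<q}"
  proof (rule fixed_box_eqI)
    fix i assume "0 \<le> i" "i < 2 * h"
    then show "2 * h dvd (- 1 - 1) * i \<and> q dvd 0 * i \<longleftrightarrow> i \<in> {0, h}"
      unfolding two using dvd_below_double_iff[of i h] by simp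
  qed (use assms(1) in simp)
  then show "card (fixed_box (2 * h) q (- 1) 0) = 2 * nat q"
    using assms(1) by (simp add: card_cartesian_product)
  have k: "(\<exists>k. 2 * h dvd h + (- 1 - 1) * k) \<longleftrightarrow> even h"
  proof
    assume "\<exists>k. 2 * h dvd h + (- 1 - 1) * k"
    then obtain k where "2 * h dvd h + (- 1 - 1) * k" ..
    then have "2 dvd h + (- 1 - 1) * k" by (rule dvd_mult_left)
    then show "even h" by simp
  next
    assume "even h"
    then obtain l where "h = 2 * l" by (elim evenE)
    then have "2 * h dvd h + (- 1 - 1) * l" by simp
    then show "\<exists>k. 2 * h dvd h + (- 1 - 1) * k" ..
  qed
  have "fixed_commutator_box (2 * h) q (- 1) 0 = (if even h then {(0, 0), (h, 0)} else {(0, 0)})"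
  proof (rule fixed_commutator_box_eqI[OF F])
    fix i j :: int assume "(i, j) \<in> {0, h} \<times> {0..<q}"
    then have ij: "i = 0 \<or> i = h" "0 \<le> j" "j < q" by simp_all
    have "(\<exists>k. 2 * h dvd i + (- 1 - 1) * k \<and> q dvd j + 0 * k) \<longleftrightarrow> (\<exists>k. 2 * h dvd i + (- 1 - 1) * k) \<and> j = 0"
      using dvd_below_iff[OF ij(2,3)] by simp
    also have "(\<exists>k. 2 * h dvd i + (- 1 - 1) * k) \<longleftrightarrow> i = 0 \<or> even h"
    proof (cases "i = 0")
      case True
      then have "2 * h dvd i + (- 1 - 1) * 0" by simp
      with True show ?thesis by blast
    next
      case False
      with ij(1) k show ?thesis by blast
    qed
    finally show "(\<exists>k. 2 * h dvd i + (- 1 - 1) * k \<and> q dvd j + 0 * k) \<longleftrightarrow>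
        (i, j) \<in> (if even h then {(0, 0), (h, 0)} else {(0, 0)})"
      using ij(1) by (cases "even h") auto
  qed (use assms in simp)
  then show "card (fixed_commutator_box (2 * h) q (- 1) 0) = (if even h then 2 else 1)"
    using assms(1) by simp
qed

text \<open>Here \<open>r - 1 = 2 * (n - 1)\<close> with \<open>n - 1\<close> coprime to
  \<open>2 * n\<close>, so the fixed exponents are \<open>0\<close> and \<open>2 * n\<close>; both
  come from commutators.\<close>

lemma semidihedral_boxes_even:
  fixes n :: int
  assumes "n > 0" "even n"
  shows "card (fixed_box (4 * n) 1 (2 * n - 1) 0) = 2"
    "card (fixed_commutator_box (4 * n) 1 (2 * n - 1) 0) = 2"
proof -
  have "coprime n (n - 1)" using coprime_diff_one_left[of n] by (simp only: coprime_commute)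
  moreover have "coprime 2 (n - 1)" using assms(2) by simp
  ultimately have cop: "coprime (2 * n) (n - 1)" by simp
  have dvd: "4 * n dvd (2 * n - 1 - 1) * i \<longleftrightarrow> 2 * n dvd i" for i
  proof -
    have "4 * n dvd (2 * n - 1 - 1) * i \<longleftrightarrow> 2 * (2 * n) dvd 2 * ((n - 1) * i)"
      by (rule arg_cong2[where f = "(dvd)"]) (simp_all add: algebra_simps)
    also have "\<dots> \<longleftrightarrow> 2 * n dvd (n - 1) * i" by (rule dvd_times_left_cancel_iff) simp
    also have "\<dots> \<longleftrightarrow> 2 * n dvd i" by (rule coprime_dvd_mult_right_iff[OF cop])
    finally show ?thesis .
  qed
  have F: "fixed_box (4 * n) 1 (2 * n - 1) 0 = {0, 2 * n} \<times> {0..<1}"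
  proof (rule fixed_box_eqI)
    fix i assume "0 \<le> i" "i < 4 * n"
    then show "4 * n dvd (2 * n - 1 - 1) * i \<and> 1 dvd 0 * i \<longleftrightarrow> i \<in> {0, 2 * n}"
      unfolding dvd using dvd_below_double_iff[of i "2 * n"] by simp
  qed (use assms(1) in simp)
  then show "card (fixed_box (4 * n) 1 (2 * n - 1) 0) = 2"
    using assms(1) by (simp add: card_cartesian_product)
  obtain l where l: "n = 2 * l" using assms(2) by (elim evenE)
  \<comment> \<open>The witness \<open>k = n\<close> makes the sum \<open>2 * n\<^sup>2\<close>, a
    multiple of \<open>4 * n\<close> as \<open>n\<close> is even.\<close>
  have "2 * n + (2 * n - 1 - 1) * n = 4 * n * l" by (simp add: l algebra_simps)
  then have 1: "4 * n dvd 2 * n + (2 * n - 1 - 1) * n" by simp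
  have 0: "4 * n dvd 0 + (2 * n - 1 - 1) * 0" by simp
  have "fixed_commutator_box (4 * n) 1 (2 * n - 1) 0 = {0, 2 * n} \<times> {0..<1}"
  proof (rule fixed_commutator_box_eqI[OF F])
    fix i j :: int assume ij: "(i, j) \<in> {0, 2 * n} \<times> {0..<1::int}"
    then have "\<exists>k. 4 * n dvd i + (2 * n - 1 - 1) * k" using 0 1 by blast
    with ij show "(\<exists>k. 4 * n dvd i + (2 * n - 1 - 1) * k \<and> 1 dvd j + 0 * k) \<longleftrightarrow>
        (i, j) \<in> {0, 2 * n} \<times> {0..<1}" by simp
  qed simp
  then show "card (fixed_commutator_box (4 * n) 1 (2 * n - 1) 0) = 2"
    using assms(1) by (simp add: card_cartesian_product)
qed

text \<open>With \<open>n = 2 * l + 1\<close> one has \<open>r - 1 = 4 * l\<close> and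
  \<open>l\<close> coprime to \<open>n\<close>. Fixed exponents are the multiples of
  \<open>n\<close>, commutators have exponents divisible by 4, and for odd \<open>n\<close> only the
  identity satisfies both.\<close>

lemma semidihedral_boxes_odd:
  fixes n :: int
  assumes "n > 0" "odd n"
  shows "card (fixed_box (4 * n) 1 (2 * n - 1) 0) = 4"
    "card (fixed_commutator_box (4 * n) 1 (2 * n - 1) 0) = 1"
proof -
  obtain l where l: "n = 2 * l + 1" using assms(2) by (elim oddE)
  have cop: "coprime n l"
  proof (rule coprimeI)
    fix d assume "d dvd n" "d dvd l"
    then have "d dvd n - 2 * l" by (intro dvd_diff dvd_mult)
    then show "is_unit d" by (simp add: l)
  qed
  have cop4: "coprime n 4"
  proof -
    have "coprime n 2" using assms(2) by simp
    then have "coprime n (2 * 2)" by (simp only: coprime_mult_right_iff)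
    then show ?thesis by simp
  qed
  have eq: "(2 * n - 1 - 1) * i = 4 * (l * i)" for i by (simp add: l algebra_simps)
  have dvd: "4 * n dvd (2 * n - 1 - 1) * i \<longleftrightarrow> n dvd i" for i
    unfolding eq using coprime_dvd_mult_right_iff[OF cop, of i] dvd_mult_cancel_left[of 4 n "l * i"] by simp
  have F: "fixed_box (4 * n) 1 (2 * n - 1) 0 = {0, n, 2 * n, 3 * n} \<times> {0..<1}"
  proof (rule fixed_box_eqI)
    fix i assume i: "0 \<le> i" "i < 4 * n"
    have "i \<in> {0, n, 2 * n, 3 * n}" if "n dvd i"
    proof -
      obtain k where k: "i = n * k" using \<open>n dvd i\<close> by (elim dvdE)
      have "k \<ge> 0" "k < 4" using i assms(1) unfolding k by (simp_all add: zero_le_mult_iff mult.commute)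
      then have "k = 0 \<or> k = 1 \<or> k = 2 \<or> k = 3" by linarith
      then show ?thesis by (auto simp: k)
    qed
    then show "4 * n dvd (2 * n - 1 - 1) * i \<and> 1 dvd 0 * i \<longleftrightarrow> i \<in> {0, n, 2 * n, 3 * n}"
      unfolding dvd by auto
  qed (use assms(1) in simp)
  then show "card (fixed_box (4 * n) 1 (2 * n - 1) 0) = 4"
    using assms(1) by (simp add: card_cartesian_product)
  have "fixed_commutator_box (4 * n) 1 (2 * n - 1) 0 = {(0, 0)}"
  proof (rule fixed_commutator_box_eqI[OF F])
    fix i j :: int assume ij: "(i, j) \<in> {0, n, 2 * n, 3 * n} \<times> {0..<1::int}"
    then have i: "0 \<le> i" "i < 4 * n" "n dvd i" and j: "j = 0" using assms(1) by auto
    have "i = 0" if k: "4 * n dvd i + (2 * n - 1 - 1) * k" for k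
    proof -
      have "n dvd i + (2 * n - 1 - 1) * k" using k by (rule dvd_mult_right)
      then have "n dvd (2 * n - 1 - 1) * k" using i(3) by (simp only: dvd_add_right_iff)
      then have "n dvd k"
        unfolding eq coprime_dvd_mult_right_iff[OF cop4] coprime_dvd_mult_right_iff[OF cop] .
      then have "4 * n dvd (2 * n - 1 - 1) * k" by (simp only: dvd)
      then have "4 * n dvd i" using k by (simp only: dvd_add_left_iff)
      then show "i = 0" using dvd_below_iff[OF i(1,2)] by simp
    qed
    moreover have "4 * n dvd 0 + (2 * n - 1 - 1) * 0" by simp
    ultimately have "(\<exists>k. 4 * n dvd i + (2 * n - 1 - 1) * k) \<longleftrightarrow> i = 0" by blast
    then show "(\<exists>k. 4 * n dvd i + (2 * n - 1 - 1) * k \<and> 1 dvd j + 0 * k) \<longleftrightarrow> (i, j) \<in> {(0, 0)}"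
      using j by simp
  qed simp
  then show "card (fixed_commutator_box (4 * n) 1 (2 * n - 1) 0) = 1" by simp
qed

text \<open>As \<open>s = 1\<close>, fixed exponents of \<open>u\<close> must also be even, which
  for even \<open>n\<close> admits both \<open>0\<close> and \<open>n\<close>. Each of them
  determines \<open>k\<close> modulo the even number \<open>n\<close>, hence the parity of the
  exponent of \<open>v\<close>, and so carries exactly one commutator.\<close>

lemma V_boxes_even:
  fixes n :: int
  assumes "n > 0" "even n"
  shows "card (fixed_box (2 * n) 2 (- 1) 1) = 4" "card (fixed_commutator_box (2 * n) 2 (- 1) 1) = 2"
proof -
  obtain h where h: "n = 2 * h" using assms(2) by (elim evenE)
  have two: "2 * n dvd (- 1 - 1) * i \<longleftrightarrow> n dvd i" for i
    using dvd_mult_cancel_left[of 2 n i] by simp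
  have F: "fixed_box (2 * n) 2 (- 1) 1 = {0, n} \<times> {0..<2}"
  proof (rule fixed_box_eqI)
    fix i assume "0 \<le> i" "i < 2 * n"
    then show "2 * n dvd (- 1 - 1) * i \<and> 2 dvd 1 * i \<longleftrightarrow> i \<in> {0, n}"
      unfolding two using dvd_below_double_iff[of i n] assms(2) by auto
  qed (use assms(1) in simp)
  then show "card (fixed_box (2 * n) 2 (- 1) 1) = 4"
    using assms(1) by (simp add: card_cartesian_product)
  have 0: "(\<exists>k. 2 * n dvd 0 + (- 1 - 1) * k \<and> 2 dvd j + 1 * k) \<longleftrightarrow> even j" for j
  proof
    assume "\<exists>k. 2 * n dvd 0 + (- 1 - 1) * k \<and> 2 dvd j + 1 * k"
    then obtain k where k: "2 * n dvd (- 1 - 1) * k" "even (j + k)" by (auto simp only: add_0 mult_1)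
    have "even k" using k(1) unfolding two by (rule dvd_trans[OF assms(2)])
    with k(2) show "even j" by simp
  next
    assume "even j"
    then have "2 * n dvd 0 + (- 1 - 1) * 0 \<and> 2 dvd j + 1 * 0" by simp
    then show "\<exists>k. 2 * n dvd 0 + (- 1 - 1) * k \<and> 2 dvd j + 1 * k" ..
  qed
  have n: "(\<exists>k. 2 * n dvd n + (- 1 - 1) * k \<and> 2 dvd j + 1 * k) \<longleftrightarrow> even (j + h)" for j
  proof
    assume "\<exists>k. 2 * n dvd n + (- 1 - 1) * k \<and> 2 dvd j + 1 * k"
    then obtain k where k: "2 * n dvd n + (- 1 - 1) * k" "even (j + k)" by (auto simp only: mult_1)
    have "n + (- 1 - 1) * k = 2 * (h - k)" by (simp add: h)
    with k(1) have "n dvd h - k" using dvd_mult_cancel_left[of 2 n "h - k"] by simp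
    then have "even (h - k)" by (rule dvd_trans[OF assms(2)])
    with k(2) show "even (j + h)" by simp
  next
    assume "even (j + h)"
    then have "2 * n dvd n + (- 1 - 1) * h \<and> 2 dvd j + 1 * h" by (simp add: h)
    then show "\<exists>k. 2 * n dvd n + (- 1 - 1) * k \<and> 2 dvd j + 1 * k" ..
  qed
  have "fixed_commutator_box (2 * n) 2 (- 1) 1 = {(0, 0), (n, h mod 2)}"
  proof (rule fixed_commutator_box_eqI[OF F])
    fix i j :: int assume "(i, j) \<in> {0, n} \<times> {0..<2::int}"
    then have ij: "i = 0 \<or> i = n" "0 \<le> j" "j < 2" by simp_all
    have "even (j + h) \<longleftrightarrow> j = h mod 2" using ij(2,3) by presburger
    moreover have "even j \<longleftrightarrow> j = 0" using dvd_below_iff[OF ij(2,3)] .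
    ultimately show "(\<exists>k. 2 * n dvd i + (- 1 - 1) * k \<and> 2 dvd j + 1 * k) \<longleftrightarrow> (i, j) \<in> {(0, 0), (n, h mod 2)}"
      using ij(1) 0[of j] n[of j] assms(1) by (elim disjE) simp_all
  qed simp
  then show "card (fixed_commutator_box (2 * n) 2 (- 1) 1) = 2" using assms(1) by simp
qed

text \<open>For odd \<open>n\<close> parity excludes the exponent \<open>n\<close>. The witnesses
  \<open>k = 0\<close> and \<open>k = n\<close> now differ in parity, so both exponents of
  \<open>v\<close> occur in commutators.\<close>

lemma V_boxes_odd:
  fixes n :: int
  assumes "n > 0" "odd n"
  shows "card (fixed_box (2 * n) 2 (- 1) 1) = 2" "card (fixed_commutator_box (2 * n) 2 (- 1) 1) = 2"
proof -
  have two: "2 * n dvd (- 1 - 1) * i \<longleftrightarrow> n dvd i" for i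
    using dvd_mult_cancel_left[of 2 n i] by simp
  have F: "fixed_box (2 * n) 2 (- 1) 1 = {0} \<times> {0..<2}"
  proof (rule fixed_box_eqI)
    fix i assume "0 \<le> i" "i < 2 * n"
    then show "2 * n dvd (- 1 - 1) * i \<and> 2 dvd 1 * i \<longleftrightarrow> i \<in> {0}"
      unfolding two using dvd_below_double_iff[of i n] assms(2) by auto
  qed (use assms(1) in simp)
  then show "card (fixed_box (2 * n) 2 (- 1) 1) = 2" by (simp add: card_cartesian_product)
  have 0: "2 * n dvd 0 + (- 1 - 1) * 0 \<and> 2 dvd 0 + 1 * (0::int)" by simp
  have 1: "2 * n dvd 0 + (- 1 - 1) * n \<and> 2 dvd 1 + 1 * n" using assms(2) by simp
  have "fixed_commutator_box (2 * n) 2 (- 1) 1 = {0} \<times> {0..<2}"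
  proof (rule fixed_commutator_box_eqI[OF F])
    fix i j :: int assume ij: "(i, j) \<in> {0} \<times> {0..<2::int}"
    then have "i = 0" "j = 0 \<or> j = 1" by auto
    then have "\<exists>k. 2 * n dvd i + (- 1 - 1) * k \<and> 2 dvd j + 1 * k" using 0 1 by blast
    with ij show "(\<exists>k. 2 * n dvd i + (- 1 - 1) * k \<and> 2 dvd j + 1 * k) \<longleftrightarrow> (i, j) \<in> {0} \<times> {0..<2}" by blast
  qed simp
  then show "card (fixed_commutator_box (2 * n) 2 (- 1) 1) = 2" by (simp add: card_cartesian_product)
qed

section \<open>From the parameters of a group to the comparison of its energies\<close>

abbreviation equal_energies :: "'v pair_pre_digraph \<Rightarrow> bool" where
  "equal_energies \<Gamma> \<equiv> E_CN \<Gamma> = LE_plus_CN \<Gamma> \<and> LE_plus_CN \<Gamma> = LE_CN \<Gamma>"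

abbreviation increasing_energies :: "'v pair_pre_digraph \<Rightarrow> bool" where
  "increasing_energies \<Gamma> \<equiv> E_CN \<Gamma> < LE_plus_CN \<Gamma> \<and> LE_plus_CN \<Gamma> < LE_CN \<Gamma>"

lemma (in group) conj_swap:
  assumes "x \<in> carrier G" "y \<in> carrier G" "z \<in> carrier G" "y \<otimes> x \<otimes> inv y = z"
  shows "y \<otimes> x = z \<otimes> y"
  using assms by (metis inv_closed inv_solve_right m_closed inv_inv)

text \<open>\<open>T_4n\<close> and \<open>U_nm\<close> are presented with the conjugating generator
  inverted on the left; inversion being an involution, conjugation the other way inverts as
  well.\<close>

lemma (in group) inv_conj_swap:
  assumes "x \<in> carrier G" "y \<in> carrier G" "inv y \<otimes> x \<otimes> y = inv x"
  shows "y \<otimes> x = inv x \<otimes> y"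
proof -
  have "x \<otimes> y = y \<otimes> (inv y \<otimes> x \<otimes> y)" using assms(1,2) by (simp flip: m_assoc)
  then have "x \<otimes> y = y \<otimes> inv x" by (simp only: assms(3))
  then have "x \<otimes> y \<otimes> x = y" using assms(1,2) by (simp add: m_assoc)
  then have "inv x \<otimes> y = inv x \<otimes> (x \<otimes> (y \<otimes> x))" using assms(1,2) by (simp add: m_assoc)
  then show ?thesis using assms(1,2) by (simp flip: m_assoc)
qed

lemma (in presentation) \<psi>_pow_relation:
  "(word_pow w k, []) \<in> R \<Longrightarrow> \<psi> w [^] int k = \<one>"
  using \<psi>_relation[of "word_pow w k" "[]"] by (simp add: \<psi>_word_pow int_pow_int)

lemma (in presentation) \<psi>_Cons: "\<psi> (a # b # w) = \<psi> [a] \<otimes> \<psi> (b # w)"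
  using \<psi>_append[of "[a]" "b # w"] by simp

lemma (in presentation) \<psi>_Cons_word_inv: "\<psi> (a # word_inv w) = \<psi> [a] \<otimes> inv (\<psi> w)"
  using \<psi>_append[of "[a]" "word_inv w"] by (simp add: \<psi>_word_inv)

lemma word_pow_2: "word_pow w 2 = w @ w"
  by (simp add: word_pow_def numeral_eq_Suc)

lemma word_pow_4: "word_pow w 4 = w @ w @ w @ w"
  by (simp add: word_pow_def numeral_eq_Suc)

lemma word_inv_letter: "word_inv [(g, b)] = [(g, \<not> b)]"
  by (simp add: word_inv_def)

lemma (in extension_data) act_u_pow: "act (word_pow [(gu, True)] n) (i, j, e) = (i + int n, j, e)"
proof -
  have "(act [(gu, True)] ^^ n) (i, j, e) = (i + int n, j, e)"
    by (induction n) (simp_all add: algebra_simps)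
  then show ?thesis by (simp only: act_word_pow)
qed

context index_two_presentation
begin

text \<open>Covers \<open>D_2n\<close>, \<open>T_4n\<close> and \<open>U_nm\<close>. The triple
  \<open>(a, b, k)\<close> is \<open>(Q h, Q, 1)\<close> for \<open>P = 2 h + 1\<close>; for
  \<open>P = 2 h\<close> it is \<open>(Q (h - 1), Q, 2)\<close> or
  \<open>(Q (h - 1), 2 Q, 1)\<close>, as \<open>h\<close> is even or odd. So \<open>a = b\<close>
  exactly for \<open>P\<close> equal to 3, 4 or 6, and \<open>P = 5\<close>, \<open>Q = 1\<close> is
  the remaining case with cliques of size at most two.\<close>

lemma inversion_energies:
  assumes "\<not> comm_group G" "r = - 1" "s = 0" "p = int P" "q = int Q" "P \<ge> 2"
  shows "if P \<in> {3, 4, 6} \<or> P = 5 \<and> Q = 1 then equal_energies (ccc_graph G)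
    else increasing_energies (ccc_graph G)"
proof -
  have Q: "Q \<ge> 1" using q assms(5) by simp
  have np: "nat p = P" "nat q = Q" by (simp_all add: assms(4,5))
  show ?thesis
  proof (cases "odd P")
    case True
    then obtain h where h: "P = 2 * h + 1" by (elim oddE)
    have h1: "h \<ge> 1" using assms(6) h by simp
    have "card (fixed_box p q r s) = Q" "card (fixed_commutator_box p q r s) = 1"
      using inversion_boxes_odd[OF p q] True by (simp_all add: assms(2-5))
    then have profile: "clique_profile (ccc_graph G) (Q * h) Q (1 * Q)"
      by (rule clique_profile_if_not_comm[OF assms(1)]) (simp_all add: np h algebra_simps)
    have Qh: "Q * h \<ge> Q" "Q * h \<ge> h" using h1 Q by simp_all
    show ?thesis
    proof (cases "h = 1 \<or> h = 2 \<and> Q = 1")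
      case True
      then have "equal_energies (ccc_graph G)" using Q by (intro energies_equal[OF profile]) auto
      then show ?thesis using True by (auto simp: h)
    next
      case False
      then have "h \<ge> 2" "h \<ge> 3 \<or> Q \<ge> 2" using h1 Q by auto
      have "Q * 2 \<le> Q * h" using \<open>h \<ge> 2\<close> by (rule mult_le_mono2)
      moreover have "3 \<le> Q * h"
        using \<open>h \<ge> 3 \<or> Q \<ge> 2\<close>
      proof
        assume "h \<ge> 3"
        then show ?thesis using Qh(2) by linarith
      next
        assume "Q \<ge> 2"
        then have "2 * 2 \<le> Q * h" using \<open>h \<ge> 2\<close> by (rule mult_le_mono)
        then show ?thesis by linarith
      qed
      ultimately have "3 \<le> Q * h" "Q + 1 * Q \<le> Q * h" by linarith+
      then have "increasing_energies (ccc_graph G)"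
        by (intro energies_strictly_increasing[OF profile Q] disjI1 HOL.refl)
      moreover have "\<not> (P \<in> {3, 4, 6} \<or> P = 5 \<and> Q = 1)" using False unfolding h by auto presburger
      ultimately show ?thesis by simp
    qed
  next
    case False
    then have "even P" by simp
    then obtain h where h: "P = 2 * h" by (elim evenE)
    have h1: "h \<ge> 1" using assms(6) h by simp
    \<comment> \<open>For \<open>P = 2\<close> inversion is trivial and the group abelian; this
      disposes of \<open>U_nm\<close> with \<open>m = 2\<close>.\<close>
    obtain z where "\<not> fixed z" using assms(1) by (rule not_fixed_if_not_comm)
    moreover have "fixed z" if "h = 1"
      unfolding fixed_iff_dvd by (simp add: assms(2-4) h \<open>h = 1\<close>)
    ultimately have "h \<noteq> 1" by blast
    with h1 have h2: "h \<ge> 2" by simp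
    then have a: "2 * (Q * (h - 1)) + 2 * Q = nat p * nat q"
      by (cases h) (simp_all add: np h algebra_simps)
    have F: "card (fixed_box p q r s) = 2 * Q"
        and K: "card (fixed_commutator_box p q r s) = (if even h then 2 else 1)"
      using inversion_boxes_even[of "int h" q] q h1 by (simp_all add: assms(2-5) h)
    show ?thesis
    proof (cases "even h")
      case True
      have profile: "clique_profile (ccc_graph G) (Q * (h - 1)) Q (2 * Q)"
        using K True by (intro clique_profile_if_not_comm[OF assms(1) F _ a]) simp_all
      show ?thesis
      proof (cases "h = 2")
        case True
        then show ?thesis using energies_equal[OF profile] Q by (simp add: h)
      next
        case False
        have "h \<ge> 4" using \<open>even h\<close> h2 False by presburger
        then have "Q * 3 \<le> Q * (h - 1)" by (intro mult_le_mono2) simp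
        then have "3 \<le> Q * (h - 1)" "Q + 2 * Q \<le> Q * (h - 1)" using Q by linarith+
        then have "increasing_energies (ccc_graph G)"
          by (intro energies_strictly_increasing[OF profile Q] disjI2 HOL.refl)
        then show ?thesis using \<open>h \<ge> 4\<close> by (simp add: h)
      qed
    next
      case False
      have profile: "clique_profile (ccc_graph G) (Q * (h - 1)) (2 * Q) (1 * (2 * Q))"
        using K False by (intro clique_profile_if_not_comm[OF assms(1) F _ a]) simp_all
      show ?thesis
      proof (cases "h = 3")
        case True
        then show ?thesis using energies_equal[OF profile] Q by (simp add: h)
      next
        case h3: False
        have "h \<ge> 5" using \<open>odd h\<close> h2 h3 by presburger
        then have "Q * 4 \<le> Q * (h - 1)" by (intro mult_le_mono2) simp
        then have "3 \<le> Q * (h - 1)" "2 * Q + 1 * (2 * Q) \<le> Q * (h - 1)" "1 \<le> 2 * Q" using Q by linarith+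
        then have "increasing_energies (ccc_graph G)"
          by (intro energies_strictly_increasing[OF profile] disjI1 HOL.refl)
        then show ?thesis using \<open>h \<ge> 5\<close> by (simp add: h)
      qed
    qed
  qed
qed

text \<open>The clique sizes are \<open>2 n - 1\<close> and 1 for even \<open>n\<close>, and
  \<open>2 n - 2\<close> and 4 for odd \<open>n\<close>; they agree only at
  \<open>n = 3\<close>.\<close>

lemma semidihedral_energies:
  assumes "\<not> comm_group G" "r = 2 * int n - 1" "s = 0" "p = 4 * int n" "q = 1" "n \<ge> 2"
  shows "if n = 3 then equal_energies (ccc_graph G) else increasing_energies (ccc_graph G)"
proof (cases "even n")
  case True
  have "card (fixed_box p q r s) = 2" "card (fixed_commutator_box p q r s) = 2"
    using semidihedral_boxes_even[of "int n"] True assms(6) by (simp_all add: assms(2-5))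
  then have "clique_profile (ccc_graph G) (2 * n - 1) 1 (2 * 1)"
    by (rule clique_profile_if_not_comm[OF assms(1)]) (use assms(6) in \<open>simp_all add: assms(4,5)\<close>)
  then have "increasing_energies (ccc_graph G)"
    using assms(6) by (intro energies_strictly_increasing[of _ "2 * n - 1" 1 2]) simp_all
  then show ?thesis using True by auto
next
  case False
  have "card (fixed_box p q r s) = 4" "card (fixed_commutator_box p q r s) = 1"
    using semidihedral_boxes_odd[of "int n"] False assms(6) by (simp_all add: assms(2-5))
  then have profile: "clique_profile (ccc_graph G) (2 * n - 2) 4 (1 * 4)"
    by (rule clique_profile_if_not_comm[OF assms(1)]) (use assms(6) in \<open>simp_all add: assms(4,5)\<close>)
  show ?thesis
  proof (cases "n = 3")
    case True
    then show ?thesis using energies_equal[OF profile] by simp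
  next
    case n3: False
    have "n \<ge> 5" using False assms(6) n3 by presburger
    then have "increasing_energies (ccc_graph G)"
      by (intro energies_strictly_increasing[OF profile]) simp_all
    then show ?thesis using n3 by simp
  qed
qed

text \<open>The clique sizes are \<open>2 n - 2\<close> and 2 for even \<open>n\<close>, and
  \<open>2 n - 1\<close> and 1 for odd \<open>n\<close>; they agree only at
  \<open>n = 2\<close>.\<close>

lemma V_energies:
  assumes "\<not> comm_group G" "r = - 1" "s = 1" "p = 2 * int n" "q = 2" "n \<ge> 2"
  shows "if n = 2 then equal_energies (ccc_graph G) else increasing_energies (ccc_graph G)"
proof (cases "even n")
  case True
  have "card (fixed_box p q r s) = 4" "card (fixed_commutator_box p q r s) = 2"
    using V_boxes_even[of "int n"] True assms(6) by (simp_all add: assms(2-5))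
  then have profile: "clique_profile (ccc_graph G) (2 * n - 2) 2 (2 * 2)"
    by (rule clique_profile_if_not_comm[OF assms(1)]) (use assms(6) in \<open>simp_all add: assms(4,5)\<close>)
  show ?thesis
  proof (cases "n = 2")
    case True
    then show ?thesis using energies_equal[OF profile] by simp
  next
    case n2: False
    have "n \<ge> 4" using True assms(6) n2 by presburger
    then have "increasing_energies (ccc_graph G)"
      by (intro energies_strictly_increasing[OF profile]) simp_all
    then show ?thesis using n2 by simp
  qed
next
  case False
  have "card (fixed_box p q r s) = 2" "card (fixed_commutator_box p q r s) = 2"
    using V_boxes_odd[of "int n"] False assms(6) by (simp_all add: assms(2-5))
  then have "clique_profile (ccc_graph G) (2 * n - 1) 1 (2 * 1)"
    by (rule clique_profile_if_not_comm[OF assms(1)]) (use assms(6) in \<open>simp_all add: assms(4,5)\<close>)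
  then have "increasing_energies (ccc_graph G)"
    using assms(6) by (intro energies_strictly_increasing[of _ "2 * n - 1" 1 2]) simp_all
  then show ?thesis using False by auto
qed

end

section \<open>The families\<close>

text \<open>The rotation \<open>x\<close> serves as \<open>u\<close> and the reflection
  \<open>y\<close> as \<open>t\<close>, with trivial \<open>v\<close>.\<close>

lemma D_2n_energies:
  fixes G :: "('a, 'b) monoid_scheme"
  assumes G: "group G" "\<not> comm_group G" "G \<cong> D_2n n" and n: "n \<ge> 3"
  shows "if n \<in> {3, 4, 5, 6} then equal_energies (ccc_graph G) else increasing_energies (ccc_graph G)"
proof -
  let ?R = "{(word_pow wx n, []), (word_pow wy 2, []), (wy @ wx @ wy_inv, wx_inv)}"
  obtain \<psi> where "presentation G ?R \<psi>"
    using presentation_exists[OF G(1) G(3)[unfolded D_2n_def]] .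
  then interpret presentation G ?R \<psi> .
  interpret ed: extension_data "int n" 1 "- 1" 0 0 GenX
    using n by unfold_locales simp_all
  note words = word_pow_2 word_inv_letter
  have rel: "ed.sim (ed.act (word_pow wx n) (i, j, e)) (ed.act [] (i, j, e))"
    "ed.sim (ed.act (word_pow wy 2) (i, j, e)) (ed.act [] (i, j, e))"
    "ed.sim (ed.act (wy @ wx @ wy_inv) (i, j, e)) (ed.act wx_inv (i, j, e))" for i j e
    unfolding ed.act_u_pow words by (cases e; simp)+
  have r: "\<psi> wy \<otimes>\<^bsub>G\<^esub> \<psi> wy = \<one>\<^bsub>G\<^esub>" "\<psi> wy \<otimes>\<^bsub>G\<^esub> \<psi> wx \<otimes>\<^bsub>G\<^esub> inv\<^bsub>G\<^esub> \<psi> wy = inv\<^bsub>G\<^esub> \<psi> wx"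
    using \<psi>_relation[of "word_pow wy 2" "[]"] \<psi>_relation[of "wy @ wx @ wy_inv" wx_inv]
    by (simp_all add: word_pow_2 \<psi>_Cons \<psi>_Cons_word_inv \<psi>_word_inv m_assoc)
  interpret index_two_presentation G ?R \<psi> "int n" 1 "- 1" 0 0 GenX GenY "[]"
  proof (intro index_two_presentation.intro index_two_presentation_axioms.intro
      presentation_axioms ed.extension_data_axioms)
    fix l l' :: "gen word" and z :: "int \<times> int \<times> bool"
    assume l: "(l, l') \<in> ?R"
    obtain i j e where z: "z = (i, j, e)" by (cases z)
    from l show "ed.sim (ed.act l z) (ed.act l' z)"
      unfolding insert_iff prod.inject empty_iff z by (elim disjE conjE) (simp_all only: rel)
  next
    show "\<psi> wy \<otimes>\<^bsub>G\<^esub> \<psi> wx = \<psi> wx [^]\<^bsub>G\<^esub> (- 1 :: int) \<otimes>\<^bsub>G\<^esub> \<psi> [] [^]\<^bsub>G\<^esub> (0 :: int) \<otimes>\<^bsub>G\<^esub> \<psi> wy"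
      using conj_swap[OF _ _ _ r(2)] by (simp add: int_pow_neg)
  qed (use r in \<open>simp_all add: \<psi>_pow_relation\<close>)
  show ?thesis
    using inversion_energies[of n 1] G(2) n by (auto simp: insert_commute)
qed

text \<open>The relation \<open>x^n = y^2\<close> enters as \<open>c = n\<close>; the other
  parameters are those of the dihedral group of the same order.\<close>

lemma T_4n_energies:
  fixes G :: "('a, 'b) monoid_scheme"
  assumes G: "group G" "\<not> comm_group G" "G \<cong> T_4n n" and n: "n \<ge> 2"
  shows "if n \<in> {2, 3} then equal_energies (ccc_graph G) else increasing_energies (ccc_graph G)"
proof -
  let ?R = "{(word_pow wx (2 * n), []), (word_pow wx n, word_pow wy 2), (wy_inv @ wx @ wy, wx_inv)}"
  obtain \<psi> where "presentation G ?R \<psi>"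
    using presentation_exists[OF G(1) G(3)[unfolded T_4n_def]] .
  then interpret presentation G ?R \<psi> .
  interpret ed: extension_data "2 * int n" 1 "- 1" 0 "int n" GenX
    using n by unfold_locales simp_all
  note words = word_pow_2 word_inv_letter
  have rel: "ed.sim (ed.act (word_pow wx (2 * n)) (i, j, e)) (ed.act [] (i, j, e))"
    "ed.sim (ed.act (word_pow wx n) (i, j, e)) (ed.act (word_pow wy 2) (i, j, e))"
    "ed.sim (ed.act (wy_inv @ wx @ wy) (i, j, e)) (ed.act wx_inv (i, j, e))" for i j e
    unfolding ed.act_u_pow words by (cases e; simp)+
  have r: "\<psi> wx [^]\<^bsub>G\<^esub> int n = \<psi> wy \<otimes>\<^bsub>G\<^esub> \<psi> wy" "inv\<^bsub>G\<^esub> \<psi> wy \<otimes>\<^bsub>G\<^esub> \<psi> wx \<otimes>\<^bsub>G\<^esub> \<psi> wy = inv\<^bsub>G\<^esub> \<psi> wx"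
    using \<psi>_relation[of "word_pow wx n" "word_pow wy 2"] \<psi>_relation[of "wy_inv @ wx @ wy" wx_inv]
    by (simp_all add: word_pow_2 \<psi>_word_pow int_pow_int
        \<psi>_Cons \<psi>_Cons_word_inv \<psi>_append[of wy_inv] \<psi>_word_inv m_assoc)
  interpret index_two_presentation G ?R \<psi> "2 * int n" 1 "- 1" 0 "int n" GenX GenY "[]"
  proof (intro index_two_presentation.intro index_two_presentation_axioms.intro
      presentation_axioms ed.extension_data_axioms)
    fix l l' :: "gen word" and z :: "int \<times> int \<times> bool"
    assume l: "(l, l') \<in> ?R"
    obtain i j e where z: "z = (i, j, e)" by (cases z)
    from l show "ed.sim (ed.act l z) (ed.act l' z)"
      unfolding insert_iff prod.inject empty_iff z by (elim disjE conjE) (simp_all only: rel)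
  next
    show "\<psi> wy \<otimes>\<^bsub>G\<^esub> \<psi> wx = \<psi> wx [^]\<^bsub>G\<^esub> (- 1 :: int) \<otimes>\<^bsub>G\<^esub> \<psi> [] [^]\<^bsub>G\<^esub> (0 :: int) \<otimes>\<^bsub>G\<^esub> \<psi> wy"
      using inv_conj_swap[OF _ _ r(2)] by (simp add: int_pow_neg)
    show "\<psi> wx [^]\<^bsub>G\<^esub> (2 * int n) = \<one>\<^bsub>G\<^esub>"
      using \<psi>_pow_relation[of wx "2 * n"] by simp
  qed (use r in simp_all)
  show ?thesis
    using inversion_energies[of "2 * n" 1] G(2) n by (auto split: if_splits)
qed

text \<open>The generators exchange roles: \<open>y\<close> is inverted and serves as
  \<open>u\<close>, \<open>x\<close> serves as \<open>t\<close>, and \<open>v = x^2\<close> is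
  central.\<close>

lemma U_nm_energies:
  fixes G :: "('a, 'b) monoid_scheme"
  assumes G: "group G" "\<not> comm_group G" "G \<cong> U_nm n m" and n: "n \<ge> 2" and m: "m \<ge> 2"
  shows "if m \<in> {3, 4, 6} then equal_energies (ccc_graph G) else increasing_energies (ccc_graph G)"
proof -
  let ?R = "{(word_pow wx (2 * n), []), (word_pow wy m, []), (wx_inv @ wy @ wx, wy_inv)}"
  obtain \<psi> where "presentation G ?R \<psi>"
    using presentation_exists[OF G(1) G(3)[unfolded U_nm_def]] .
  then interpret presentation G ?R \<psi> .
  interpret ed: extension_data "int m" "int n" "- 1" 0 0 GenY
    using n m by unfold_locales simp_all
  note words = word_pow_2 word_inv_letter
  \<comment> \<open>Two steps by \<open>x\<close> restore \<open>i\<close> and the bit and raise the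
    exponent of \<open>v\<close> by one, so \<open>x^(2 n)\<close> shifts it by \<open>n\<close>,
    which is 0 modulo \<open>q\<close>.\<close>
  have "(ed.act wx ^^ (2 * k)) (i, j, e) = (i, j + int k, e)" for k i j e
    by (induction k) simp_all
  then have "ed.act (word_pow wx (2 * n)) (i, j, e) = (i, j + int n, e)" for i j e
    by (simp only: ed.act_word_pow)
  then have rel: "ed.sim (ed.act (word_pow wx (2 * n)) (i, j, e)) (ed.act [] (i, j, e))"
    "ed.sim (ed.act (word_pow wy m) (i, j, e)) (ed.act [] (i, j, e))"
    "ed.sim (ed.act (wx_inv @ wy @ wx) (i, j, e)) (ed.act wy_inv (i, j, e))" for i j e
    unfolding ed.act_u_pow words by (cases e; simp)+
  have r: "inv\<^bsub>G\<^esub> \<psi> wx \<otimes>\<^bsub>G\<^esub> \<psi> wy \<otimes>\<^bsub>G\<^esub> \<psi> wx = inv\<^bsub>G\<^esub> \<psi> wy"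
    using \<psi>_relation[of "wx_inv @ wy @ wx" wy_inv]
    by (simp add: \<psi>_append[of wx_inv] \<psi>_Cons \<psi>_word_inv m_assoc)
  have xx: "\<psi> (wx @ wx) = \<psi> wx \<otimes>\<^bsub>G\<^esub> \<psi> wx" by (rule \<psi>_append)
  have swap: "\<psi> wx \<otimes>\<^bsub>G\<^esub> \<psi> wy = inv\<^bsub>G\<^esub> \<psi> wy \<otimes>\<^bsub>G\<^esub> \<psi> wx"
    by (rule inv_conj_swap[OF _ _ r]) simp_all
  have swap': "\<psi> wx \<otimes>\<^bsub>G\<^esub> inv\<^bsub>G\<^esub> \<psi> wy = \<psi> wy \<otimes>\<^bsub>G\<^esub> \<psi> wx"
    using conj_int_pow[OF _ _ _ swap, of "- 1"] by (simp add: int_pow_neg)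
  interpret index_two_presentation G ?R \<psi> "int m" "int n" "- 1" 0 0 GenY GenX "wx @ wx"
  proof (intro index_two_presentation.intro index_two_presentation_axioms.intro
      presentation_axioms ed.extension_data_axioms)
    fix l l' :: "gen word" and z :: "int \<times> int \<times> bool"
    assume l: "(l, l') \<in> ?R"
    obtain i j e where z: "z = (i, j, e)" by (cases z)
    from l show "ed.sim (ed.act l z) (ed.act l' z)"
      unfolding insert_iff prod.inject empty_iff z by (elim disjE conjE) (simp_all only: rel)
  next
    show "ed.sim (ed.act (wx @ wx) (i, j, e)) (i, j + 1, e)" for i j e
      by (cases e) simp_all
    show "\<psi> (wx @ wx) [^]\<^bsub>G\<^esub> int n = \<one>\<^bsub>G\<^esub>"
    proof -
      have "\<psi> (wx @ wx) = \<psi> wx [^]\<^bsub>G\<^esub> (2 :: int)"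
        unfolding xx using int_pow_mult[of "\<psi> wx" 1 1] by simp
      then show ?thesis using \<psi>_pow_relation[of wx "2 * n"] by (simp add: int_pow_pow)
    qed
    have "\<psi> wx \<otimes>\<^bsub>G\<^esub> (\<psi> wx \<otimes>\<^bsub>G\<^esub> \<psi> wy) = \<psi> wx \<otimes>\<^bsub>G\<^esub> inv\<^bsub>G\<^esub> \<psi> wy \<otimes>\<^bsub>G\<^esub> \<psi> wx"
      unfolding swap by (simp add: m_assoc)
    then show "\<psi> wy \<otimes>\<^bsub>G\<^esub> \<psi> (wx @ wx) = \<psi> (wx @ wx) \<otimes>\<^bsub>G\<^esub> \<psi> wy"
      unfolding xx swap' by (simp add: m_assoc)
    show "\<psi> wx \<otimes>\<^bsub>G\<^esub> \<psi> wy = \<psi> wy [^]\<^bsub>G\<^esub> (- 1 :: int) \<otimes>\<^bsub>G\<^esub> \<psi> (wx @ wx) [^]\<^bsub>G\<^esub> (0 :: int) \<otimes>\<^bsub>G\<^esub> \<psi> wx"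
      using swap by (simp add: int_pow_neg)
  qed (simp_all add: \<psi>_pow_relation \<psi>_Cons m_assoc)
  show ?thesis
    using inversion_energies[of m n] G(2) n m by simp
qed

lemma SD_8n_energies:
  fixes G :: "('a, 'b) monoid_scheme"
  assumes G: "group G" "\<not> comm_group G" "G \<cong> SD_8n n" and n: "n \<ge> 2"
  shows "if n = 3 then equal_energies (ccc_graph G) else increasing_energies (ccc_graph G)"
proof -
  let ?R = "{(word_pow wx (4 * n), []), (word_pow wy 2, []), (wy @ wx @ wy, word_pow wx (2 * n - 1))}"
  obtain \<psi> where "presentation G ?R \<psi>"
    using presentation_exists[OF G(1) G(3)[unfolded SD_8n_def]] .
  then interpret presentation G ?R \<psi> .
  \<comment> \<open>Twofold conjugation by \<open>y\<close> must be trivial on \<open>x\<close>: the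
    exponent \<open>2 * n - 1\<close> squares to 1 modulo \<open>4 * n\<close>.\<close>
  have "(2 * int n - 1) * (2 * int n - 1) - 1 = 4 * int n * (int n - 1)" by (simp add: algebra_simps)
  then have sq: "4 * int n dvd (2 * int n - 1) * (2 * int n - 1) - 1" by simp
  interpret ed: extension_data "4 * int n" 1 "2 * int n - 1" 0 0 GenX
    using n sq by unfold_locales simp_all
  have k: "int (2 * n - 1) = 2 * int n - 1" using n by simp
  have sq': "4 * int n dvd (2 * int n - 1) * ((2 * int n - 1) * i) - i" for i
    using dvd_mult2[OF sq, of i] by (simp add: algebra_simps)
  have sq'': "4 * int n dvd (2 * int n - 1) * ((2 * int n - 1) * i + 1) - (i + (2 * int n - 1))" for i
    using sq'[of i] by (simp add: algebra_simps)
  have rel: "ed.sim (ed.act (word_pow wx (4 * n)) (i, j, e)) (ed.act [] (i, j, e))"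
    "ed.sim (ed.act (word_pow wy 2) (i, j, e)) (ed.act [] (i, j, e))"
    "ed.sim (ed.act (wy @ wx @ wy) (i, j, e)) (ed.act (word_pow wx (2 * n - 1)) (i, j, e))" for i j e
    unfolding ed.act_u_pow word_pow_2 k using sq'[of i] sq''[of i] by (cases e; simp)+
  have r: "\<psi> wy \<otimes>\<^bsub>G\<^esub> \<psi> wy = \<one>\<^bsub>G\<^esub>"
      "\<psi> wy \<otimes>\<^bsub>G\<^esub> \<psi> wx \<otimes>\<^bsub>G\<^esub> \<psi> wy = \<psi> wx [^]\<^bsub>G\<^esub> (2 * int n - 1)"
    using \<psi>_relation[of "word_pow wy 2" "[]"] \<psi>_relation[of "wy @ wx @ wy" "word_pow wx (2 * n - 1)"]
    unfolding k[symmetric] int_pow_int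
    by (simp_all add: word_pow_2 \<psi>_word_pow \<psi>_Cons \<psi>_Cons_word_inv m_assoc)
  have inv: "inv\<^bsub>G\<^esub> \<psi> wy = \<psi> wy" using r(1) by (intro inv_equality) simp_all
  interpret index_two_presentation G ?R \<psi> "4 * int n" 1 "2 * int n - 1" 0 0 GenX GenY "[]"
  proof (intro index_two_presentation.intro index_two_presentation_axioms.intro
      presentation_axioms ed.extension_data_axioms)
    fix l l' :: "gen word" and z :: "int \<times> int \<times> bool"
    assume l: "(l, l') \<in> ?R"
    obtain i j e where z: "z = (i, j, e)" by (cases z)
    from l show "ed.sim (ed.act l z) (ed.act l' z)"
      unfolding insert_iff prod.inject empty_iff z by (elim disjE conjE) (simp_all only: rel)
  next
    show "\<psi> wy \<otimes>\<^bsub>G\<^esub> \<psi> wx = \<psi> wx [^]\<^bsub>G\<^esub> (2 * int n - 1) \<otimes>\<^bsub>G\<^esub> \<psi> [] [^]\<^bsub>G\<^esub> (0 :: int) \<otimes>\<^bsub>G\<^esub> \<psi> wy"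
      using conj_swap[of "\<psi> wx" "\<psi> wy" "\<psi> wx [^]\<^bsub>G\<^esub> (2 * int n - 1)"] r(2) by (simp add: inv)
    show "\<psi> wx [^]\<^bsub>G\<^esub> (4 * int n) = \<one>\<^bsub>G\<^esub>"
      using \<psi>_pow_relation[of wx "4 * n"] by simp
  qed (use r in simp_all)
  show ?thesis
    using semidihedral_energies[of n] G(2) n by simp
qed

text \<open>Here \<open>v = y^2\<close>. By \<open>y^4 = 1\<close> the relation
  \<open>y x = x^-1 y^-1\<close> reads \<open>y x = x^-1 y^2 y\<close>, whence \<open>s = 1\<close>
  and \<open>q = 2\<close>.\<close>

lemma V_8n_energies:
  fixes G :: "('a, 'b) monoid_scheme"
  assumes G: "group G" "\<not> comm_group G" "G \<cong> V_8n n" and n: "n \<ge> 2"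
  shows "if n = 2 then equal_energies (ccc_graph G) else increasing_energies (ccc_graph G)"
proof -
  let ?R = "{(word_pow wx (2 * n), []), (word_pow wy 4, []),
      (wy @ wx, wx_inv @ wy_inv), (wy_inv @ wx, wx_inv @ wy)}"
  obtain \<psi> where "presentation G ?R \<psi>"
    using presentation_exists[OF G(1) G(3)[unfolded V_8n_def]] .
  then interpret presentation G ?R \<psi> .
  interpret ed: extension_data "2 * int n" 2 "- 1" 1 0 GenX
    using n by unfold_locales simp_all
  note words = word_pow_4 word_inv_letter
  have rel: "ed.sim (ed.act (word_pow wx (2 * n)) (i, j, e)) (ed.act [] (i, j, e))"
    "ed.sim (ed.act (word_pow wy 4) (i, j, e)) (ed.act [] (i, j, e))"
    "ed.sim (ed.act (wy @ wx) (i, j, e)) (ed.act (wx_inv @ wy_inv) (i, j, e))"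
    "ed.sim (ed.act (wy_inv @ wx) (i, j, e)) (ed.act (wx_inv @ wy) (i, j, e))" for i j e
    unfolding ed.act_u_pow words by (cases e; simp)+
  let ?x = "\<psi> wx" and ?y = "\<psi> wy"
  have yy: "\<psi> (wy @ wy) = ?y \<otimes>\<^bsub>G\<^esub> ?y" by (rule \<psi>_append)
  have r: "?y \<otimes>\<^bsub>G\<^esub> ?x = inv\<^bsub>G\<^esub> ?x \<otimes>\<^bsub>G\<^esub> inv\<^bsub>G\<^esub> ?y"
      "inv\<^bsub>G\<^esub> ?y \<otimes>\<^bsub>G\<^esub> ?x = inv\<^bsub>G\<^esub> ?x \<otimes>\<^bsub>G\<^esub> ?y"
    using \<psi>_relation[of "wy @ wx" "wx_inv @ wy_inv"] \<psi>_relation[of "wy_inv @ wx" "wx_inv @ wy"]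
    by (simp_all add: \<psi>_Cons \<psi>_append[of wx_inv] \<psi>_append[of wy_inv] \<psi>_word_inv)
  have "?y \<otimes>\<^bsub>G\<^esub> (?y \<otimes>\<^bsub>G\<^esub> (?y \<otimes>\<^bsub>G\<^esub> ?y)) = \<one>\<^bsub>G\<^esub>"
    using \<psi>_relation[of "word_pow wy 4" "[]"] by (simp add: word_pow_4 \<psi>_Cons)
  then have y4: "?y \<otimes>\<^bsub>G\<^esub> ?y \<otimes>\<^bsub>G\<^esub> (?y \<otimes>\<^bsub>G\<^esub> ?y) = \<one>\<^bsub>G\<^esub>" "?y \<otimes>\<^bsub>G\<^esub> ?y \<otimes>\<^bsub>G\<^esub> ?y \<otimes>\<^bsub>G\<^esub> ?y = \<one>\<^bsub>G\<^esub>"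
    by (simp_all add: m_assoc)
  have inv_y: "inv\<^bsub>G\<^esub> ?y = ?y \<otimes>\<^bsub>G\<^esub> ?y \<otimes>\<^bsub>G\<^esub> ?y" using y4(2) by (intro inv_equality) simp_all
  have inv_yy: "inv\<^bsub>G\<^esub> ?y \<otimes>\<^bsub>G\<^esub> inv\<^bsub>G\<^esub> ?y = ?y \<otimes>\<^bsub>G\<^esub> ?y"
    using y4(1) inv_equality[of "?y \<otimes>\<^bsub>G\<^esub> ?y" "?y \<otimes>\<^bsub>G\<^esub> ?y"] by (simp add: inv_mult_group)
  \<comment> \<open>The relation \<open>y^-1 x = x^-1 y\<close> rearranges to
    \<open>y x^-1 = x y^-1\<close>. With the other relation,
    \<open>y^2 x = y x^-1 y^-1 = x y^-2 = x y^2\<close>, so \<open>y^2\<close> commutes with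
    \<open>x\<close>.\<close>
  have "?y \<otimes>\<^bsub>G\<^esub> inv\<^bsub>G\<^esub> ?x = ?x \<otimes>\<^bsub>G\<^esub> inv\<^bsub>G\<^esub> ?y"
  proof -
    have "inv\<^bsub>G\<^esub> (inv\<^bsub>G\<^esub> ?x) \<otimes>\<^bsub>G\<^esub> (inv\<^bsub>G\<^esub> ?y \<otimes>\<^bsub>G\<^esub> ?x) = ?y"
      unfolding r(2) by (simp flip: m_assoc)
    then have "?y \<otimes>\<^bsub>G\<^esub> inv\<^bsub>G\<^esub> ?x =
        inv\<^bsub>G\<^esub> (inv\<^bsub>G\<^esub> ?x) \<otimes>\<^bsub>G\<^esub> (inv\<^bsub>G\<^esub> ?y \<otimes>\<^bsub>G\<^esub> ?x) \<otimes>\<^bsub>G\<^esub> inv\<^bsub>G\<^esub> ?x"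
      by (simp only:)
    then show ?thesis by (simp add: m_assoc)
  qed
  then have comm: "?x \<otimes>\<^bsub>G\<^esub> (?y \<otimes>\<^bsub>G\<^esub> ?y) = ?y \<otimes>\<^bsub>G\<^esub> ?y \<otimes>\<^bsub>G\<^esub> ?x"
  proof -
    assume yx: "?y \<otimes>\<^bsub>G\<^esub> inv\<^bsub>G\<^esub> ?x = ?x \<otimes>\<^bsub>G\<^esub> inv\<^bsub>G\<^esub> ?y"
    have "?y \<otimes>\<^bsub>G\<^esub> ?y \<otimes>\<^bsub>G\<^esub> ?x = ?y \<otimes>\<^bsub>G\<^esub> (?y \<otimes>\<^bsub>G\<^esub> ?x)" by (simp add: m_assoc)
    also have "\<dots> = ?y \<otimes>\<^bsub>G\<^esub> inv\<^bsub>G\<^esub> ?x \<otimes>\<^bsub>G\<^esub> inv\<^bsub>G\<^esub> ?y" unfolding r(1) by (simp add: m_assoc)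
    also have "\<dots> = ?x \<otimes>\<^bsub>G\<^esub> (inv\<^bsub>G\<^esub> ?y \<otimes>\<^bsub>G\<^esub> inv\<^bsub>G\<^esub> ?y)" unfolding yx by (simp add: m_assoc)
    finally show ?thesis unfolding inv_yy by simp
  qed
  interpret index_two_presentation G ?R \<psi> "2 * int n" 2 "- 1" 1 0 GenX GenY "wy @ wy"
  proof (intro index_two_presentation.intro index_two_presentation_axioms.intro
      presentation_axioms ed.extension_data_axioms)
    fix l l' :: "gen word" and z :: "int \<times> int \<times> bool"
    assume l: "(l, l') \<in> ?R"
    obtain i j e where z: "z = (i, j, e)" by (cases z)
    from l show "ed.sim (ed.act l z) (ed.act l' z)"
      unfolding insert_iff prod.inject empty_iff z by (elim disjE conjE) (simp_all only: rel)
  next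
    show "ed.sim (ed.act (wy @ wy) (i, j, e)) (i, j + 1, e)" for i j e
      by (cases e) simp_all
    show "?x [^]\<^bsub>G\<^esub> (2 * int n) = \<one>\<^bsub>G\<^esub>" using \<psi>_pow_relation[of wx "2 * n"] by simp
    show "\<psi> (wy @ wy) [^]\<^bsub>G\<^esub> (2 :: int) = \<one>\<^bsub>G\<^esub>"
      unfolding yy using int_pow_mult[of "?y \<otimes>\<^bsub>G\<^esub> ?y" 1 1] y4(1) by simp
    show "?y \<otimes>\<^bsub>G\<^esub> ?x = ?x [^]\<^bsub>G\<^esub> (- 1 :: int) \<otimes>\<^bsub>G\<^esub> \<psi> (wy @ wy) [^]\<^bsub>G\<^esub> (1 :: int) \<otimes>\<^bsub>G\<^esub> ?y"
      unfolding yy r(1) inv_y by (simp add: int_pow_neg m_assoc)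
  qed (use comm in \<open>simp_all add: \<psi>_Cons m_assoc\<close>)
  show ?thesis
    using V_energies[of n] G(2) n by simp
qed

theorem corollary3p11:
  fixes G :: "('a, 'b) monoid_scheme"
  assumes "group G" and "\<not> comm_group G"
    and "(\<exists>n\<ge>3. G \<cong> D_2n n) \<or> (\<exists>n\<ge>2. G \<cong> T_4n n) \<or> (\<exists>n\<ge>2. G \<cong> U_6n n) \<or>
      (\<exists>n\<ge>2. G \<cong> SD_8n n) \<or> (\<exists>n\<ge>2. G \<cong> V_8n n) \<or> (\<exists>n\<ge>2. \<exists>m\<ge>2. G \<cong> U_nm n m)"
  shows "(E_CN (ccc_graph G) = LE_plus_CN (ccc_graph G) \<and>
          LE_plus_CN (ccc_graph G) = LE_CN (ccc_graph G) \<longleftrightarrow> in_equality_list G) \<and>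
         (E_CN (ccc_graph G) < LE_plus_CN (ccc_graph G) \<and>
          LE_plus_CN (ccc_graph G) < LE_CN (ccc_graph G) \<longleftrightarrow> \<not> in_equality_list G)"
proof -
  note energies = D_2n_energies[OF assms(1,2)] T_4n_energies[OF assms(1,2)] U_nm_energies[OF assms(1,2)]
    SD_8n_energies[OF assms(1,2)] V_8n_energies[OF assms(1,2)]
  have U6: "U_6n n = U_nm n 3" for n by (simp add: U_6n_def U_nm_def)
  have list: "equal_energies (ccc_graph G)" if "in_equality_list G"
    using \<open>in_equality_list G\<close> unfolding in_equality_list_def U6
  proof (elim disjE exE conjE bexE)
    fix n m :: nat assume "n \<ge> 2" "m \<in> {3, 4, 6}" "G \<cong> U_nm n m"
    then show ?thesis using energies(3)[of n m] by auto
  qed (use energies(1)[of 3] energies(1)[of 4] energies(1)[of 5] energies(1)[of 6]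
      energies(2)[of 2] energies(2)[of 3] energies(3)[of _ 3] energies(4)[of 3] energies(5)[of 2] in simp_all)
  \<comment> \<open>Equality and strict increase exclude each other, so this alternative together
    with \<open>list\<close> yields both equivalences. No isomorphism between a listed and an
    unlisted group has to be ruled out by hand.\<close>
  have "in_equality_list G \<or> increasing_energies (ccc_graph G)"
    using assms(3) unfolding U6
  proof (elim disjE exE conjE)
    fix n :: nat assume n: "n \<ge> 3" "G \<cong> D_2n n"
    show ?thesis
    proof (cases "n \<in> {3, 4, 5, 6}")
      case True
      with n(2) show ?thesis unfolding in_equality_list_def by blast
    qed (use energies(1)[OF n(2,1)] in simp)
  next
    fix n :: nat assume n: "n \<ge> 2" "G \<cong> T_4n n"
    show ?thesis
    proof (cases "n \<in> {2, 3}")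
      case True
      with n(2) show ?thesis unfolding in_equality_list_def by blast
    qed (use energies(2)[OF n(2,1)] in simp)
  next
    fix n :: nat assume n: "n \<ge> 2" "G \<cong> U_nm n 3"
    then show ?thesis unfolding in_equality_list_def by blast
  next
    fix n :: nat assume n: "n \<ge> 2" "G \<cong> SD_8n n"
    show ?thesis
    proof (cases "n = 3")
      case True
      with n(2) show ?thesis unfolding in_equality_list_def by blast
    qed (use energies(4)[OF n(2,1)] in simp)
  next
    fix n :: nat assume n: "n \<ge> 2" "G \<cong> V_8n n"
    show ?thesis
    proof (cases "n = 2")
      case True
      with n(2) show ?thesis unfolding in_equality_list_def by blast
    qed (use energies(5)[OF n(2,1)] in simp)
  next
    fix n m :: nat assume n: "n \<ge> 2" "m \<ge> 2" "G \<cong> U_nm n m"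
    show ?thesis
    proof (cases "m \<in> {3, 4, 6}")
      case True
      with n show ?thesis unfolding in_equality_list_def by blast
    qed (use energies(3)[OF n(3,1,2)] in simp)
  qed
  then show ?thesis using list by auto
qed

end
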